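(* Let $r\geq 1$, $b\geq 5$, $n\geq 2^{r+1}$ be integers, let $q=2^b$, and let $X=X^{r,b,n}$ be the rank-$r$ $\mathbb{F}_2$-Grassmannian complex defined in the context. Then the local expansion of $X$ satisfies $$\lambda(X)\leq\frac{11}{q}.$$
   Context: **Grassmannian complexes.** An $\mathbb{F}_2$-Grassmannian complex $X$ in an ambient $\mathbb{F}_2$-vector space is a collection of linear subspaces closed under taking subspaces, ordered by inclusion, with $\mathrm{rank}(x)=\dim(x)-1$. $X(i)$ is the set of rank-$i$ elements, and the rank $r$ of $X$ is the maximum rank of an element; every element lies in a rank-$r$ element. $X$ carries a weight function $m_X$ restricting to a probability distribution on each $X(i)$. **Local expansion.** For a graph with nonnegative edge weights, $\lambda(\mathbf G)$ is the second largest absolute value of an eigenvalue (with multiplicity) of its random walk matrix $\mathbf W_{v,v'}=m(v,v')/\deg(v)$. The link of $x\in X$ is $X_x=\{x'\in X:x\subseteq x'\}$, with rank function $\mathrm{rank}(x')-\mathrm{rank}(x)-1$ and weights those of $X$ renormalized to a probability distribution in each rank. The 1-skeleton graph $\mathbf G_X$ has vertex set $X(0)$, an edge $\{x_0,x_0'\}$ for distinct $x_0,x_0'$ lying in a common $x_1\in X(1)$, and edge weight $\sum_{x_1\in X(1):x_0,x_0'\subset x_1}m_X(x_1)$. Put $\lambda^{(i)}(X)=\max_{x\in X(i)}\lambda(\mathbf G_{X_x})$ and $\lambda(X)=\max_{-1\leq i\leq r-2}\lambda^{(i)}(X)$. **The complex $X^{r,b,n}$.** Let $q=2^b$; view $\mathbb{F}_q^{n}\otimes\mathbb{F}_q^n=\mathbb{F}_q^{n\times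 n}\cong\mathbb{F}_2^{bn^2}$ as an $\mathbb{F}_2$-vector space, $e\otimes f$ being the rank-1 matrix $ef^\top$. Let $G^{(r)}_{\mathrm{Had}}\in\mathbb{F}_2^{(2^{r+1}-1)\times(r+1)}$ be the matrix whose $k$th row ($1\leq k\leq 2^{r+1}-1$) is the binary representation of $2^{r+1}-k$, most significant bit first. The rank-$r$ faces of $X^{r,b,n}$ are the $(r+1)$-dimensional $\mathbb{F}_2$-subspaces of the form $\{\sum_{k}(G^{(r)}_{\mathrm{Had}}u)_k\, e^{(1)}_k\otimes e^{(2)}_k:u\in\mathbb{F}_2^{r+1}\}$, where $e^{(\ell)}_k\in\mathbb{F}_q^n$ ($1\le k\le 2^{r+1}-1$, $\ell\in\{1,2\}$) are any vectors such that for each $\ell$ the vectors $e^{(\ell)}_1,\dots,e^{(\ell)}_{2^{r+1}-1}$ are linearly independent over $\mathbb{F}_q$. $X^{r,b,n}$ is the set of all subspaces of such faces; weights are uniform in each rank. *)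

theory Defs
  imports
    "HOL-Analysis.Cartesian_Space"
    "HOL-Library.Z2"
    "Jordan_Normal_Form.Char_Poly"
begin

no_notation Matrix.vec_index (infixl \<open>$\<close> 100)
no_notation Matrix.scalar_prod (infix \<open>\<bullet>\<close> 70)

text \<open>On an abelian group of exponent two this is the unique structure of a vector space over
  the field \<^typ>\<open>bit\<close>; compare \<open>vector_space_f2_scale\<close>.\<close>

definition f2_scale :: "bit \<Rightarrow> 'v::ab_group_add \<Rightarrow> 'v"
  where "f2_scale c v = (if c = 1 then v else 0)"

abbreviation f2_subspace :: "'v::ab_group_add set \<Rightarrow> bool"
  where "f2_subspace \<equiv> module.subspace f2_scale"

abbreviation f2_dim :: "'v::ab_group_add set \<Rightarrow> nat"
  where "f2_dim \<equiv> vector_space.dim f2_scale"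

lemma vector_space_f2_scale:
  assumes "\<And>v :: 'v::ab_group_add. v + v = 0"
  shows "vector_space (f2_scale :: bit \<Rightarrow> 'v \<Rightarrow> 'v)"
proof
  fix a b :: bit and x y :: 'v
  show "f2_scale a (x + y) = f2_scale a x + f2_scale a y"
    by (simp add: f2_scale_def)
  show "f2_scale (a + b) x = f2_scale a x + f2_scale b x"
    by (cases a; cases b) (simp_all add: f2_scale_def assms)
  show "f2_scale a (f2_scale b x) = f2_scale (a * b) x"
    by (cases a; cases b) (simp_all add: f2_scale_def)
  show "f2_scale 1 x = x" by (simp add: f2_scale_def)
qed

lemma exponent_two_matrix:
  fixes A :: "'q::{field,finite} ^ 'n ^ 'n"
  assumes "CARD('q) = 2 ^ b"
  shows "A + A = 0"
proof -
  have "(\<Sum>x\<in>(UNIV::'q set). x + 1) = (\<Sum>x\<in>UNIV. x)"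
    by (rule sum.reindex_bij_betw) (auto intro!: bij_betw_byWitness[where f'="\<lambda>x. x - 1"])
  hence "(of_nat CARD('q) :: 'q) = 0" by (simp add: sum.distrib)
  hence "(2::'q) ^ b = 0" by (simp add: assms)
  hence "(2::'q) = 0" by simp
  hence "x + x = 0" for x :: 'q by (metis mult_2 mult_zero_left)
  thus ?thesis by (simp add: Finite_Cartesian_Product.vec_eq_iff)
qed

text \<open>The rank function is part of the data because the link of an element keeps the same
  subspaces but shifts their ranks.\<close>

record 'v weighted_complex =
  elems :: "'v set set"
  rk :: "'v set \<Rightarrow> int"
  wt :: "'v set \<Rightarrow> real"

definition level :: "'v weighted_complex \<Rightarrow> int \<Rightarrow> 'v set set"
  where "level X i = {x \<in> elems X. rk X x = i}"

definition complex_rank :: "'v weighted_complex \<Rightarrow> int"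
  where "complex_rank X = Max (rk X ` elems X)"

definition grassmannian_complex :: "'v::ab_group_add weighted_complex \<Rightarrow> bool"
  where "grassmannian_complex X \<longleftrightarrow>
    vector_space (f2_scale :: bit \<Rightarrow> 'v \<Rightarrow> 'v) \<and>
    elems X \<noteq> {} \<and> finite (elems X) \<and>
    (\<forall>x\<in>elems X. f2_subspace x) \<and>
    (\<forall>x\<in>elems X. \<forall>y. f2_subspace y \<and> y \<subseteq> x \<longrightarrow> y \<in> elems X) \<and>
    (\<forall>x\<in>elems X. rk X x = int (f2_dim x) - 1) \<and>
    (\<forall>x\<in>elems X. \<exists>y\<in>level X (complex_rank X). x \<subseteq> y) \<and>
    (\<forall>x\<in>elems X. 0 \<le> wt X x) \<and>
    (\<forall>i\<in>{-1..complex_rank X}. (\<Sum>x\<in>level X i. wt X x) = 1)"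

definition link :: "'v weighted_complex \<Rightarrow> 'v set \<Rightarrow> 'v weighted_complex"
  where "link X x =
    (let L = {x' \<in> elems X. x \<subseteq> x'} in
     \<lparr>elems = L,
      rk = (\<lambda>x'. rk X x' - rk X x - 1),
      wt = (\<lambda>x'. wt X x' / (\<Sum>x''\<in>{x'' \<in> L. rk X x'' = rk X x'}. wt X x''))\<rparr>)"

text \<open>A weighted graph is given by its vertex set and a weight function on pairs of vertices that
  vanishes off the edges. Its random walk matrix is written down in an arbitrary enumeration of
  the vertices; the characteristic polynomial does not depend on it.\<close>

definition vertex_list :: "'a set \<Rightarrow> 'a list"
  where "vertex_list V = (SOME vs. distinct vs \<and> set vs = V)"

definition degree_in :: "'a set \<Rightarrow> ('a \<Rightarrow> 'a \<Rightarrow> real) \<Rightarrow> 'a \<Rightarrow> real"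
  where "degree_in V m v = (\<Sum>v'\<in>V. m v v')"

definition walk_matrix :: "'a set \<Rightarrow> ('a \<Rightarrow> 'a \<Rightarrow> real) \<Rightarrow> complex mat"
  where "walk_matrix V m =
    mat (card V) (card V) (\<lambda>(i, j).
      let v = vertex_list V ! i; v' = vertex_list V ! j
      in complex_of_real (m v v' / degree_in V m v))"

definition graph_lambda :: "'a set \<Rightarrow> ('a \<Rightarrow> 'a \<Rightarrow> real) \<Rightarrow> real"
  where "graph_lambda V m =
    rev (sorted_list_of_multiset
      (image_mset cmod (proots (char_poly (walk_matrix V m))))) ! 1"

definition skeleton_weight :: "'v weighted_complex \<Rightarrow> 'v set \<Rightarrow> 'v set \<Rightarrow> real"
  where "skeleton_weight X x y =
    (if x = y then 0 else \<Sum>z\<in>{z \<in> level X 1. x \<subset> z \<and> y \<subset> z}. wt X z)"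

definition skeleton_lambda :: "'v weighted_complex \<Rightarrow> real"
  where "skeleton_lambda X = graph_lambda (level X 0) (skeleton_weight X)"

definition local_expansion_at :: "'v weighted_complex \<Rightarrow> int \<Rightarrow> real"
  where "local_expansion_at X i = Max ((\<lambda>x. skeleton_lambda (link X x)) ` level X i)"

definition local_expansion :: "'v weighted_complex \<Rightarrow> real"
  where "local_expansion X = Max (local_expansion_at X ` {-1..complex_rank X - 2})"

text \<open>Rows are indexed from 0, so row \<open>i\<close> below is the row number \<open>k = i + 1\<close>. Column \<open>j\<close>
  holds the bit of weight \<open>2 ^ (r - j)\<close> (most significant bit first).\<close>

definition had_matrix :: "nat \<Rightarrow> bit mat"
  where "had_matrix r =
    mat (2 ^ (r + 1) - 1) (r + 1)
      (\<lambda>(i, j). of_bool (Bit_Operations.bit (2 ^ (r + 1) - (i + 1) :: nat) (r - j)))"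

definition outer :: "'q::times ^ 'n \<Rightarrow> 'q ^ 'n \<Rightarrow> 'q ^ 'n ^ 'n"
  where "outer e f = (\<chi> i j. e $ i * f $ j)"

definition indep_family :: "nat set \<Rightarrow> (nat \<Rightarrow> 'q::field ^ 'n) \<Rightarrow> bool"
  where "indep_family K e \<longleftrightarrow> inj_on e K \<and> vec.independent (e ` K)"

definition had_face ::
    "nat \<Rightarrow> (nat \<Rightarrow> 'q::field ^ 'n) \<Rightarrow> (nat \<Rightarrow> 'q ^ 'n) \<Rightarrow> ('q ^ 'n ^ 'n) set"
  where "had_face r e f =
    {\<Sum>k<2 ^ (r + 1) - 1. f2_scale (vec_index (had_matrix r *\<^sub>v u) k) (outer (e k) (f k))
      | u. u \<in> carrier_vec (r + 1)}"

definition had_faces :: "nat \<Rightarrow> ('q::field ^ 'n ^ 'n) set set"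
  where "had_faces r =
    {F. f2_subspace F \<and> f2_dim F = r + 1 \<and>
      (\<exists>e f. indep_family {..<2 ^ (r + 1) - 1} e \<and> indep_family {..<2 ^ (r + 1) - 1} f \<and>
         F = had_face r e f)}"

text \<open>The numbers \<open>q\<close> and \<open>n\<close> are the cardinalities of the type parameters.\<close>

definition had_complex :: "nat \<Rightarrow> ('q::field ^ 'n ^ 'n) weighted_complex"
  where "had_complex r =
    (let S = {x. f2_subspace x \<and> (\<exists>F\<in>had_faces r. x \<subseteq> F)};
         \<rho> = (\<lambda>x. int (f2_dim x) - 1)
     in \<lparr>elems = S, rk = \<rho>, wt = (\<lambda>x. 1 / card {y \<in> S. \<rho> y = \<rho> x})\<rparr>)"

lemma had_faces_nonempty:
  assumes q: "CARD('q::{field,finite}) = 2 ^ b"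
    and n: "2 ^ (r + 1) - 1 \<le> CARD('n::finite)"
  shows "(had_faces r :: ('q ^ 'n ^ 'n) set set) \<noteq> {}"
proof -
  interpret V: vector_space "f2_scale :: bit \<Rightarrow> 'q ^ 'n ^ 'n \<Rightarrow> 'q ^ 'n ^ 'n"
    by (intro vector_space_f2_scale exponent_two_matrix[OF q])
  define K :: nat where "K = 2 ^ (r + 1) - 1"
  obtain g :: "nat \<Rightarrow> 'n" where g: "inj_on g {..<K}"
    using n card_le_inj[of "{..<K}" "UNIV :: 'n set"] unfolding K_def by auto
  define e :: "nat \<Rightarrow> 'q ^ 'n" where "e = (\<lambda>k. axis (g k) 1)"
  have e: "indep_family {..<K} e"
    unfolding indep_family_def
  proof
    show "inj_on e {..<K}"
      using g by (auto simp: e_def inj_on_def axis_eq_axis)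
    have "e ` {..<K} \<subseteq> cart_basis" by (auto simp: e_def cart_basis_def)
    thus "vec.independent (e ` {..<K})"
      using vec.independent_mono independent_cart_basis by blast
  qed
  define h where "h = (\<lambda>k j. had_matrix r $$ (k, j))"
  define P where "P = (\<lambda>k. outer (e k) (e k))"
  define M where "M = (\<lambda>j. \<Sum>k<K. f2_scale (h k j) (P k))"
  define N where "N = (\<lambda>c. \<Sum>j<r + 1. f2_scale (c j) (M j))"
  have N: "N c = (\<Sum>k<K. f2_scale (\<Sum>j<r + 1. h k j * c j) (P k))" for c
  proof -
    have "N c = (\<Sum>j<r + 1. \<Sum>k<K. f2_scale (h k j * c j) (P k))"
      unfolding N_def M_def by (simp only: V.scale_sum_right V.scale_scale mult.commute)
    also have "\<dots> = (\<Sum>k<K. \<Sum>j<r + 1. f2_scale (h k j * c j) (P k))"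
      by (rule sum.swap)
    finally show ?thesis by (simp only: V.scale_sum_left)
  qed
  have face: "had_face r e e = range N"
  proof -
    have *: "(\<Sum>k<K. f2_scale (vec_index (had_matrix r *\<^sub>v u) k) (outer (e k) (e k)))
        = N (vec_index u)" if "u \<in> carrier_vec (r + 1)" for u
      unfolding N P_def h_def using that
      by (intro sum.cong refl arg_cong2[where f = f2_scale])
        (auto simp: K_def had_matrix_def Matrix.scalar_prod_def atLeast0LessThan
          intro!: sum.cong)
    have **: "N c = N (vec_index (Matrix.vec (r + 1) c))" for c
      unfolding N_def by (intro sum.cong) auto
    show ?thesis
      unfolding had_face_def K_def[symmetric]
      using * ** by (auto simp: image_iff) (metis vec_carrier)+
  qed
  have entry: "N c $ g k $ g k = (if (\<Sum>j<r + 1. h k j * c j) = 1 then 1 else 0)"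
    if "k < K" for c k
  proof -
    have "f2_scale a (P l) $ g k $ g k = (if l = k then (if a = 1 then 1 else 0) else 0)"
      if "l < K" for a l
      using that \<open>k < K\<close> inj_onD[OF g, of l k]
      by (auto simp: f2_scale_def P_def outer_def e_def axis_def)
    thus ?thesis using that unfolding N by (simp add: sum.delta)
  qed
  have row: "(\<Sum>j<r + 1. h (2 ^ (r + 1) - 2 ^ (r - i) - 1) j * c j) = c i"
    "2 ^ (r + 1) - 2 ^ (r - i) - 1 < K" if "i < r + 1" for i c
  proof -
    have lt: "(2::nat) ^ (r - i) < 2 ^ (r + 1)" 
      by (intro power_strict_increasing) auto
    show k: "2 ^ (r + 1) - 2 ^ (r - i) - 1 < K"
    proof -
      have "(1::nat) \<le> 2 ^ (r - i)" by simp
      thus ?thesis unfolding K_def using lt by linarith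
    qed
    have "2 ^ (r + 1) - ((2 ^ (r + 1) - 2 ^ (r - i) - 1) + 1) = (2::nat) ^ (r - i)"
      using lt by linarith
    hence "h (2 ^ (r + 1) - 2 ^ (r - i) - 1) j = (if j = i then 1 else 0)" if "j < r + 1" for j
      using that \<open>i < r + 1\<close> k unfolding h_def had_matrix_def K_def
      by (auto simp: bit_exp_iff)
    hence "(\<Sum>j<r + 1. h (2 ^ (r + 1) - 2 ^ (r - i) - 1) j * c j)
        = (\<Sum>j<r + 1. if j = i then c j else 0)"
      by (intro sum.cong) auto
    thus "(\<Sum>j<r + 1. h (2 ^ (r + 1) - 2 ^ (r - i) - 1) j * c j) = c i"
      using that by simp
  qed
  have N_inj: "c i = d i" if "N c = N d" "i < r + 1" for c d i
    using entry[OF row(2)[OF that(2)], of c] entry[OF row(2)[OF that(2)], of d] that(1)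
    unfolding row(1)[OF that(2)] by (cases "c i"; cases "d i") auto
  have M_N: "M j = N (\<lambda>i. if i = j then 1 else 0)" if "j < r + 1" for j
  proof -
    have "N (\<lambda>i. if i = j then 1 else 0) = (\<Sum>i<r + 1. if i = j then M i else 0)"
      unfolding N_def by (intro sum.cong) (auto simp: f2_scale_def)
    thus ?thesis using that by simp
  qed
  have M_inj: "inj_on M {..<r + 1}"
  proof (rule inj_onI)
    fix i j assume "i \<in> {..<r + 1}" "j \<in> {..<r + 1}" "M i = M j"
    thus "i = j" using N_inj[of "\<lambda>x. if x = i then 1 else 0" "\<lambda>x. if x = j then 1 else 0" i]
      M_N[of i] M_N[of j] by (auto split: if_splits)
  qed
  have N0: "N (\<lambda>_. 0) = 0" unfolding N_def by simp
  have indep: "V.independent (M ` {..<r + 1})"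
  proof (rule V.independent_if_scalars_zero)
    fix c x assume 0: "(\<Sum>x\<in>M ` {..<r + 1}. f2_scale (c x) x) = 0" and "x \<in> M ` {..<r + 1}"
    then obtain j where j: "j < r + 1" "x = M j" by blast
    have "N (c \<circ> M) = N (\<lambda>_. 0)"
      using 0 unfolding N0 sum.reindex[OF M_inj] by (simp only: N_def o_def)
    thus "c x = 0" using N_inj[of "c \<circ> M" "\<lambda>_. 0" j] j by simp
  qed simp
  have span: "range N = V.span (M ` {..<r + 1})"
  proof
    show "range N \<subseteq> V.span (M ` {..<r + 1})"
    proof (rule image_subsetI)
      show "N c \<in> V.span (M ` {..<r + 1})" for c
        unfolding N_def by (intro V.span_sum V.span_scale V.span_base) blast
    qed
    have "V.span (M ` {..<r + 1}) = range (\<lambda>u. \<Sum>v\<in>M ` {..<r + 1}. f2_scale (u v) v)"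
      by (rule V.span_finite) simp
    also have "\<dots> \<subseteq> range N"
    proof -
      have "(\<Sum>v\<in>M ` {..<r + 1}. f2_scale (u v) v) = N (u \<circ> M)" for u
        unfolding sum.reindex[OF M_inj] by (simp only: N_def o_def)
      thus ?thesis by auto
    qed
    finally show "V.span (M ` {..<r + 1}) \<subseteq> range N" .
  qed
  have "V.dim (had_face r e e) = r + 1"
    unfolding face span using V.dim_span_eq_card_independent[OF indep] card_image[OF M_inj] by simp
  moreover have "V.subspace (had_face r e e)"
    unfolding face span by (rule V.subspace_span)
  ultimately have "had_face r e e \<in> had_faces r"
    using e unfolding had_faces_def K_def by blast
  thus ?thesis by blast
qed

lemma had_complex_grassmannian:
  assumes q: "CARD('q::{field,finite}) = 2 ^ b"
    and n: "2 ^ (r + 1) - 1 \<le> CARD('n::finite)"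
  shows "grassmannian_complex (had_complex r :: ('q ^ 'n ^ 'n) weighted_complex)" (is ?G)
    and "complex_rank (had_complex r :: ('q ^ 'n ^ 'n) weighted_complex) = int r" (is ?R)
    and "i \<in> {-1..int r} \<Longrightarrow> level (had_complex r :: ('q ^ 'n ^ 'n) weighted_complex) i \<noteq> {}"
proof -
  interpret V: vector_space "f2_scale :: bit \<Rightarrow> 'q ^ 'n ^ 'n \<Rightarrow> 'q ^ 'n ^ 'n"
    by (intro vector_space_f2_scale exponent_two_matrix[OF q])
  let ?X = "had_complex r :: ('q ^ 'n ^ 'n) weighted_complex"
  have elems: "elems ?X = {x. V.subspace x \<and> (\<exists>F\<in>had_faces r. x \<subseteq> F)}"
    and rk: "rk ?X = (\<lambda>x. int (V.dim x) - 1)"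
    and wt: "wt ?X x = 1 / card (level ?X (rk ?X x))" for x
    by (simp_all add: had_complex_def Let_def level_def)
  have dim_face: "V.subspace F \<and> V.dim F = r + 1" if "F \<in> had_faces r" for F
    using that by (simp add: had_faces_def)
  have bound: "V.dim x \<le> r + 1" if x: "x \<in> elems ?X" for x
  proof -
    obtain F where F: "F \<in> had_faces r" "x \<subseteq> F" using x unfolding elems by auto
    obtain B where B: "B \<subseteq> F" "V.independent B" "F \<subseteq> V.span B" "card B = V.dim F"
      by (rule V.basis_exists)
    have "V.dim x \<le> card B"
      by (rule V.dim_le_card) (use B F in auto)
    thus ?thesis using dim_face[OF F(1)] B by simp
  qed
  have ex: "level ?X i \<noteq> {}" if i: "i \<in> {-1..int r}" for i
  proof -
    obtain F where F: "F \<in> (had_faces r :: ('q ^ 'n ^ 'n) set set)"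
      using had_faces_nonempty[OF q n] by blast
    obtain B where B: "B \<subseteq> F" "V.independent B" "F \<subseteq> V.span B" "card B = V.dim F"
      by (rule V.basis_exists)
    have "nat (i + 1) \<le> card B" using i dim_face[OF F] B(4) by auto
    then obtain C where C: "C \<subseteq> B" "card C = nat (i + 1)" by (meson obtain_subset_with_card_n)
    have "V.dim (V.span C) = nat (i + 1)"
      using V.dim_span_eq_card_independent[OF V.independent_mono[OF B(2) C(1)]] C by simp
    moreover have "V.span C \<subseteq> F"
      using C B dim_face[OF F] by (intro V.span_minimal) auto
    ultimately have "V.span C \<in> level ?X i"
      using F i unfolding level_def elems rk by (auto simp: V.subspace_span)
    thus ?thesis by blast
  qed
  thus "i \<in> {-1..int r} \<Longrightarrow> level ?X i \<noteq> {}" .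
  have fin: "finite S" for S :: "('q ^ 'n ^ 'n) set set" by simp
  show R: ?R unfolding complex_rank_def
  proof (rule Max_eqI)
    show "int r \<in> rk ?X ` elems ?X" using ex[of "int r"] by (force simp: level_def image_iff)
    show "y \<le> int r" if "y \<in> rk ?X ` elems ?X" for y
      using that bound by (force simp: rk)
  qed (simp add: fin)
  show ?G unfolding grassmannian_complex_def R
  proof (intro conjI ballI allI impI)
    show "vector_space (f2_scale :: bit \<Rightarrow> 'q ^ 'n ^ 'n \<Rightarrow> 'q ^ 'n ^ 'n)" ..
    show "elems ?X \<noteq> {}" using ex[of "int r"] by (auto simp: level_def)
    show "\<exists>y\<in>level ?X (int r). x \<subseteq> y" if x: "x \<in> elems ?X" for x
      
    proof -
      obtain F where F: "F \<in> had_faces r" "x \<subseteq> F" using x unfolding elems by auto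
      hence "F \<in> level ?X (int r)"
        unfolding level_def elems rk using dim_face[OF F(1)] by auto
      thus ?thesis using F(2) by blast
    qed
    show "(\<Sum>x\<in>level ?X i. wt ?X x) = 1" if "i \<in> {-1..int r}" for i
    proof -
      have "(\<Sum>x\<in>level ?X i. wt ?X x) = (\<Sum>x\<in>level ?X i. 1 / card (level ?X i))"
        by (intro sum.cong) (auto simp: wt level_def)
      thus ?thesis using ex[OF that] fin by simp
    qed
    show "y \<in> elems ?X" if "x \<in> elems ?X" "V.subspace y \<and> y \<subseteq> x" for x y
      using that unfolding elems by blast
    show "V.subspace x" if "x \<in> elems ?X" for x
      using that unfolding elems by blast
  qed (simp_all add: rk wt fin)
qed

end

theory Submission imports Defs begin

text \<open>Index the rank-one summands of a face by the nonzero bit vectors. A face together with an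
  ordered basis \<open>m\<^sub>0, \<dots>, m\<^sub>r\<close> is then a pair of frames \<open>(e, f)\<close> with \<open>m\<^sub>j = \<Sum> e\<^sub>k \<otimes> f\<^sub>k\<close>, summed over
  the labels \<open>k\<close> whose bit \<open>j\<close> is set. Fixing \<open>m\<^sub>0, \<dots>, m\<^bsub>d-1\<^esub>\<close> amounts to fixing the sums over all
  nonzero classes of labels modulo \<open>2\<^sup>d\<close>, and pairs of frames with these class sums form a set
  \<open>\<Omega>\<close> on which a group acts transitively. The walk on the link of their span is
  the step from \<open>m\<^sub>d\<close> to \<open>m\<^bsub>d+1\<^esub>\<close> for a uniformly random element of \<open>\<Omega>\<close>, so its second eigenvalue is bounded by the
  correlation of a function \<open>F\<close> of \<open>m\<^sub>d\<close> and a function \<open>G\<close> of \<open>m\<^bsub>d+1\<^esub>\<close>, both of mean zero.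

  The transvections \<open>T\<^sub>i\<^sub>j: e\<^sub>j \<mapsto> e\<^sub>j + t e\<^sub>i, f\<^sub>i \<mapsto> f\<^sub>i - t f\<^sub>j\<close> inside a class preserve \<open>\<Omega>\<close>. They fix
  \<open>m\<^sub>d\<close> if the labels \<open>i\<close> and \<open>j\<close> agree in bit \<open>d\<close>, and likewise for \<open>m\<^bsub>d+1\<^esub>\<close>. Choosing one label from each of the four
  cells that these two bits cut out of a class gives two commuting pairs of transvections, one fixing \<open>F\<close> and one
  fixing \<open>G\<close>, which generate a Heisenberg group. On the nontrivial characters
  of its centre the two invariant subspaces have correlation \<open>1/q\<close>. What remains are
  the averages of \<open>F\<close> and \<open>G\<close> over the central transvection. They are small because one vector of the
  class outside the support of the function can be resampled almost uniformly. Conditioning on the classes one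
  at a time reduces the general case to one class.\<close>

section \<open>Eigenvalues of symmetric stochastic matrices\<close>

text \<open>The central averages are small only for functions that vary with the vector being
  resampled. Mean zero does not ensure this: \<open>F\<close> may depend on the second vectors of a
  class alone, and then replacing a first vector does nothing. Hence \<open>F\<close> and
  \<open>G\<close> are each split into a part with mean zero over the first vectors and a part blind
  to them, for which first and second vectors exchange roles. The orientation of the central
  transvection \<open>T i j\<close> is chosen for each of the four resulting products:
  \<open>i\<close> and \<open>j\<close> always come from opposite cells, and the other two cells
  supply the commuting pairs. Each splitting costs a factor \<open>sqrt 2\<close>, which gives the
  bound 2 (1/q + \<delta>) with \<delta> = 1/q + 1/(q - 1), at most 8/q. Frames are full bases of
  the n-dimensional space, longer than the 2^(r+1) - 1 vectors of a face. The surplus vectors get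
  label 0 and enter no m_j. When d + 2 = r + 1, they alone fill the cell of class 0 in which both
  bits vanish; this is where n \<ge> 2^(r+1) enters.\<close>

lemma second_largest_le:
  fixes M :: "real multiset"
  assumes "M \<noteq> {#}" and le: "\<And>x. x \<in># M \<Longrightarrow> x \<le> \<epsilon>"
  shows "rev (sorted_list_of_multiset (add_mset y M)) ! 1 \<le> \<epsilon>"
proof (rule ccontr)
  define L where "L = rev (sorted_list_of_multiset (add_mset y M))"
  assume "\<not> ?thesis"
  hence gt: "L ! 1 > \<epsilon>" by (simp add: L_def)
  have mL: "mset L = add_mset y M" by (simp add: L_def)
  have "size (add_mset y M) \<ge> 2" using assms(1) by (cases M) auto
  hence len: "length L \<ge> 2" by (metis mL size_mset)
  then obtain a L1 where L1: "L = a # L1" by (cases L) auto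
  then obtain b L2 where L2: "L = a # b # L2" using len by (cases L1) auto
  have "sorted (rev L)" unfolding L_def rev_rev_ident by (rule sorted_sorted_list_of_multiset)
  hence "b \<le> a" using L2 by (simp add: sorted_append)
  hence ab: "a > \<epsilon>" "b > \<epsilon>" using gt L2 by auto
  \<comment> \<open>Only \<open>y\<close> can exceed \<open>\<epsilon>\<close>, whereas
    \<open>a\<close> and \<open>b\<close>, the two leading entries of \<open>L\<close>, both
    would.\<close>
  have "filter_mset (\<lambda>x. x > \<epsilon>) M = {#}"
    using le by (intro multiset_eqI) (force simp: not_in_iff)
  hence "size (filter_mset (\<lambda>x. x > \<epsilon>) (add_mset y M)) \<le> 1"
    by (simp only: filter_mset_add_mset) simp
  moreover have "size (filter_mset (\<lambda>x. x > \<epsilon>) (mset L)) \<ge> 2" using ab L2 by simp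
  ultimately show False using mL by simp
qed

text \<open>Symmetry cancels the cross terms between real and imaginary parts, so the form at
  \<open>z\<close> is the sum of its values at two real vectors of coordinate sum 0. Complex vectors
  occur because the characteristic polynomial is taken over the complex numbers.\<close>

lemma real_form_bound_complex:
  fixes p :: "nat \<Rightarrow> nat \<Rightarrow> real" and z :: "nat \<Rightarrow> complex"
  assumes sym: "\<And>i j. i < N \<Longrightarrow> j < N \<Longrightarrow> p i j = p j i"
    and bound: "\<And>f. (\<Sum>i<N. f i) = 0 \<Longrightarrow>
      \<bar>\<Sum>i<N. \<Sum>j<N. f i * p i j * f j\<bar> \<le> \<epsilon> * (\<Sum>i<N. (f i)\<^sup>2)"
    and z0: "(\<Sum>i<N. z i) = 0"
  shows "cmod (\<Sum>i<N. \<Sum>j<N. z i * p i j * cnj (z j)) \<le> \<epsilon> * (\<Sum>i<N. (cmod (z i))\<^sup>2)"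
proof -
  let ?Q = "\<lambda>f :: nat \<Rightarrow> real. \<Sum>i<N. \<Sum>j<N. f i * p i j * f j"
  have "Re (\<Sum>i<N. \<Sum>j<N. z i * p i j * cnj (z j)) = ?Q (\<lambda>i. Re (z i)) + ?Q (\<lambda>i. Im (z i))"
    by (simp add: Re_sum sum.distrib[symmetric] algebra_simps)
  moreover have "Im (\<Sum>i<N. \<Sum>j<N. z i * p i j * cnj (z j)) = 0"
  proof -
    have "(\<Sum>i<N. \<Sum>j<N. Im (z i) * p i j * Re (z j)) = (\<Sum>i<N. \<Sum>j<N. Im (z j) * p j i * Re (z i))"
      by (rule sum.swap)
    also have "\<dots> = (\<Sum>i<N. \<Sum>j<N. Re (z i) * p i j * Im (z j))"
      by (intro sum.cong refl) (auto simp: sym)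
    finally show ?thesis by (simp add: Im_sum sum_subtractf sum.distrib algebra_simps)
  qed
  ultimately have "(\<Sum>i<N. \<Sum>j<N. z i * p i j * cnj (z j))
      = complex_of_real (?Q (\<lambda>i. Re (z i)) + ?Q (\<lambda>i. Im (z i)))"
    by (simp add: complex_eq_iff)
  hence "cmod (\<Sum>i<N. \<Sum>j<N. z i * p i j * cnj (z j))
      = \<bar>?Q (\<lambda>i. Re (z i)) + ?Q (\<lambda>i. Im (z i))\<bar>" by (simp only: norm_of_real)
  also have "\<dots> \<le> \<epsilon> * (\<Sum>i<N. (Re (z i))\<^sup>2) + \<epsilon> * (\<Sum>i<N. (Im (z i))\<^sup>2)"
    using bound[of "\<lambda>i. Re (z i)"] bound[of "\<lambda>i. Im (z i)"] z0
    by (force simp: complex_eq_iff Re_sum Im_sum)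
  also have "\<dots> = \<epsilon> * (\<Sum>i<N. (cmod (z i))\<^sup>2)"
    by (simp add: cmod_power2 sum.distrib distrib_left)
  finally show ?thesis .
qed

text \<open>Change of basis: \<open>S\<close> replaces the first unit vector by the all-ones vector,
  an eigenvector for 1, which makes the matrix block triangular.\<close>

lemma char_poly_stochastic:
  fixes P :: "complex mat"
  assumes P: "P \<in> carrier_mat (Suc n) (Suc n)"
    and rows: "\<And>i. i < Suc n \<Longrightarrow> (\<Sum>j<Suc n. P $$ (i, j)) = 1"
  shows "char_poly P = [:-1, 1:] *
    char_poly (Matrix.mat n n (\<lambda>(i, j). P $$ (Suc i, Suc j) - P $$ (0, Suc j)))"
proof -
  let ?N = "Suc n"
  define S :: "complex mat" where "S = Matrix.mat ?N ?N (\<lambda>(i, j). if j = 0 \<or> i = j then 1 else 0)"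
  define S' :: "complex mat" where
    "S' = Matrix.mat ?N ?N (\<lambda>(i, j). if i = j then 1 else if j = 0 then -1 else 0)"
  define B where "B = Matrix.mat n n (\<lambda>(i, j). P $$ (Suc i, Suc j) - P $$ (0, Suc j))"
  define C where "C = four_block_mat (1\<^sub>m 1) (Matrix.mat 1 n (\<lambda>(i, j). P $$ (0, Suc j))) (0\<^sub>m n 1) B"
  have B: "B \<in> carrier_mat n n" by (simp add: B_def)
  have cS: "S \<in> carrier_mat ?N ?N" "S' \<in> carrier_mat ?N ?N" by (auto simp: S_def S'_def)
  have cC: "C \<in> carrier_mat ?N ?N" using B by (auto simp: C_def)
  have PS: "(P * S) $$ (i, j) = (if j = 0 then 1 else P $$ (i, j))" if "i < ?N" "j < ?N" for i j
  proof -
    have "(P * S) $$ (i, j) = (\<Sum>k<?N. P $$ (i, k) * (if j = 0 \<or> k = j then 1 else 0))"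
      using P that unfolding S_def
      by (auto simp: scalar_prod_def atLeast0LessThan intro!: sum.cong)
    also have "\<dots> = (if j = 0 then 1 else P $$ (i, j))"
    proof (cases "j = 0")
      case True
      thus ?thesis using rows[OF that(1)] by simp
    next
      case False
      hence "(\<Sum>k<?N. P $$ (i, k) * (if j = 0 \<or> k = j then 1 else 0))
          = (\<Sum>k<?N. if k = j then P $$ (i, k) else 0)" by (intro sum.cong) auto
      thus ?thesis using False that by (simp add: sum.delta del: sum.lessThan_Suc)
    qed
    finally show ?thesis .
  qed
  have SC: "(S * C) $$ (i, j) = (if i = 0 then C $$ (0, j) else C $$ (0, j) + C $$ (i, j))"
    if "i < ?N" "j < ?N" for i j
  proof -
    have "(S * C) $$ (i, j) = (\<Sum>k<?N. (if k = 0 \<or> i = k then 1 else 0) * C $$ (k, j))"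
      using cC that unfolding S_def
      by (auto simp: scalar_prod_def atLeast0LessThan intro!: sum.cong)
    also have "\<dots> = (\<Sum>k\<in>{0, i}. C $$ (k, j))"
      using that by (intro sum.mono_neutral_cong_right) auto
    also have "\<dots> = (if i = 0 then C $$ (0, j) else C $$ (0, j) + C $$ (i, j))" by auto
    finally show ?thesis .
  qed
  have "P * S = S * C"
  proof (rule eq_matI)
    fix i j assume "i < dim_row (S * C)" "j < dim_col (S * C)"
    hence ij: "i < ?N" "j < ?N" using cS cC by auto
    show "(P * S) $$ (i, j) = (S * C) $$ (i, j)"
      unfolding PS[OF ij] SC[OF ij] using ij B
      by (cases i; cases j) (auto simp: C_def B_def)
  qed (use P cS cC in auto)
  moreover have SS': "S * S' = 1\<^sub>m ?N"
  proof (rule eq_matI)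
    fix i j assume "i < dim_row (1\<^sub>m ?N :: complex mat)" "j < dim_col (1\<^sub>m ?N :: complex mat)"
    hence ij: "i < ?N" "j < ?N" by auto
    have "(S * S') $$ (i, j) = (\<Sum>k<?N. (if k = 0 \<or> i = k then 1 else 0) * S' $$ (k, j))"
      using cS ij unfolding S_def
      by (auto simp: scalar_prod_def atLeast0LessThan intro!: sum.cong)
    also have "\<dots> = (\<Sum>k\<in>{0, i}. S' $$ (k, j))"
      using ij by (intro sum.mono_neutral_cong_right) auto
    also have "\<dots> = (if i = 0 then S' $$ (0, j) else S' $$ (0, j) + S' $$ (i, j))" by auto
    also have "\<dots> = 1\<^sub>m ?N $$ (i, j)" using ij by (auto simp: S'_def)
    finally show "(S * S') $$ (i, j) = 1\<^sub>m ?N $$ (i, j)" .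
  qed (use cS in auto)
  moreover have "S' * S = 1\<^sub>m ?N" by (rule mat_mult_left_right_inverse[OF cS SS'])
  moreover have "P = S * C * S'"
  proof -
    have "P = P * (S * S')" using P SS' by simp
    also have "\<dots> = P * S * S'" using P cS by simp
    finally show ?thesis using \<open>P * S = S * C\<close> by simp
  qed
  ultimately have "similar_mat_wit P C S S'"
    unfolding similar_mat_wit_def Let_def using P cS cC by auto
  hence "char_poly P = char_poly C" by (intro char_poly_similar) (auto simp: similar_mat_def)
  also have "\<dots> = char_poly (1\<^sub>m 1) * char_poly B"
    unfolding C_def by (rule char_poly_four_block_zeros_col) (use B in auto)
  also have "char_poly (1\<^sub>m 1 :: complex mat) = [:-1, 1:]"
    by (simp add: char_poly_def char_poly_matrix_def det_single)
  finally show ?thesis by (simp add: B_def)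
qed

text \<open>Subtracting the first row of a stochastic matrix from the others splits off the eigenvalue 1, so
  the remaining eigenvalues are those of a smaller matrix, whose left eigenvectors extend to left eigenvectors
  of the full matrix with coordinate sum 0.\<close>

lemma second_eigenvalue_le:
  fixes p :: "nat \<Rightarrow> nat \<Rightarrow> real"
  assumes N: "2 \<le> N"
    and sym: "\<And>i j. i < N \<Longrightarrow> j < N \<Longrightarrow> p i j = p j i"
    and rows: "\<And>i. i < N \<Longrightarrow> (\<Sum>j<N. p i j) = 1"
    and bound: "\<And>f. (\<Sum>i<N. f i) = 0 \<Longrightarrow>
      \<bar>\<Sum>i<N. \<Sum>j<N. f i * p i j * f j\<bar> \<le> \<epsilon> * (\<Sum>i<N. (f i)\<^sup>2)"
  shows "rev (sorted_list_of_multiset (image_mset cmod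
    (proots (char_poly (Matrix.mat N N (\<lambda>(i, j). complex_of_real (p i j))))))) ! 1 \<le> \<epsilon>"
proof -
  obtain n where n: "N = Suc n" "n \<noteq> 0" using N by (cases N) auto
  define P where "P = Matrix.mat N N (\<lambda>(i, j). complex_of_real (p i j))"
  define B where "B = Matrix.mat n n (\<lambda>(i, j). P $$ (Suc i, Suc j) - P $$ (0, Suc j))"
  have B: "B \<in> carrier_mat n n" by (simp add: B_def)
  have P: "P \<in> carrier_mat (Suc n) (Suc n)" by (simp add: P_def n)
  have prows: "(\<Sum>j<Suc n. P $$ (i, j)) = 1" if "i < Suc n" for i
  proof -
    have "(\<Sum>j<Suc n. P $$ (i, j)) = complex_of_real (\<Sum>j<N. p i j)"
      unfolding of_real_sum n using that by (intro sum.cong) (auto simp: P_def n)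
    thus ?thesis using rows[of i] that n by (simp del: sum.lessThan_Suc of_real_sum)
  qed
  have char: "char_poly P = [:-1, 1:] * char_poly B"
    unfolding B_def by (rule char_poly_stochastic[OF P prows])
  have monic: "char_poly B \<noteq> 0" "degree (char_poly B) = n"
    using degree_monic_char_poly[OF B] n by auto
  have ev: "cmod \<mu> \<le> \<epsilon>" if "poly (char_poly B) \<mu> = 0" for \<mu>
  proof -
    have BT: "transpose_mat B \<in> carrier_mat n n" using B by simp
    have "eigenvalue (transpose_mat B) \<mu>"
      using that eigenvalue_root_char_poly[OF BT] char_poly_transpose_mat[OF B] by simp
    then obtain y where y: "y \<in> carrier_vec n" "y \<noteq> 0\<^sub>v n" "transpose_mat B *\<^sub>v y = \<mu> \<cdot>\<^sub>v y"
      using BT by (auto simp: eigenvalue_def eigenvector_def)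
    define z where "z k = (case k of 0 \<Rightarrow> - (\<Sum>l<n. vec_index y l) | Suc l \<Rightarrow> vec_index y l)" for k
    have z0: "(\<Sum>i<N. z i) = 0"
      unfolding n sum.lessThan_Suc_shift by (simp add: z_def)
    have eq_Suc: "(\<Sum>i<N. z i * p i (Suc j)) = \<mu> * z (Suc j)" if "j < n" for j
    proof -
      have "\<mu> * z (Suc j) = vec_index (transpose_mat B *\<^sub>v y) j" using y that by (simp add: z_def)
      also have "\<dots> = (\<Sum>l<n. (P $$ (Suc l, Suc j) - P $$ (0, Suc j)) * vec_index y l)"
        using y(1) that B by (auto simp: scalar_prod_def atLeast0LessThan B_def intro!: sum.cong)
      also have "\<dots> = (\<Sum>i<N. z i * p i (Suc j))"
        using that unfolding n sum.lessThan_Suc_shift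
        by (simp add: z_def P_def n algebra_simps sum_distrib_right sum_distrib_left sum_subtractf sum_negf)
      finally show ?thesis by simp
    qed
    have eq: "(\<Sum>i<N. z i * p i j) = \<mu> * z j" if "j < N" for j
    proof (cases j)
      case 0
      \<comment> \<open>Coordinate 0 follows from the others: as rows sum to 1, both sides of the
        eigenvector equation have total 0.\<close>
      have "(\<Sum>j<N. \<Sum>i<N. z i * p i j) = (\<Sum>i<N. z i * complex_of_real (\<Sum>j<N. p i j))"
        by (subst sum.swap) (simp add: sum_distrib_left)
      also have "\<dots> = (\<Sum>i<N. z i)" by (intro sum.cong) (auto simp: rows)
      also have "\<dots> = (\<Sum>j<N. \<mu> * z j)" by (simp add: z0 flip: sum_distrib_left)
      finally have "(\<Sum>i<N. z i * p i 0) + (\<Sum>j<n. \<Sum>i<N. z i * p i (Suc j))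
          = \<mu> * z 0 + (\<Sum>j<n. \<mu> * z (Suc j))"
        unfolding n sum.lessThan_Suc_shift[of _ n] by (simp add: algebra_simps sum.distrib)
      moreover have "(\<Sum>j<n. \<Sum>i<N. z i * p i (Suc j)) = (\<Sum>j<n. \<mu> * z (Suc j))"
        using eq_Suc by (intro sum.cong) auto
      ultimately show ?thesis using 0 by simp
    next
      case (Suc l)
      thus ?thesis using eq_Suc that n by simp
    qed
    let ?w = "\<Sum>i<N. (cmod (z i))\<^sup>2"
    \<comment> \<open>The form at a left eigenvector is the eigenvalue times the squared
      norm.\<close>
    have "(\<Sum>i<N. \<Sum>j<N. z i * p i j * cnj (z j)) = (\<Sum>j<N. (\<Sum>i<N. z i * p i j) * cnj (z j))"
      by (subst sum.swap) (simp add: sum_distrib_right)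
    also have "\<dots> = (\<Sum>j<N. \<mu> * complex_of_real ((cmod (z j))\<^sup>2))"
      by (intro sum.cong refl) (simp add: eq mult.assoc complex_norm_square flip: complex_norm_square)
    also have "\<dots> = \<mu> * complex_of_real ?w" by (simp add: sum_distrib_left)
    finally have "cmod (\<mu> * complex_of_real ?w) \<le> \<epsilon> * ?w"
      using real_form_bound_complex[OF sym bound z0] by simp
    moreover have "0 \<le> ?w" by (simp add: sum_nonneg)
    ultimately have "cmod \<mu> * ?w \<le> \<epsilon> * ?w" by (simp only: norm_mult norm_of_real abs_of_nonneg)
    moreover have "?w > 0"
    proof -
      obtain l where l: "l < n" "vec_index y l \<noteq> 0" using y by (metis carrier_vecD eq_vecI index_zero_vec)
      hence "(cmod (z (Suc l)))\<^sup>2 > 0" by (simp add: z_def)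
      thus ?thesis using l n by (intro sum_pos2[of _ "Suc l"]) auto
    qed
    ultimately show ?thesis by simp
  qed
  have "proots (char_poly P) = add_mset 1 (proots (char_poly B))"
    unfolding char using monic by (subst proots_mult) auto
  moreover have "proots (char_poly B) \<noteq> {#}"
    using size_proots_complex[of "char_poly B"] monic n by auto
  ultimately show ?thesis
    unfolding P_def[symmetric] using ev monic
    by (simp only: image_mset_add_mset) (rule second_largest_le, auto)
qed

section \<open>Functions invariant under subgroups of a Heisenberg group\<close>

text \<open>An action of an additive group. The group laws hold on the whole type, so that
  compositions can be rewritten without membership conditions.\<close>

definition param_action :: "'w set \<Rightarrow> ('q::ab_group_add \<Rightarrow> 'w \<Rightarrow> 'w) \<Rightarrow> bool"
  where "param_action \<Omega> u \<longleftrightarrow>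
    (\<forall>s t w. u s (u t w) = u (s + t) w) \<and> (\<forall>w. u 0 w = w) \<and> (\<forall>t. \<forall>w\<in>\<Omega>. u t w \<in> \<Omega>)"

definition param_avg :: "('q::{finite,ab_group_add} \<Rightarrow> 'w \<Rightarrow> 'w) \<Rightarrow> ('w \<Rightarrow> real) \<Rightarrow> 'w \<Rightarrow> real"
  where "param_avg u F w = (\<Sum>t\<in>UNIV. F (u t w)) / CARD('q)"

lemma param_actionD:
  assumes "param_action \<Omega> u"
  shows "u s (u t w) = u (s + t) w" "u 0 w = w" "w \<in> \<Omega> \<Longrightarrow> u t w \<in> \<Omega>"
  using assms by (auto simp: param_action_def)

lemma param_action_bij:
  assumes "param_action \<Omega> u"
  shows "bij_betw (u t) \<Omega> \<Omega>"
  using assms unfolding param_action_def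
  by (intro bij_betw_byWitness[where f' = "u (- t)"]) auto

lemma sum_param_action:
  assumes "param_action \<Omega> u"
  shows "(\<Sum>w\<in>\<Omega>. F (u t w)) = (\<Sum>w\<in>\<Omega>. F w)"
  by (rule sum.reindex_bij_betw[OF param_action_bij[OF assms]])

lemma sum_UNIV_shift: "(\<Sum>t\<in>(UNIV :: 'q::{finite,ab_group_add} set). f (s + t)) = (\<Sum>t\<in>UNIV. f t)"
  by (rule sum.reindex_bij_betw) (intro bij_betw_byWitness[where f' = "\<lambda>t. t - s"], auto)

lemma sum_UNIV_uminus: "(\<Sum>t\<in>(UNIV :: 'q::{finite,ab_group_add} set). f (- t)) = (\<Sum>t\<in>UNIV. f t)"
  by (rule sum.reindex_bij_betw) (intro bij_betw_byWitness[where f' = "\<lambda>t. - t"], auto)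

lemma param_avg_inv:
  fixes u :: "'q::{finite,ab_group_add} \<Rightarrow> 'w \<Rightarrow> 'w"
  assumes "param_action \<Omega> u"
  shows "param_avg u F (u s w) = param_avg u F w"
  using assms sum_UNIV_shift[of "\<lambda>t. F (u t w)" s]
  by (simp add: param_avg_def param_action_def add.commute)

text \<open>The substitution \<open>u (- t)\<close> permutes \<open>\<Omega>\<close> and moves the
  average to the other factor. Together with \<open>param_avg_idem\<close> this makes averaging an
  orthogonal projection.\<close>

lemma param_avg_adjoint:
  fixes u :: "'q::{finite,ab_group_add} \<Rightarrow> 'w \<Rightarrow> 'w"
  assumes u: "param_action \<Omega> u"
  shows "(\<Sum>w\<in>\<Omega>. param_avg u F w * G w) = (\<Sum>w\<in>\<Omega>. F w * param_avg u G w)"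
proof -
  have "(\<Sum>w\<in>\<Omega>. \<Sum>t\<in>UNIV. F (u t w) * G w) = (\<Sum>t\<in>UNIV. \<Sum>w\<in>\<Omega>. F (u t w) * G w)"
    by (rule sum.swap)
  also have "\<dots> = (\<Sum>t\<in>UNIV. \<Sum>w\<in>\<Omega>. F (u t (u (- t) w)) * G (u (- t) w))"
    using sum_param_action[OF u, of "\<lambda>w. F (u t w) * G w" "- t" for t] by simp
  also have "\<dots> = (\<Sum>t\<in>UNIV. \<Sum>w\<in>\<Omega>. F w * G (u (- t) w))"
    using u by (simp add: param_action_def)
  also have "\<dots> = (\<Sum>t\<in>UNIV. \<Sum>w\<in>\<Omega>. F w * G (u t w))"
    by (rule sum_UNIV_uminus)
  also have "\<dots> = (\<Sum>w\<in>\<Omega>. \<Sum>t\<in>UNIV. F w * G (u t w))" by (rule sum.swap)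
  finally show ?thesis
    by (simp add: param_avg_def sum_distrib_right sum_distrib_left flip: sum_divide_distrib)
qed

lemma param_avg_invariant:
  fixes u :: "'q::{finite,ab_group_add} \<Rightarrow> 'w \<Rightarrow> 'w"
  assumes "\<And>t. F (u t w) = F w"
  shows "param_avg u F w = F w"
  using assms by (simp add: param_avg_def)

lemma param_avg_idem:
  fixes u :: "'q::{finite,ab_group_add} \<Rightarrow> 'w \<Rightarrow> 'w"
  assumes "param_action \<Omega> u"
  shows "param_avg u (param_avg u F) w = param_avg u F w"
  using param_avg_inv[OF assms] by (intro param_avg_invariant) auto

lemma param_avg_diff:
  "param_avg u (\<lambda>w. F w - G w) w = param_avg u F w - param_avg u G w"
  by (simp add: param_avg_def sum_subtractf diff_divide_distrib)

lemma param_avg_commute: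
  fixes u v :: "'q::{finite,ab_group_add} \<Rightarrow> 'w \<Rightarrow> 'w"
  assumes "\<And>s t w. u s (v t w) = v t (u s w)"
  shows "param_avg u (param_avg v F) w = param_avg v (param_avg u F) w"
proof -
  have "(\<Sum>s\<in>UNIV. \<Sum>t\<in>UNIV. F (v t (u s w))) = (\<Sum>t\<in>UNIV. \<Sum>s\<in>UNIV. F (v t (u s w)))"
    by (rule sum.swap)
  thus ?thesis by (simp add: param_avg_def assms flip: sum_divide_distrib)
qed

lemma Cauchy_Schwarz_sum_abs:
  fixes F G :: "'w \<Rightarrow> real"
  shows "\<bar>\<Sum>w\<in>\<Omega>. F w * G w\<bar> \<le> sqrt (\<Sum>w\<in>\<Omega>. (F w)\<^sup>2) * sqrt (\<Sum>w\<in>\<Omega>. (G w)\<^sup>2)"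
  using L2_set_mult_ineq[of F G \<Omega>]
  by (intro order.trans[OF sum_abs]) (simp add: abs_mult L2_set_def)

text \<open>The actions generate a Heisenberg group with centre \<open>z\<close>: only \<open>a\<^sub>1, b\<^sub>2\<close> and \<open>a\<^sub>2, b\<^sub>1\<close> fail to
  commute. The first term bounds the part of \<open>F\<close> and \<open>G\<close> orthogonal to the \<open>z\<close>-invariant functions.\<close>

lemma heisenberg_bound:
  fixes a1 a2 b1 b2 z :: "'q::{field,finite} \<Rightarrow> 'w \<Rightarrow> 'w"
  assumes act: "param_action \<Omega> a1" "param_action \<Omega> a2" "param_action \<Omega> b1" "param_action \<Omega> b2"
      "param_action \<Omega> z"
    and F: "\<And>t w. w \<in> \<Omega> \<Longrightarrow> F (a1 t w) = F w" "\<And>t w. w \<in> \<Omega> \<Longrightarrow> F (a2 t w) = F w"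
    and G: "\<And>t w. w \<in> \<Omega> \<Longrightarrow> G (b1 t w) = G w" "\<And>t w. w \<in> \<Omega> \<Longrightarrow> G (b2 t w) = G w"
    and z: "\<And>s t w. z s (a1 t w) = a1 t (z s w)" "\<And>s t w. z s (a2 t w) = a2 t (z s w)"
      "\<And>s t w. z s (b1 t w) = b1 t (z s w)" "\<And>s t w. z s (b2 t w) = b2 t (z s w)"
    and comm: "\<And>s t w. b1 s (b2 t w) = b2 t (b1 s w)" "\<And>s t w. a1 s (b1 t w) = b1 t (a1 s w)"
      "\<And>s t w. a2 s (b2 t w) = b2 t (a2 s w)"
      "\<And>s t w. a1 s (b2 t w) = b2 t (a1 s (z (s * t) w))"
      "\<And>s t w. a2 s (b1 t w) = b1 t (a2 s (z (- (s * t)) w))"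
  shows "\<bar>\<Sum>w\<in>\<Omega>. F w * G w\<bar> \<le>
    1 / CARD('q) * (sqrt (\<Sum>w\<in>\<Omega>. (F w)\<^sup>2) * sqrt (\<Sum>w\<in>\<Omega>. (G w)\<^sup>2)) +
    sqrt (\<Sum>w\<in>\<Omega>. (param_avg z F w)\<^sup>2) * sqrt (\<Sum>w\<in>\<Omega>. (param_avg z G w)\<^sup>2)"
proof -
  let ?E = "param_avg z"
  define q where "q = real CARD('q)"
  have q: "q > 0" by (simp add: q_def)
  \<comment> \<open>The components orthogonal to the functions invariant under the centre; averaging
    over the centre kills them.\<close>
  define Fp where "Fp w = F w - ?E F w" for w
  define Gp where "Gp w = G w - ?E G w" for w
  have EFp: "?E Fp w = 0" for w
    unfolding Fp_def param_avg_diff param_avg_idem[OF act(5)] by simp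
  have z_split: "(\<Sum>w\<in>\<Omega>. H w * K w) =
      (\<Sum>w\<in>\<Omega>. (H w - ?E H w) * (K w - ?E K w)) + (\<Sum>w\<in>\<Omega>. ?E H w * ?E K w)" for H K
  proof -
    have "(\<Sum>w\<in>\<Omega>. ?E H w * K w) = (\<Sum>w\<in>\<Omega>. ?E H w * ?E K w)"
      using param_avg_adjoint[OF act(5), of "?E H" K] by (simp add: param_avg_idem[OF act(5)])
    moreover have "(\<Sum>w\<in>\<Omega>. H w * ?E K w) = (\<Sum>w\<in>\<Omega>. ?E H w * ?E K w)"
      using param_avg_adjoint[OF act(5), of H "?E K"] by (simp add: param_avg_idem[OF act(5)])
    ultimately show ?thesis by (simp add: algebra_simps sum.distrib sum_subtractf)
  qed
  have closed: "z t w \<in> \<Omega>" "a1 t w \<in> \<Omega>" "a2 t w \<in> \<Omega>" "b1 t w \<in> \<Omega>" "b2 t w \<in> \<Omega>" if "w \<in> \<Omega>" for t w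
    using that act by (blast intro: param_actionD(3))+
  have Fa: "Fp (a1 t w) = Fp w" "Fp (a2 t w) = Fp w" if "w \<in> \<Omega>" for t w
    using F closed that by (simp_all add: Fp_def param_avg_def z)
  have Gb: "Gp (b1 t w) = Gp w" "Gp (b2 t w) = Gp w" if "w \<in> \<Omega>" for t w
    using G closed that by (simp_all add: Gp_def param_avg_def z)
  \<comment> \<open>As \<open>b1\<close> and \<open>b2\<close> commute, this is the projection of
    \<open>Fp\<close> to the functions invariant under both. Its norm is governed by the
    autocorrelations \<open>C s t\<close>, only one of which survives.\<close>
  define H where "H = param_avg b1 (param_avg b2 Fp)"
  define C where "C s t = (\<Sum>w\<in>\<Omega>. Fp w * Fp (b2 t (b1 s w)))" for s t :: 'q
  have avg_z: "(\<Sum>s\<in>UNIV. Fp (b2 t (b1 s' (z s w)))) = 0" for s' t w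
    using EFp[of "b2 t (b1 s' w)"] by (simp add: z[symmetric] param_avg_def)
  \<comment> \<open>Substitute \<open>a1 (- c)\<close>, which fixes \<open>Fp\<close>: moving it
    past \<open>b2 t\<close> leaves the central factor \<open>z (c * t)\<close>. With
    \<open>a2\<close> the factor depends on \<open>s\<close> instead.\<close>
  have shiftz: "C s t = (\<Sum>w\<in>\<Omega>. Fp w * Fp (b2 t (b1 s (z (c * t) w))))" for s t c
  proof -
    have "C s t = (\<Sum>w\<in>\<Omega>. Fp (a1 (- c) w) * Fp (b2 t (b1 s (a1 (- c) w))))"
      unfolding C_def by (rule sum_param_action[OF act(1), symmetric])
    also have "\<dots> = (\<Sum>w\<in>\<Omega>. Fp w * Fp (b2 t (b1 s (z (c * t) w))))"
    proof (intro sum.cong refl)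
      fix w assume w: "w \<in> \<Omega>"
      have zz: "z (- c * t) (z (c * t) v) = v" for v
        by (simp add: act(5)[THEN param_actionD(1)] act(5)[THEN param_actionD(2)])
      have "b2 t (b1 s (a1 (- c) w)) = b2 t (a1 (- c) (z (- c * t) (z (c * t) (b1 s w))))"
        by (simp only: comm(2) zz)
      also have "\<dots> = a1 (- c) (b2 t (z (c * t) (b1 s w)))" by (simp only: comm(4))
      also have "\<dots> = a1 (- c) (b2 t (b1 s (z (c * t) w)))" by (simp only: z)
      finally show "Fp (a1 (- c) w) * Fp (b2 t (b1 s (a1 (- c) w)))
          = Fp w * Fp (b2 t (b1 s (z (c * t) w)))"
        using w closed by (simp add: Fa)
    qed
    finally show ?thesis .
  qed
  have shiftz': "C s t = (\<Sum>w\<in>\<Omega>. Fp w * Fp (b2 t (b1 s (z (c * s) w))))" for s t c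
  proof -
    have "C s t = (\<Sum>w\<in>\<Omega>. Fp (a2 c w) * Fp (b2 t (b1 s (a2 c w))))"
      unfolding C_def by (rule sum_param_action[OF act(2), symmetric])
    also have "\<dots> = (\<Sum>w\<in>\<Omega>. Fp w * Fp (b2 t (b1 s (z (c * s) w))))"
    proof (intro sum.cong refl)
      fix w assume w: "w \<in> \<Omega>"
      have zz: "z (- (c * s)) (z (c * s) v) = v" for v
        by (simp add: act(5)[THEN param_actionD(1)] act(5)[THEN param_actionD(2)])
      have "b2 t (b1 s (a2 c w)) = b2 t (b1 s (a2 c (z (- (c * s)) (z (c * s) w))))"
        by (simp only: zz)
      also have "\<dots> = b2 t (a2 c (b1 s (z (c * s) w)))" by (simp only: comm(5))
      also have "\<dots> = a2 c (b2 t (b1 s (z (c * s) w)))" by (simp only: comm(3))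
      finally show "Fp (a2 c w) * Fp (b2 t (b1 s (a2 c w)))
          = Fp w * Fp (b2 t (b1 s (z (c * s) w)))"
        using w closed by (simp add: Fa)
    qed
    finally show ?thesis .
  qed
  have sum_mult: "(\<Sum>c\<in>UNIV. f (c * t)) = (\<Sum>c\<in>UNIV. f c)" if "t \<noteq> 0" for t :: 'q and f :: "'q \<Rightarrow> real"
    by (rule sum.reindex_bij_betw)
      (intro bij_betw_byWitness[where f' = "\<lambda>c. c / t"], use that in auto)
  have C0: "C s t = 0" if "s \<noteq> 0 \<or> t \<noteq> 0" for s t
  proof -
    \<comment> \<open>A nonzero one of the two parameters: as \<open>c\<close> varies,
      \<open>c * r\<close> runs through the whole centre, over which \<open>Fp\<close> sums to
      0.\<close>
    define r where "r = (if t \<noteq> 0 then t else s)"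
    have r: "r \<noteq> 0" using that by (auto simp: r_def)
    have Cr: "C s t = (\<Sum>w\<in>\<Omega>. Fp w * Fp (b2 t (b1 s (z (c * r) w))))" for c
    proof (cases "t = 0")
      case True
      hence "r = s" by (simp add: r_def)
      thus ?thesis by (simp only: shiftz')
    next
      case False
      hence "r = t" by (simp add: r_def)
      thus ?thesis by (simp only: shiftz)
    qed
    have "q * C s t = (\<Sum>c\<in>(UNIV :: 'q set). C s t)" by (simp add: q_def)
    also have "\<dots> = (\<Sum>c\<in>UNIV. \<Sum>w\<in>\<Omega>. Fp w * Fp (b2 t (b1 s (z (c * r) w))))"
      by (intro sum.cong refl Cr)
    also have "\<dots> = (\<Sum>w\<in>\<Omega>. Fp w * (\<Sum>c\<in>UNIV. Fp (b2 t (b1 s (z (c * r) w)))))"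
      by (subst sum.swap) (simp add: sum_distrib_left)
    also have "\<dots> = 0"
      using sum_mult[OF r, of "\<lambda>c. Fp (b2 t (b1 s (z c w)))" for w] by (simp add: avg_z)
    finally show ?thesis using q by simp
  qed
  have C00: "C 0 0 = (\<Sum>w\<in>\<Omega>. (Fp w)\<^sup>2)"
    by (simp add: C_def power2_eq_square act(3,4)[THEN param_actionD(2)])
  have HH: "(\<Sum>w\<in>\<Omega>. (H w)\<^sup>2) = (\<Sum>w\<in>\<Omega>. (Fp w)\<^sup>2) / q\<^sup>2"
  proof -
    have comm12: "param_avg b2 (param_avg b1 K) = param_avg b1 (param_avg b2 K)" for K
      by (rule ext, rule param_avg_commute) (simp add: comm(1))
    have idem: "param_avg b1 (param_avg b1 K) = param_avg b1 K"
      "param_avg b2 (param_avg b2 K) = param_avg b2 K" for K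
      by (rule ext, rule param_avg_idem[OF act(3)], rule ext, rule param_avg_idem[OF act(4)])
    have "(\<Sum>w\<in>\<Omega>. (H w)\<^sup>2) = (\<Sum>w\<in>\<Omega>. param_avg b1 (param_avg b2 Fp) w * H w)"
      by (simp add: H_def power2_eq_square)
    also have "\<dots> = (\<Sum>w\<in>\<Omega>. Fp w * param_avg b2 (param_avg b1 H) w)"
      by (simp add: param_avg_adjoint[OF act(3)] param_avg_adjoint[OF act(4)])
    also have "param_avg b2 (param_avg b1 H) = H"
      by (simp add: H_def comm12 idem)
    also have "(\<Sum>w\<in>\<Omega>. Fp w * H w) = (\<Sum>w\<in>\<Omega>. Fp w * (\<Sum>s\<in>UNIV. \<Sum>t\<in>UNIV. Fp (b2 t (b1 s w)))) / q\<^sup>2"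
      by (simp add: H_def param_avg_def q_def power2_eq_square flip: sum_divide_distrib)
    also have "(\<Sum>w\<in>\<Omega>. Fp w * (\<Sum>s\<in>UNIV. \<Sum>t\<in>UNIV. Fp (b2 t (b1 s w))))
        = (\<Sum>s\<in>UNIV. \<Sum>t\<in>UNIV. C s t)"
    proof -
      have "(\<Sum>w\<in>\<Omega>. Fp w * (\<Sum>s\<in>UNIV. \<Sum>t\<in>UNIV. Fp (b2 t (b1 s w))))
          = (\<Sum>w\<in>\<Omega>. \<Sum>s\<in>UNIV. \<Sum>t\<in>UNIV. Fp w * Fp (b2 t (b1 s w)))"
        by (simp only: sum_distrib_left)
      also have "\<dots> = (\<Sum>s\<in>UNIV. \<Sum>w\<in>\<Omega>. \<Sum>t\<in>UNIV. Fp w * Fp (b2 t (b1 s w)))"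
        by (rule sum.swap)
      also have "\<dots> = (\<Sum>s\<in>UNIV. \<Sum>t\<in>UNIV. C s t)"
        unfolding C_def by (intro sum.cong refl sum.swap)
      finally show ?thesis .
    qed
    also have "\<dots> = (\<Sum>s\<in>(UNIV :: 'q set). \<Sum>t\<in>(UNIV :: 'q set). if t = 0 then if s = 0 then C 0 0 else 0 else 0)"
      by (intro sum.cong refl) (auto simp: C0)
    also have "\<dots> = C 0 0" by simp
    finally show ?thesis by (simp add: C00)
  qed
  \<comment> \<open>\<open>Gp\<close> is fixed by \<open>b1\<close> and \<open>b2\<close>, so it
    sees only the projection \<open>H\<close> of \<open>Fp\<close>, whose norm is 1/q times that of
    \<open>Fp\<close>.\<close>
  have "(\<Sum>w\<in>\<Omega>. Fp w * Gp w) = (\<Sum>w\<in>\<Omega>. Fp w * param_avg b2 (param_avg b1 Gp) w)"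
    using Gb closed by (intro sum.cong refl) (simp add: param_avg_def)
  also have "\<dots> = (\<Sum>w\<in>\<Omega>. H w * Gp w)"
    by (simp add: H_def param_avg_adjoint[OF act(3)] param_avg_adjoint[OF act(4)])
  finally have "\<bar>\<Sum>w\<in>\<Omega>. Fp w * Gp w\<bar> \<le> sqrt (\<Sum>w\<in>\<Omega>. (H w)\<^sup>2) * sqrt (\<Sum>w\<in>\<Omega>. (Gp w)\<^sup>2)"
    by (simp only: Cauchy_Schwarz_sum_abs)
  also have "\<dots> = 1 / q * (sqrt (\<Sum>w\<in>\<Omega>. (Fp w)\<^sup>2) * sqrt (\<Sum>w\<in>\<Omega>. (Gp w)\<^sup>2))"
    unfolding HH real_sqrt_divide using q by simp
  also have "\<dots> \<le> 1 / q * (sqrt (\<Sum>w\<in>\<Omega>. (F w)\<^sup>2) * sqrt (\<Sum>w\<in>\<Omega>. (G w)\<^sup>2))"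
  proof -
    have le: "(\<Sum>w\<in>\<Omega>. (K w - ?E K w)\<^sup>2) \<le> (\<Sum>w\<in>\<Omega>. (K w)\<^sup>2)" for K
    proof -
      have "0 \<le> (\<Sum>w\<in>\<Omega>. ?E K w * ?E K w)" by (intro sum_nonneg) simp
      thus ?thesis using z_split[of K K] unfolding power2_eq_square by linarith
    qed
    have "sqrt (\<Sum>w\<in>\<Omega>. (Fp w)\<^sup>2) * sqrt (\<Sum>w\<in>\<Omega>. (Gp w)\<^sup>2)
        \<le> sqrt (\<Sum>w\<in>\<Omega>. (F w)\<^sup>2) * sqrt (\<Sum>w\<in>\<Omega>. (G w)\<^sup>2)"
      unfolding Fp_def Gp_def
      by (rule mult_mono[OF real_sqrt_le_mono[OF le] real_sqrt_le_mono[OF le]])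
        (rule real_sqrt_ge_zero, rule sum_nonneg, simp)+
    moreover have "0 \<le> 1 / q" using q by simp
    ultimately show ?thesis by (rule mult_left_mono)
  qed
  finally have 1: "\<bar>\<Sum>w\<in>\<Omega>. Fp w * Gp w\<bar>
      \<le> 1 / q * (sqrt (\<Sum>w\<in>\<Omega>. (F w)\<^sup>2) * sqrt (\<Sum>w\<in>\<Omega>. (G w)\<^sup>2))" .
  have "\<bar>\<Sum>w\<in>\<Omega>. F w * G w\<bar> \<le> \<bar>\<Sum>w\<in>\<Omega>. Fp w * Gp w\<bar> + \<bar>\<Sum>w\<in>\<Omega>. ?E F w * ?E G w\<bar>"
    by (subst z_split, fold Fp_def Gp_def, rule abs_triangle_ineq)
  also have "\<dots> \<le> 1 / q * (sqrt (\<Sum>w\<in>\<Omega>. (F w)\<^sup>2) * sqrt (\<Sum>w\<in>\<Omega>. (G w)\<^sup>2))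
      + sqrt (\<Sum>w\<in>\<Omega>. (?E F w)\<^sup>2) * sqrt (\<Sum>w\<in>\<Omega>. (?E G w)\<^sup>2)"
    by (rule add_mono[OF 1 Cauchy_Schwarz_sum_abs])
  finally show ?thesis unfolding q_def .
qed

section \<open>Averages over coordinate translations\<close>

lemma sum_inner_selfadj_idem:
  fixes E :: "('w \<Rightarrow> real) \<Rightarrow> 'w \<Rightarrow> real"
  assumes "\<And>F G. (\<Sum>w\<in>\<Omega>. E F w * G w) = (\<Sum>w\<in>\<Omega>. F w * E G w)" "\<And>F. E (E F) = E F"
  shows "(\<Sum>w\<in>\<Omega>. (E F w)\<^sup>2) = (\<Sum>w\<in>\<Omega>. F w * E F w)"
  using assms(1)[of F "E F"] assms(2)[of F] by (simp add: power2_eq_square)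

text \<open>Abstract form of the data that a function can see: vectors \<open>a\<close>, of which
  those indexed by \<open>S\<close> may be translated by the subspace \<open>W x\<close>, and
  further data \<open>y\<close>. A transvection also changes \<open>y\<close>, and
  \<open>\<tau>\<close> records how. In the application \<open>a\<close> holds first vectors and
  \<open>y\<close> second vectors.\<close>

locale coordinate_translations =
  fixes S :: "'n::finite set"
    and W :: "('n \<Rightarrow> 'q::{field,finite} ^ 'm::finite) \<times> 'y::finite \<Rightarrow> ('q ^ 'm) set"
    and \<tau> :: "'n \<Rightarrow> 'n \<Rightarrow> 'q \<Rightarrow> 'y \<Rightarrow> 'y"
  assumes W_subspace: "vec.subspace (W x)"
    and W_translate: "j \<in> S \<Longrightarrow> W (a(j := b), y) = W (a, y)"
    and W_twist: "i \<in> S \<Longrightarrow> j \<in> S \<Longrightarrow> i \<noteq> j \<Longrightarrow> W (a, \<tau> i j t y) = W (a, y)"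
    and twist_add: "i \<noteq> j \<Longrightarrow> \<tau> i j s (\<tau> i j t y) = \<tau> i j (s + t) y"
    and twist_0: "\<tau> i j 0 y = y"
begin

definition tr :: "'n \<Rightarrow> 'q ^ 'm \<Rightarrow> ('n \<Rightarrow> 'q ^ 'm) \<times> 'y \<Rightarrow> ('n \<Rightarrow> 'q ^ 'm) \<times> 'y"
  where "tr j b x = ((fst x)(j := fst x j + b), snd x)"

text \<open>The transvection \<open>T i j t\<close> as it acts on the visible data, see
  \<open>key_T\<close>.\<close>

definition shear :: "'n \<Rightarrow> 'n \<Rightarrow> 'q \<Rightarrow> ('n \<Rightarrow> 'q ^ 'm) \<times> 'y \<Rightarrow> ('n \<Rightarrow> 'q ^ 'm) \<times> 'y"
  where "shear i j t x = ((fst x)(j := fst x j + t *s fst x i), \<tau> i j t (snd x))"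

definition avg :: "'n \<Rightarrow> (('n \<Rightarrow> 'q ^ 'm) \<times> 'y \<Rightarrow> real) \<Rightarrow> ('n \<Rightarrow> 'q ^ 'm) \<times> 'y \<Rightarrow> real"
  where "avg j F x = (\<Sum>b\<in>W x. F (tr j b x)) / card (W x)"

lemma W_tr [simp]: "j \<in> S \<Longrightarrow> W (tr j b x) = W x"
  by (cases x) (simp add: tr_def W_translate)

lemma W_shear [simp]: "i \<in> S \<Longrightarrow> j \<in> S \<Longrightarrow> i \<noteq> j \<Longrightarrow> W (shear i j t x) = W x"
  by (cases x) (simp add: shear_def W_translate W_twist)

lemma W_closed: "0 \<in> W x" "b \<in> W x \<Longrightarrow> c \<in> W x \<Longrightarrow> b + c \<in> W x" "b \<in> W x \<Longrightarrow> t *s b \<in> W x"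
  "b \<in> W x \<Longrightarrow> c \<in> W x \<Longrightarrow> b - c \<in> W x" "b \<in> W x \<Longrightarrow> - b \<in> W x"
  using W_subspace[of x]
  by (auto intro: vec.subspace_0 vec.subspace_add vec.subspace_scale vec.subspace_diff vec.subspace_neg)

lemma card_W: "card (W x) > 0"
  using W_closed(1)[of x] by (auto simp: card_gt_0_iff)

lemma sum_W_shift: "c \<in> W x \<Longrightarrow> (\<Sum>b\<in>W x. f (b + c)) = (\<Sum>b\<in>W x. f b)"
  by (rule sum.reindex_bij_betw)
    (intro bij_betw_byWitness[where f' = "\<lambda>b. b - c"], auto intro: W_closed)

lemma sum_W_scale: "t \<noteq> 0 \<Longrightarrow> (\<Sum>b\<in>W x. f (t *s b)) = (\<Sum>b\<in>W x. f b)"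
  by (rule sum.reindex_bij_betw)
    (intro bij_betw_byWitness[where f' = "\<lambda>b. inverse t *s b"], auto intro: W_closed)

lemma tr_tr: "tr j b (tr j c x) = tr j (b + c) x"
  by (simp add: tr_def algebra_simps)

lemma tr_0: "tr j 0 x = x"
  by (simp add: tr_def)

lemma tr_commute: "i \<noteq> j \<Longrightarrow> tr i b (tr j c x) = tr j c (tr i b x)"
  by (simp add: tr_def fun_upd_twist)

lemma shear_act: "i \<noteq> j \<Longrightarrow> param_action UNIV (shear i j)"
  by (simp add: param_action_def shear_def twist_add twist_0 algebra_simps vec.scale_left_distrib)

lemma shear_tr: "i \<noteq> j \<Longrightarrow> shear i j t (tr i b x) = tr j (t *s b) (tr i b (shear i j t x))"
  by (auto simp: shear_def tr_def algebra_simps vec.scale_right_distrib)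

lemma shear_tr_right: "i \<noteq> j \<Longrightarrow> shear i j t (tr j b x) = tr j b (shear i j t x)"
  by (auto simp: shear_def tr_def algebra_simps)

lemma shear_tr_other: "k \<noteq> i \<Longrightarrow> k \<noteq> j \<Longrightarrow> shear i j t (tr k b x) = tr k b (shear i j t x)"
  by (auto simp: shear_def tr_def)

lemma avg_tr: "j \<in> S \<Longrightarrow> c \<in> W x \<Longrightarrow> avg j F (tr j c x) = avg j F x"
  using sum_W_shift[of c x "\<lambda>b. F (tr j b x)"] by (simp add: avg_def tr_tr)

lemma avg_idem: "j \<in> S \<Longrightarrow> avg j (avg j F) = avg j F"
proof
  fix x assume j: "j \<in> S"
  have "avg j (avg j F) x = (\<Sum>b\<in>W x. avg j F x) / card (W x)"
    unfolding avg_def[of j "avg j F"] by (intro arg_cong2[where f = "(/)"] sum.cong refl avg_tr j)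
  thus "avg j (avg j F) x = avg j F x" using card_W[of x] by (auto simp: card_gt_0_iff)
qed

lemma avg_commute: "i \<in> S \<Longrightarrow> j \<in> S \<Longrightarrow> i \<noteq> j \<Longrightarrow> avg i (avg j F) = avg j (avg i F)"
proof
  fix x assume ij: "i \<in> S" "j \<in> S" "i \<noteq> j"
  have "(\<Sum>b\<in>W x. \<Sum>c\<in>W x. F (tr j c (tr i b x))) = (\<Sum>c\<in>W x. \<Sum>b\<in>W x. F (tr j c (tr i b x)))"
    by (rule sum.swap)
  thus "avg i (avg j F) x = avg j (avg i F) x"
    using ij by (simp add: avg_def tr_commute[OF ij(3)] flip: sum_divide_distrib)
qed

text \<open>The step from a point to its translate is reversible, and \<open>W\<close> is the same
  at both ends, so the normalisation by \<open>card (W x)\<close> respects the symmetry.\<close>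

lemma avg_adjoint: "j \<in> S \<Longrightarrow> (\<Sum>x\<in>UNIV. avg j F x * G x) = (\<Sum>x\<in>UNIV. F x * avg j G x)"
proof -
  assume j: "j \<in> S"
  have bij: "bij_betw (\<lambda>(x, b). (tr j b x, - b)) (Sigma UNIV W) (Sigma UNIV W)"
  proof (intro bij_betw_byWitness[where f' = "\<lambda>(x, b). (tr j b x, - b)"])
    have "tr j (- b) (tr j b x) = x" for b x by (simp add: tr_def)
    thus "\<forall>a\<in>Sigma UNIV W. (\<lambda>(x, b). (tr j b x, - b)) ((\<lambda>(x, b). (tr j b x, - b)) a) = a"
      by auto
    thus "\<forall>a\<in>Sigma UNIV W. (\<lambda>(x, b). (tr j b x, - b)) ((\<lambda>(x, b). (tr j b x, - b)) a) = a" .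
  qed (use j W_closed(5) in auto)
  have "(\<Sum>x\<in>UNIV. avg j F x * G x) = (\<Sum>(x, b)\<in>Sigma UNIV W. F (tr j b x) * G x / card (W x))"
    by (subst sum.Sigma[symmetric]) (auto simp: avg_def sum_distrib_right sum_divide_distrib)
  also have "\<dots> = (\<Sum>(x, b)\<in>Sigma UNIV W. F x * G (tr j b x) / card (W x))"
    by (subst sum.reindex_bij_betw[OF bij, symmetric], rule sum.cong)
      (use j in \<open>auto simp: tr_tr\<close>, simp add: tr_def)
  also have "\<dots> = (\<Sum>x\<in>UNIV. F x * avg j G x)"
    by (subst sum.Sigma[symmetric]) (auto simp: avg_def sum_distrib_left sum_divide_distrib)
  finally show ?thesis .
qed

lemma avg_shear:
  assumes "i \<in> S" "j \<in> S" "i \<noteq> j" "k \<in> S" "k \<noteq> i" "k \<noteq> j" and "\<And>t x. F (shear i j t x) = F x"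
  shows "avg k F (shear i j t x) = avg k F x"
  using assms by (simp add: avg_def shear_tr_other[symmetric])

text \<open>Average over the line of slope \<open>t\<close> in the plane of translations of the
  coordinates \<open>i\<close> and \<open>j\<close>; slope 0 is \<open>avg i\<close>.\<close>

definition diag :: "'n \<Rightarrow> 'n \<Rightarrow> 'q \<Rightarrow> (('n \<Rightarrow> 'q ^ 'm) \<times> 'y \<Rightarrow> real) \<Rightarrow> ('n \<Rightarrow> 'q ^ 'm) \<times> 'y \<Rightarrow> real"
  where "diag i j t F x = (\<Sum>b\<in>W x. F (tr j (t *s b) (tr i b x))) / card (W x)"

text \<open>The shears conjugate \<open>avg i\<close> into \<open>CARD('q)\<close> averages \<open>diag i j t\<close>, which are pairwise
  orthogonal on the orthogonal complement of the image of \<open>avg j \<circ> avg i\<close>.\<close>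

lemma shear_pair_ineq:
  fixes m0 m1 m2 :: real
  assumes ij: "i \<in> S" "j \<in> S" "i \<noteq> j" and H: "\<And>t x. H (shear i j t x) = H x"
  defines "m0 \<equiv> (\<Sum>x\<in>UNIV. (H x)\<^sup>2)" and "m1 \<equiv> (\<Sum>x\<in>UNIV. (avg i H x)\<^sup>2)"
    and "m2 \<equiv> (\<Sum>x\<in>UNIV. (avg j (avg i H) x)\<^sup>2)"
  shows "CARD('q) * (m1 - m2) \<le> m0 - m2"
proof -
  let ?P = "\<lambda>t. diag i j t H" and ?\<pi> = "avg j (avg i H)"
  define q where "q = real CARD('q)"
  have P_shear: "?P (s + t) (shear i j t x) = ?P s x" for s t x
  proof -
    have "tr j ((s + t) *s b) (tr i b (shear i j t x)) = shear i j t (tr j (s *s b) (tr i b x))" for b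
      using ij by (simp add: shear_tr shear_tr_right tr_tr vec.scale_left_distrib add.commute)
    thus ?thesis using ij H by (simp add: diag_def)
  qed
  have P0: "?P 0 x = avg i H x" for x by (simp add: diag_def avg_def tr_0)
  have P_shear0: "?P t (shear i j t x) = avg i H x" for t x
    using P_shear[of 0 t x] by (simp add: P0)
  \<comment> \<open>This is the average over the full plane of translations, which a shear only
    reparametrises.\<close>
  have \<pi>_shear: "?\<pi> (shear i j t x) = ?\<pi> x" for t x
  proof -
    have "(\<Sum>c\<in>W x. H (tr i b (tr j c (shear i j t x)))) = (\<Sum>c\<in>W x. H (tr i b (tr j c x)))"
      if b: "b \<in> W x" for b
    proof -
      have "H (tr i b (tr j (c + t *s b) (shear i j t x))) = H (tr i b (tr j c x))" for c
      proof -
        have "tr i b (tr j (c + t *s b) (shear i j t x)) = shear i j t (tr i b (tr j c x))"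
          using ij by (simp add: shear_tr shear_tr_right tr_tr tr_commute[of i j] add.commute)
        thus ?thesis by (simp add: H)
      qed
      thus ?thesis
        using sum_W_shift[OF W_closed(3)[OF b], of "\<lambda>c. H (tr i b (tr j c (shear i j t x)))" t] by simp
    qed
    moreover have "?\<pi> z = (\<Sum>b\<in>W z. \<Sum>c\<in>W z. H (tr i b (tr j c z))) / (card (W z))\<^sup>2" for z
      using ij by (subst sum.swap) (simp add: avg_def power2_eq_square flip: sum_divide_distrib)
    ultimately show ?thesis using ij by simp
  qed
  \<comment> \<open>A line of slope \<open>r \<noteq> 0\<close> and the direction of coordinate
    \<open>i\<close> together fill the plane, so averaging along both is averaging over the
    plane.\<close>
  have avg_P: "avg i (?P r) = ?\<pi>" if r: "r \<noteq> 0" for r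
  proof
    fix x
    have "avg i (?P r) x = (\<Sum>c\<in>W x. \<Sum>b\<in>W x. H (tr j (r *s b) (tr i (c + b) x))) / (card (W x))\<^sup>2"
      using ij by (simp add: avg_def diag_def tr_tr add.commute power2_eq_square flip: sum_divide_distrib)
    also have "(\<Sum>c\<in>W x. \<Sum>b\<in>W x. H (tr j (r *s b) (tr i (c + b) x)))
        = (\<Sum>b\<in>W x. \<Sum>c\<in>W x. H (tr j (r *s b) (tr i (c + b) x)))" by (rule sum.swap)
    also have "\<dots> = (\<Sum>b\<in>W x. \<Sum>c\<in>W x. H (tr j (r *s b) (tr i c x)))"
    proof (rule sum.cong[OF refl])
      fix b assume "b \<in> W x"
      thus "(\<Sum>c\<in>W x. H (tr j (r *s b) (tr i (c + b) x))) = (\<Sum>c\<in>W x. H (tr j (r *s b) (tr i c x)))"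
        by (rule sum_W_shift[where f = "\<lambda>c. H (tr j (r *s b) (tr i c x))"])
    qed
    also have "\<dots> = (\<Sum>b\<in>W x. \<Sum>c\<in>W x. H (tr j b (tr i c x)))"
      by (rule sum_W_scale[OF r])
    finally show "avg i (?P r) x = ?\<pi> x"
      using ij by (simp add: avg_def power2_eq_square tr_commute flip: sum_divide_distrib)
  qed
  have re: "(\<Sum>x\<in>UNIV. K (shear i j t x)) = (\<Sum>x\<in>UNIV. K x)" for K :: "_ \<Rightarrow> real" and t
    by (rule sum_param_action[OF shear_act[OF ij(3)]])
  have m1: "m1 = (\<Sum>x\<in>UNIV. H x * avg i H x)"
    unfolding m1_def by (rule sum_inner_selfadj_idem) (use ij avg_adjoint avg_idem in auto)
  have m2': "(\<Sum>x\<in>UNIV. avg i H x * ?\<pi> x) = m2"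
    unfolding m2_def by (rule sum_inner_selfadj_idem[symmetric]) (use ij avg_adjoint avg_idem in auto)
  have m2'': "(\<Sum>x\<in>UNIV. H x * ?\<pi> x) = m2"
  proof -
    have "(\<Sum>x\<in>UNIV. avg i H x * ?\<pi> x) = (\<Sum>x\<in>UNIV. H x * avg i ?\<pi> x)"
      by (rule avg_adjoint[OF ij(1)])
    thus ?thesis using ij m2' by (simp add: avg_commute[of i j] avg_idem)
  qed
  have HP: "(\<Sum>x\<in>UNIV. H x * ?P t x) = m1" for t
    using re[of "\<lambda>x. H x * ?P t x" t] by (simp add: H P_shear0 m1)
  have \<pi>P: "(\<Sum>x\<in>UNIV. ?P t x * ?\<pi> x) = m2" for t
    using re[of "\<lambda>x. ?P t x * ?\<pi> x" t] by (simp add: \<pi>_shear P_shear0 m2')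
  \<comment> \<open>Gram matrix of the q averages: \<open>m1\<close> on the diagonal and
    \<open>m2\<close> off it, so the differences \<open>?P t - ?\<pi>\<close> are pairwise
    orthogonal.\<close>
  have PP: "(\<Sum>x\<in>UNIV. ?P s x * ?P t x) = (if s = t then m1 else m2)" for s t
  proof -
    have "(\<Sum>x\<in>UNIV. ?P s x * ?P t x) = (\<Sum>x\<in>UNIV. ?P (s - t) x * avg i H x)"
      using re[of "\<lambda>x. ?P s x * ?P t x" t] P_shear[of "s - t" t] by (simp add: P_shear0)
    also have "\<dots> = (\<Sum>x\<in>UNIV. avg i (?P (s - t)) x * H x)" by (rule avg_adjoint[OF ij(1), symmetric])
    also have "\<dots> = (if s = t then m1 else m2)"
    proof (cases "s = t")
      case True
      hence "?P (s - t) = avg i H" using P0 by (intro ext) simp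
      thus ?thesis using True ij by (simp add: avg_idem m1 mult.commute)
    next
      case False
      thus ?thesis using avg_P[of "s - t"] m2'' by (simp add: mult.commute)
    qed
    finally show ?thesis .
  qed
  define Q where "Q x = (\<Sum>t\<in>UNIV. ?P t x)" for x
  have QQ: "(\<Sum>x\<in>UNIV. Q x * Q x) = q * (m1 + (q - 1) * m2)"
  proof -
    have "(\<Sum>x\<in>UNIV. Q x * Q x) = (\<Sum>x\<in>UNIV. \<Sum>s\<in>UNIV. \<Sum>t\<in>UNIV. ?P s x * ?P t x)"
      by (simp only: Q_def sum_product)
    also have "\<dots> = (\<Sum>s\<in>UNIV. \<Sum>x\<in>UNIV. \<Sum>t\<in>UNIV. ?P s x * ?P t x)" by (rule sum.swap)
    also have "\<dots> = (\<Sum>s\<in>UNIV. \<Sum>t\<in>UNIV. \<Sum>x\<in>UNIV. ?P s x * ?P t x)"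
      by (intro sum.cong refl sum.swap)
    also have "\<dots> = (\<Sum>s\<in>(UNIV :: 'q set). \<Sum>t\<in>(UNIV :: 'q set). (if s = t then m1 - m2 else 0) + m2)"
      by (intro sum.cong refl) (simp add: PP)
    also have "\<dots> = q * (m1 + (q - 1) * m2)" by (simp add: sum.distrib q_def algebra_simps)
    finally show ?thesis .
  qed
  have HQ: "(\<Sum>x\<in>UNIV. H x * Q x) = q * m1" and \<pi>Q: "(\<Sum>x\<in>UNIV. Q x * ?\<pi> x) = q * m2"
    unfolding Q_def sum_distrib_left sum_distrib_right
    by (subst sum.swap, simp add: HP q_def, subst sum.swap, simp add: \<pi>P q_def)
  \<comment> \<open>Bessel's inequality for \<open>H - ?\<pi>\<close>: subtracting all q differences
    \<open>?P t - ?\<pi>\<close> from it leaves exactly this function.\<close>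
  have "0 \<le> (\<Sum>x\<in>UNIV. (H x - Q x + (q - 1) * ?\<pi> x)\<^sup>2)" by (intro sum_nonneg) auto
  also have "\<dots> = (\<Sum>x\<in>UNIV. (H x)\<^sup>2 + Q x * Q x + (q - 1)\<^sup>2 * (?\<pi> x)\<^sup>2 - 2 * (H x * Q x)
      + 2 * (q - 1) * (H x * ?\<pi> x) - 2 * (q - 1) * (Q x * ?\<pi> x))"
    by (intro sum.cong refl) (simp add: power2_eq_square algebra_simps)
  also have "\<dots> = m0 + q * (m1 + (q - 1) * m2) + (q - 1)\<^sup>2 * m2 - 2 * (q * m1)
      + 2 * (q - 1) * m2 - 2 * (q - 1) * (q * m2)"
    by (simp only: sum.distrib sum_subtractf sum_distrib_left[symmetric] QQ HQ \<pi>Q m2'' m0_def m2_def)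
  finally show ?thesis by (simp add: power2_eq_square algebra_simps flip: q_def)
qed

text \<open>Let n_0, n_1, n_2 be the squared norms of \<open>H\<close> and of its first two
  successive averages. Then \<open>shear_pair_ineq\<close> reads (q - 1)(n_1 - n_2) \<le> n_0 - n_1,
  and along the list these inequalities telescope. Each average remains invariant under the shears
  among the coordinates still to come (\<open>avg_shear\<close>).\<close>

lemma chain_ineq:
  assumes "distinct (j # js)" "set (j # js) \<subseteq> S"
    and "\<And>i k t x. i \<in> set (j # js) \<Longrightarrow> k \<in> set (j # js) \<Longrightarrow> i \<noteq> k \<Longrightarrow> H (shear i k t x) = H x"
  shows "(real CARD('q) - 1) * ((\<Sum>x\<in>UNIV. (avg j H x)\<^sup>2) - (\<Sum>x\<in>UNIV. (fold avg js (avg j H) x)\<^sup>2))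
    \<le> (\<Sum>x\<in>UNIV. (H x)\<^sup>2)"
  using assms
proof (induction js arbitrary: j H)
  case Nil
  thus ?case by (simp add: sum_nonneg)
next
  case (Cons k js)
  let ?n = "\<lambda>F. \<Sum>x\<in>UNIV. (F x)\<^sup>2"
  have "(real CARD('q) - 1) * (?n (avg k (avg j H)) - ?n (fold avg js (avg k (avg j H)))) \<le> ?n (avg j H)"
    using Cons.prems by (intro Cons.IH) (auto intro!: avg_shear)
  moreover have "CARD('q) * (?n (avg j H) - ?n (avg k (avg j H))) \<le> ?n H - ?n (avg k (avg j H))"
    using Cons.prems by (intro shear_pair_ineq) auto
  ultimately show ?case by (simp add: algebra_simps)
qed

definition coset :: "'n set \<Rightarrow> ('n \<Rightarrow> 'q ^ 'm) \<times> 'y \<Rightarrow> ('n \<Rightarrow> 'q ^ 'm) set"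
  where "coset T x = {a. (\<forall>k\<in>T. a k - fst x k \<in> W x) \<and> (\<forall>k. k \<notin> T \<longrightarrow> a k = fst x k)}"

text \<open>\<open>W\<close> does not change along the coset, so the iterated averages combine into
  one uniform average.\<close>

lemma fold_avg_eq:
  assumes "distinct js" "set js \<subseteq> S"
  shows "fold avg js F x = (\<Sum>a\<in>coset (set js) x. F (a, snd x)) / card (W x) ^ length js"
  using assms
proof (induction js arbitrary: F x)
  case Nil
  have "coset {} x = {fst x}" by (auto simp: coset_def)
  thus ?case by simp
next
  case (Cons j js)
  let ?T = "set js"
  have bij: "bij_betw (\<lambda>(a, b). a(j := a j + b)) (coset ?T x \<times> W x) (coset (insert j ?T) x)"
    using Cons.prems
    by (intro bij_betw_byWitness[where f' = "\<lambda>a. (a(j := fst x j), a j - fst x j)"])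
      (auto simp: coset_def)
  have W: "W (a, snd x) = W x" if "a \<in> coset ?T x" for a
  proof -
    have "W (\<lambda>k. if k \<in> T then a k else fst x k, snd x) = W x" if "T \<subseteq> ?T" for T
      using finite_subset[OF that finite_set] that
    proof (induction T rule: finite_induct)
      case (insert k T)
      have "(\<lambda>l. if l \<in> insert k T then a l else fst x l)
          = (\<lambda>l. if l \<in> T then a l else fst x l)(k := a k)" by auto
      moreover have "k \<in> S" using insert.prems Cons.prems by auto
      ultimately show ?case using insert by (simp add: W_translate)
    qed simp
    moreover have "(\<lambda>k. if k \<in> ?T then a k else fst x k) = a" using that by (auto simp: coset_def)
    ultimately show ?thesis by force
  qed
  have "fold avg (j # js) F x = (\<Sum>a\<in>coset ?T x. avg j F (a, snd x)) / card (W x) ^ length js"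
    using Cons by simp
  also have "(\<Sum>a\<in>coset ?T x. avg j F (a, snd x))
      = (\<Sum>a\<in>coset ?T x. \<Sum>b\<in>W x. F (a(j := a j + b), snd x)) / card (W x)"
    unfolding sum_divide_distrib by (intro sum.cong refl) (simp add: avg_def tr_def W sum_divide_distrib)
  also have "(\<Sum>a\<in>coset ?T x. \<Sum>b\<in>W x. F (a(j := a j + b), snd x))
      = (\<Sum>a\<in>coset (insert j ?T) x. F (a, snd x))"
    by (subst sum.reindex_bij_betw[OF bij, symmetric]) (simp add: sum.cartesian_product case_prod_unfold)
  finally show ?case by (simp add: mult.commute)
qed

text \<open>Run the chain from \<open>j\<close> through all of \<open>S\<close>: its last average is
  over a whole coset and vanishes, so only the first one remains. The bound does not depend on the
  size of \<open>S\<close>.\<close>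

lemma avg_norm_le:
  assumes j: "j \<in> S"
    and inv: "\<And>i k t x. i \<in> S \<Longrightarrow> k \<in> S \<Longrightarrow> i \<noteq> k \<Longrightarrow> F (shear i k t x) = F x"
    and zero: "\<And>x. (\<Sum>a\<in>coset S x. F (a, snd x)) = 0"
  shows "(real CARD('q) - 1) * (\<Sum>x\<in>UNIV. F x * avg j F x) \<le> (\<Sum>x\<in>UNIV. (F x)\<^sup>2)"
proof -
  obtain js where js: "set js = S - {j}" "distinct js" using finite_distinct_list[of "S - {j}"] by auto
  hence js': "distinct (j # js)" "set (j # js) = S" using j by auto
  have "fold avg (j # js) F x = 0" for x
    using zero[of x] js' by (subst fold_avg_eq) auto
  moreover have "(\<Sum>x\<in>UNIV. (avg j F x)\<^sup>2) = (\<Sum>x\<in>UNIV. F x * avg j F x)"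
    by (rule sum_inner_selfadj_idem) (use j avg_adjoint avg_idem in auto)
  moreover have "(real CARD('q) - 1) * ((\<Sum>x\<in>UNIV. (avg j F x)\<^sup>2)
      - (\<Sum>x\<in>UNIV. (fold avg js (avg j F) x)\<^sup>2)) \<le> (\<Sum>x\<in>UNIV. (F x)\<^sup>2)"
    by (rule chain_ineq[OF js'(1)]) (use js'(2) inv in auto)
  ultimately show ?thesis by simp
qed

end

section \<open>Frames and sums of rank-one matrices\<close>

definition dot :: "'q::comm_ring_1 ^ 'n \<Rightarrow> 'q ^ 'n \<Rightarrow> 'q"
  where "dot a b = (\<Sum>i\<in>UNIV. a $ i * b $ i)"

lemma dot_add_left: "dot (a + b) c = dot a c + dot b c"
  by (simp add: dot_def algebra_simps sum.distrib)

lemma dot_add_right: "dot a (b + c) = dot a b + dot a c"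
  by (simp add: dot_def algebra_simps sum.distrib)

lemma dot_diff_left: "dot (a - b) c = dot a c - dot b c"
  by (simp add: dot_def algebra_simps sum_subtractf)

lemma dot_diff_right: "dot a (b - c) = dot a b - dot a c"
  by (simp add: dot_def algebra_simps sum_subtractf)

lemma dot_scale_left: "dot (t *s a) b = t * dot a b"
  by (simp add: dot_def algebra_simps sum_distrib_left)

lemma dot_scale_right: "dot a (t *s b) = t * dot a b"
  by (simp add: dot_def algebra_simps sum_distrib_left)

lemma dot_0_left: "dot 0 a = 0" and dot_0_right: "dot a 0 = 0"
  by (simp_all add: dot_def)

lemma dot_sum_left: "dot (\<Sum>k\<in>K. a k) b = (\<Sum>k\<in>K. dot (a k) b)"
  by (induction K rule: infinite_finite_induct) (simp_all add: dot_add_left dot_0_left)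

lemma dot_sum_right: "dot b (\<Sum>k\<in>K. a k) = (\<Sum>k\<in>K. dot b (a k))"
  by (induction K rule: infinite_finite_induct) (simp_all add: dot_add_right dot_0_right)

lemma dot_commute: "dot a b = dot b a"
  by (simp add: dot_def mult.commute)

lemmas dot_simps = dot_add_left dot_add_right dot_diff_left dot_diff_right dot_scale_left
  dot_scale_right dot_0_left dot_0_right

lemma dot_vector_matrix_mult: "dot (z v* A) v = dot z (A *v v)"
proof -
  have "(\<Sum>j\<in>UNIV. \<Sum>i\<in>UNIV. z $ i * A $ i $ j * v $ j)
      = (\<Sum>i\<in>UNIV. \<Sum>j\<in>UNIV. z $ i * A $ i $ j * v $ j)" by (rule sum.swap)
  thus ?thesis
    by (simp add: dot_def vector_matrix_mult_def matrix_vector_mult_def sum_distrib_left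
      sum_distrib_right mult.assoc)
qed

lemma outer_mult_vec: "outer e f *v v = dot f v *s e"
  by (simp add: Finite_Cartesian_Product.vec_eq_iff outer_def matrix_vector_mult_def dot_def
    sum_distrib_left ac_simps)

lemma vec_mult_outer: "z v* outer e f = dot z e *s f"
  by (simp add: Finite_Cartesian_Product.vec_eq_iff outer_def vector_matrix_mult_def dot_def
    sum_distrib_left ac_simps)

lemma sum_matrix_vec: "(\<Sum>k\<in>K. A k) *v v = (\<Sum>k\<in>K. A k *v v)"
  by (induction K rule: infinite_finite_induct) (simp_all add: matrix_vector_mult_add_rdistrib)

lemma vec_mult_sum: "z v* (\<Sum>k\<in>K. A k) = (\<Sum>k\<in>K. z v* A k)"
  by (induction K rule: infinite_finite_induct) (simp_all add: vector_matrix_mult_add_rdistrib)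

lemma matrix_vec_sum: "A *v (\<Sum>k\<in>K. v k) = (\<Sum>k\<in>K. A *v v k)"
  by (induction K rule: infinite_finite_induct) (simp_all add: matrix_vector_right_distrib)

lemma matrix_vec_scale: "A *v (c *s v) = c *s (A *v (v :: 'q::field ^ 'n))"
  by (simp add: Finite_Cartesian_Product.vec_eq_iff matrix_vector_mult_def sum_distrib_left algebra_simps)

section \<open>Bases of the n-dimensional space and their dual bases\<close>

definition dual :: "('n \<Rightarrow> 'q::field ^ 'n) \<Rightarrow> ('n \<Rightarrow> 'q ^ 'n) \<Rightarrow> bool"
  where "dual \<zeta> e \<longleftrightarrow> (\<forall>k l. dot (\<zeta> k) (e l) = (if k = l then 1 else 0))"

text \<open>A basis, indexed by the coordinate type itself: with as many vectors as coordinates, a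
  left inverse is a right inverse, so having a dual family suffices
  (\<open>frame_expand\<close>).\<close>

definition frame :: "('n \<Rightarrow> 'q::field ^ 'n) \<Rightarrow> bool"
  where "frame e \<longleftrightarrow> (\<exists>\<zeta>. dual \<zeta> e)"

lemma dualD: "dual \<zeta> e \<Longrightarrow> dot (\<zeta> k) (e l) = (if k = l then 1 else 0)"
  by (simp add: dual_def)

lemma frame_expand:
  assumes "dual \<zeta> e"
  shows "(\<Sum>k\<in>UNIV. dot (\<zeta> k) v *s e k) = v"
proof -
  define Z :: "'b ^ 'a ^ 'a" where "Z = (\<chi> k i. \<zeta> k $ i)"
  define E :: "'b ^ 'a ^ 'a" where "E = (\<chi> i l. e l $ i)"
  have "Z ** E = Finite_Cartesian_Product.mat 1"
    using dualD[OF assms]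
    by (simp add: Finite_Cartesian_Product.vec_eq_iff matrix_matrix_mult_def Z_def E_def
      Finite_Cartesian_Product.mat_def dot_def)
  hence "E ** Z = Finite_Cartesian_Product.mat 1" by (simp add: matrix_left_right_inverse)
  hence "v = E *v (Z *v v)" by (simp add: matrix_vector_mul_assoc)
  also have "Z *v v = (\<chi> k. dot (\<zeta> k) v)"
    by (simp add: Finite_Cartesian_Product.vec_eq_iff matrix_vector_mult_def Z_def dot_def)
  also have "E *v \<dots> = (\<Sum>k\<in>UNIV. dot (\<zeta> k) v *s e k)"
    by (simp add: Finite_Cartesian_Product.vec_eq_iff matrix_vector_mult_def E_def mult.commute)
  finally show ?thesis by simp
qed

lemma frame_ext:
  assumes "dual \<zeta> e" and "\<And>k. dot (\<zeta> k) v = dot (\<zeta> k) w"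
  shows "v = w"
proof -
  have "v = (\<Sum>k\<in>UNIV. dot (\<zeta> k) v *s e k)" by (rule frame_expand[OF assms(1), symmetric])
  also have "\<dots> = (\<Sum>k\<in>UNIV. dot (\<zeta> k) w *s e k)" by (simp only: assms(2))
  also have "\<dots> = w" by (rule frame_expand[OF assms(1)])
  finally show ?thesis .
qed

lemma dot_span_zero:
  assumes "\<And>x. x \<in> A \<Longrightarrow> dot z x = 0" "v \<in> vec.span A"
  shows "dot z v = 0"
proof -
  have "vec.subspace {x. dot z x = 0}" by (auto simp: vec.subspace_def dot_simps)
  hence "vec.span A \<subseteq> {x. dot z x = 0}" using assms(1) by (intro vec.span_minimal) auto
  thus ?thesis using assms(2) by auto
qed

lemma dual_not_in_span:
  assumes "dual \<zeta> e" "k \<notin> T"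
  shows "e k \<notin> vec.span (e ` T)"
proof
  assume "e k \<in> vec.span (e ` T)"
  moreover have "dot (\<zeta> k) x = 0" if "x \<in> e ` T" for x using that assms by (auto simp: dual_def)
  ultimately have "dot (\<zeta> k) (e k) = 0" by (rule dot_span_zero[rotated])
  thus False using assms by (simp add: dual_def)
qed

text \<open>Exchange step. The new dual family rescales \<open>\<zeta> j\<close> and corrects the
  other covectors by multiples of it.\<close>

lemma frame_update:
  assumes "dual \<zeta> e" "dot (\<zeta> j) b \<noteq> 0"
  shows "frame (e(j := b))"
proof -
  define c where "c = inverse (dot (\<zeta> j) b)"
  have "dual (\<lambda>k. if k = j then c *s \<zeta> j else \<zeta> k - (dot (\<zeta> k) b * c) *s \<zeta> j) (e(j := b))"
    unfolding dual_def
  proof (intro allI)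
    fix k l
    show "dot (if k = j then c *s \<zeta> j else \<zeta> k - (dot (\<zeta> k) b * c) *s \<zeta> j) ((e(j := b)) l) = (if k = l then 1 else 0)"
      using assms(2) by (cases "k = j"; cases "l = j") (simp_all add: dot_simps dualD[OF assms(1)] c_def)
  qed
  thus ?thesis by (auto simp: frame_def)
qed

text \<open>Gaussian elimination with \<open>f i\<close> as pivot; in the dual family only the
  covector of \<open>i\<close> changes.\<close>

lemma frame_eliminate:
  assumes "frame f" "s \<noteq> 0"
  shows "frame (\<lambda>k. if k = i then s *s f i else f k - c k *s f i)"
proof -
  obtain \<zeta> where \<zeta>: "dual \<zeta> f" using assms by (auto simp: frame_def)
  have S: "dot (\<Sum>l\<in>UNIV - {i}. c l *s \<zeta> l) (f m) = (if m = i then 0 else c m)" for m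
  proof -
    have "dot (\<Sum>l\<in>UNIV - {i}. c l *s \<zeta> l) (f m) = (\<Sum>l\<in>UNIV - {i}. if l = m then c l else 0)"
      unfolding dot_sum_left by (intro sum.cong refl) (simp add: dot_simps dualD[OF \<zeta>])
    thus ?thesis by (simp add: sum.delta)
  qed
  have "dual (\<lambda>k. if k = i then inverse s *s (\<zeta> i + (\<Sum>l\<in>UNIV - {i}. c l *s \<zeta> l)) else \<zeta> k)
      (\<lambda>k. if k = i then s *s f i else f k - c k *s f i)"
    using assms(2) unfolding dual_def
    by (intro allI, case_tac "k = i"; case_tac "l = i") (simp_all add: dot_simps S dualD[OF \<zeta>])
  thus ?thesis by (auto simp: frame_def)
qed

lemma frame_comp:
  assumes "frame e" "bij p"
  shows "frame (\<lambda>k. e (p k))"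
proof -
  obtain \<zeta> where "dual \<zeta> e" using assms by (auto simp: frame_def)
  hence "dual (\<lambda>k. \<zeta> (p k)) (\<lambda>k. e (p k))"
    using assms(2) by (simp add: dual_def bij_is_inj inj_eq)
  thus ?thesis by (auto simp: frame_def)
qed

text \<open>The linear map that takes the basis with dual family \<open>\<zeta>\<close> to
  \<open>e\<close>.\<close>

definition frame_map :: "('n \<Rightarrow> 'q::field ^ 'n) \<Rightarrow> ('n \<Rightarrow> 'q ^ 'n) \<Rightarrow> 'q ^ 'n ^ 'n"
  where "frame_map \<zeta> e = (\<Sum>k\<in>UNIV. outer (e k) (\<zeta> k))"

lemma frame_map_mult: "frame_map \<zeta> e *v v = (\<Sum>k\<in>UNIV. dot (\<zeta> k) v *s e k)"
  by (simp add: frame_map_def sum_matrix_vec outer_mult_vec)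

lemma frame_map_apply: "dual \<zeta> e \<Longrightarrow> frame_map \<zeta> e' *v e k = e' k"
  by (simp add: frame_map_mult dualD if_distrib[of "\<lambda>x. x *s _"] cong: if_cong)

lemma frame_map_inverse:
  assumes "dual \<zeta> e" "dual \<zeta>' e'"
  shows "frame_map \<zeta>' e *v (frame_map \<zeta> e' *v v) = v"
proof -
  have "frame_map \<zeta>' e *v (frame_map \<zeta> e' *v v) = (\<Sum>k\<in>UNIV. dot (\<zeta> k) v *s e k)"
    by (simp add: frame_map_mult[of \<zeta>] matrix_vec_sum matrix_vec_scale
      frame_map_apply[OF assms(2)])
  thus ?thesis using frame_expand[OF assms(1)] by simp
qed

lemma frame_matrix_image:
  assumes "frame e" "\<And>v. B *v (A *v v) = v"
  shows "frame (\<lambda>k. A *v e k)"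
proof -
  obtain \<zeta> where "dual \<zeta> e" using assms by (auto simp: frame_def)
  hence "dual (\<lambda>k. \<zeta> k v* B) (\<lambda>k. A *v e k)"
    by (simp add: dual_def dot_vector_matrix_mult assms(2))
  thus ?thesis by (auto simp: frame_def)
qed

section \<open>Pairs of frames under linear maps and transvections\<close>

type_synonym ('q, 'n) pairs = "'n \<Rightarrow> ('q ^ 'n) \<times> ('q ^ 'n)"

definition frames :: "('q::field, 'n::finite) pairs set"
  where "frames = {\<Phi>. frame (\<lambda>k. fst (\<Phi> k)) \<and> frame (\<lambda>k. snd (\<Phi> k))}"

lemma framesE:
  assumes "\<Phi> \<in> frames"
  obtains \<zeta> \<eta> where "dual \<zeta> (\<lambda>k. fst (\<Phi> k))" "dual \<eta> (\<lambda>k. snd (\<Phi> k))"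
  using assms unfolding frames_def frame_def mem_Collect_eq by (elim conjE exE) (rule that)

definition psum :: "'n set \<Rightarrow> ('q::field, 'n::finite) pairs \<Rightarrow> 'q ^ 'n ^ 'n"
  where "psum K \<Phi> = (\<Sum>k\<in>K. outer (fst (\<Phi> k)) (snd (\<Phi> k)))"

text \<open>Acts on every sum of rank-one matrices by X \<mapsto> A X B^T, whatever the index
  set.\<close>

definition pair_map :: "'q::field ^ 'n ^ 'n \<Rightarrow> 'q ^ 'n ^ 'n \<Rightarrow> ('q, 'n::finite) pairs \<Rightarrow> ('q, 'n) pairs"
  where "pair_map A B \<Phi> k = (A *v fst (\<Phi> k), B *v snd (\<Phi> k))"

lemma psum_pair_map: "psum K (pair_map A B \<Phi>) *v \<eta> = A *v (psum K \<Phi> *v (\<eta> v* B))"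
proof -
  have "dot (B *v f) \<eta> = dot f (\<eta> v* B)" for f
    by (simp add: dot_commute[of _ \<eta>] dot_commute[of f] dot_vector_matrix_mult)
  thus ?thesis
    by (simp add: psum_def pair_map_def sum_matrix_vec outer_mult_vec matrix_vec_sum matrix_vec_scale)
qed

lemma psum_pair_map_cong:
  "psum K \<Phi> = psum L \<Phi>' \<Longrightarrow> psum K (pair_map A B \<Phi>) = psum L (pair_map A B \<Phi>')"
  by (simp add: matrix_eq psum_pair_map)

text \<open>Pairs of invertible matrices act transitively on pairs of bases; dual bases provide the
  matrices and their inverses.\<close>

lemma pair_map_transitive:
  assumes "\<Phi>1 \<in> frames" "\<Phi>2 \<in> frames"
  obtains A B where "pair_map A B \<Phi>1 = \<Phi>2" "inj (pair_map A B)" "pair_map A B ` frames \<subseteq> frames"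
proof -
  obtain z1 y1 where d1: "dual z1 (\<lambda>k. fst (\<Phi>1 k))" "dual y1 (\<lambda>k. snd (\<Phi>1 k))"
    by (rule framesE[OF assms(1)])
  obtain z2 y2 where d2: "dual z2 (\<lambda>k. fst (\<Phi>2 k))" "dual y2 (\<lambda>k. snd (\<Phi>2 k))"
    by (rule framesE[OF assms(2)])
  note d = d1 d2
  define A B where "A = frame_map z1 (\<lambda>k. fst (\<Phi>2 k))" and "B = frame_map y1 (\<lambda>k. snd (\<Phi>2 k))"
  define A' B' where "A' = frame_map z2 (\<lambda>k. fst (\<Phi>1 k))" and "B' = frame_map y2 (\<lambda>k. snd (\<Phi>1 k))"
  have inv: "A' *v (A *v v) = v" "B' *v (B *v v) = v" for v
    unfolding A_def B_def A'_def B'_def by (rule frame_map_inverse; fact d)+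
  show ?thesis
  proof
    show "pair_map A B \<Phi>1 = \<Phi>2"
      by (rule ext) (simp add: pair_map_def A_def B_def frame_map_apply[OF d(1)] frame_map_apply[OF d(2)])
    have "pair_map A' B' (pair_map A B \<Phi>) = \<Phi>" for \<Phi>
      by (rule ext) (simp add: pair_map_def inv)
    thus "inj (pair_map A B)" by (intro inj_on_inverseI[where g = "pair_map A' B'"]) simp
    show "pair_map A B ` frames \<subseteq> frames"
      by (auto simp: frames_def pair_map_def
        intro: frame_matrix_image[OF _ inv(1)] frame_matrix_image[OF _ inv(2)])
  qed
qed

text \<open>The change of \<open>snd (\<Phi> i)\<close> compensates the change of \<open>fst (\<Phi> j)\<close> in every sum of rank-one matrices
  over an index set containing both \<open>i\<close> and \<open>j\<close>.\<close>

definition T :: "'n \<Rightarrow> 'n \<Rightarrow> 'q::field \<Rightarrow> ('q, 'n::finite) pairs \<Rightarrow> ('q, 'n) pairs"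
  where "T i j t \<Phi> = (\<lambda>k. if k = j then (fst (\<Phi> j) + t *s fst (\<Phi> i), snd (\<Phi> j))
    else if k = i then (fst (\<Phi> i), snd (\<Phi> i) - t *s snd (\<Phi> j)) else \<Phi> k)"

lemma T_frames:
  assumes "i \<noteq> j" "\<Phi> \<in> frames"
  shows "T i j t \<Phi> \<in> frames"
proof -
  obtain \<zeta> \<eta> where d: "dual \<zeta> (\<lambda>k. fst (\<Phi> k))" "dual \<eta> (\<lambda>k. snd (\<Phi> k))"
    by (rule framesE[OF assms(2)])
  have "frame ((\<lambda>k. fst (\<Phi> k))(j := fst (\<Phi> j) + t *s fst (\<Phi> i)))"
    using assms(1) by (intro frame_update[OF d(1)]) (simp add: dot_simps dualD[OF d(1)])
  moreover have "(\<lambda>k. fst (\<Phi> k))(j := fst (\<Phi> j) + t *s fst (\<Phi> i)) = (\<lambda>k. fst (T i j t \<Phi> k))"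
    by (rule ext) (simp add: T_def)
  moreover have "frame ((\<lambda>k. snd (\<Phi> k))(i := snd (\<Phi> i) - t *s snd (\<Phi> j)))"
    using assms(1) by (intro frame_update[OF d(2)]) (simp add: dot_simps dualD[OF d(2)])
  moreover have "(\<lambda>k. snd (\<Phi> k))(i := snd (\<Phi> i) - t *s snd (\<Phi> j)) = (\<lambda>k. snd (T i j t \<Phi> k))"
    using assms(1) by (intro ext) (simp add: T_def)
  ultimately show ?thesis by (simp add: frames_def)
qed

lemma outer_shear:
  "outer a (c - t *s d) + outer (b + t *s a) d = outer a c + outer b (d :: 'q::field ^ 'n)"
  by (simp add: Finite_Cartesian_Product.vec_eq_iff outer_def) (simp add: algebra_simps)

lemma psum_T:
  fixes \<Phi> :: "('q::field, 'n::finite) pairs"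
  assumes "i \<noteq> j" "i \<in> K \<longleftrightarrow> j \<in> K"
  shows "psum K (T i j t \<Phi>) = psum K \<Phi>"
proof (cases "i \<in> K")
  case False
  have "T i j t \<Phi> k = \<Phi> k" if "k \<in> K" for k
    using that False assms by (auto simp: T_def)
  thus ?thesis unfolding psum_def by (intro sum.cong refl arg_cong2[where f = outer]) simp_all
next
  case True
  define R where "R = K - {i} - {j}"
  have split: "(\<Sum>k\<in>K. h k) = h i + (h j + (\<Sum>k\<in>R. h k))" for h :: "'n \<Rightarrow> 'q ^ 'n ^ 'n"
    unfolding R_def using True assms
    by (subst sum.remove[of K i], simp, simp, subst sum.remove[of "K - {i}" j]) simp_all
  have "T i j t \<Phi> k = \<Phi> k" if "k \<in> R" for k
    using that by (simp add: T_def R_def)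
  hence "(\<Sum>k\<in>R. outer (fst (T i j t \<Phi> k)) (snd (T i j t \<Phi> k)))
      = (\<Sum>k\<in>R. outer (fst (\<Phi> k)) (snd (\<Phi> k)))"
    by (intro sum.cong refl arg_cong2[where f = outer]) simp_all
  moreover have "T i j t \<Phi> j = (fst (\<Phi> j) + t *s fst (\<Phi> i), snd (\<Phi> j))"
    "T i j t \<Phi> i = (fst (\<Phi> i), snd (\<Phi> i) - t *s snd (\<Phi> j))"
    using assms(1) by (simp_all add: T_def)
  ultimately show ?thesis
    unfolding psum_def split
    using outer_shear[of "fst (\<Phi> i)" "snd (\<Phi> i)" t "snd (\<Phi> j)" "fst (\<Phi> j)"]
    by (simp add: add.assoc[symmetric])
qed

lemma T_param: "i \<noteq> j \<Longrightarrow> T i j s (T i j t \<Phi>) = T i j (s + t) \<Phi>" "T i j 0 \<Phi> = \<Phi>"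
  by (rule ext, simp add: T_def vec.scale_left_distrib algebra_simps)+

section \<open>Pairs of frames with prescribed class sums\<close>

lemma sum_fibers:
  fixes h :: "'b::finite \<Rightarrow> real"
  assumes "finite A"
  shows "(\<Sum>x\<in>A. h (g x)) = (\<Sum>y\<in>UNIV. card {x \<in> A. g x = y} * h y)"
proof -
  have "(\<Sum>x\<in>A. h (g x)) = (\<Sum>y\<in>UNIV. \<Sum>x\<in>{x \<in> A. g x = y}. h (g x))"
    by (rule sum.group[symmetric]) (use assms in auto)
  also have "\<dots> = (\<Sum>y\<in>UNIV. card {x \<in> A. g x = y} * h y)"
    by (intro sum.cong refl) simp
  finally show ?thesis .
qed

text \<open>Grouped by the value of \<open>c\<close>, the double sum is a sum of squares.\<close>

lemma sum_same_class_nonneg: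
  fixes f :: "'b \<Rightarrow> real"
  assumes "finite X"
  shows "0 \<le> (\<Sum>x\<in>X. \<Sum>y\<in>{y \<in> X. c y = c x}. f y * f x)"
proof -
  have "(\<Sum>x\<in>X. \<Sum>y\<in>{y \<in> X. c y = c x}. f y * f x)
      = (\<Sum>z\<in>c ` X. \<Sum>x\<in>{x \<in> X. c x = z}. \<Sum>y\<in>{y \<in> X. c y = c x}. f y * f x)"
    by (rule sum.group[symmetric]) (use assms in auto)
  also have "\<dots> = (\<Sum>z\<in>c ` X. (\<Sum>x\<in>{x \<in> X. c x = z}. f x)\<^sup>2)"
  proof (intro sum.cong refl)
    fix z
    have "(\<Sum>x\<in>{x \<in> X. c x = z}. \<Sum>y\<in>{y \<in> X. c y = c x}. f y * f x)
        = (\<Sum>x\<in>{x \<in> X. c x = z}. \<Sum>y\<in>{y \<in> X. c y = z}. f x * f y)"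
      by (intro sum.cong) (auto simp: mult.commute)
    thus "(\<Sum>x\<in>{x \<in> X. c x = z}. \<Sum>y\<in>{y \<in> X. c y = c x}. f y * f x)
        = (\<Sum>x\<in>{x \<in> X. c x = z}. f x)\<^sup>2"
      by (simp add: power2_eq_square sum_product)
  qed
  finally show ?thesis by (simp add: sum_nonneg)
qed

locale config =
  fixes cl :: "'n::finite \<Rightarrow> nat" and M :: "nat \<Rightarrow> 'q::{field,finite} ^ 'n ^ 'n"
begin

definition cls :: "nat \<Rightarrow> 'n set"
  where "cls c = {k. cl k = c}"

text \<open>Class 0 carries no condition: in the application its labels occur in none of the
  matrices that are fixed.\<close>

definition \<Omega> :: "('q, 'n) pairs set"
  where "\<Omega> = {\<Phi> \<in> frames. \<forall>c. c \<noteq> 0 \<longrightarrow> psum (cls c) \<Phi> = M c}"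

lemma T_\<Omega>: "i \<noteq> j \<Longrightarrow> cl i = cl j \<Longrightarrow> \<Phi> \<in> \<Omega> \<Longrightarrow> T i j t \<Phi> \<in> \<Omega>"
  by (simp add: \<Omega>_def T_frames psum_T cls_def)

lemma T_action: "i \<noteq> j \<Longrightarrow> cl i = cl j \<Longrightarrow> param_action \<Omega> (T i j)"
  by (simp add: param_action_def T_param T_\<Omega>)

text \<open>A pair of matrices that takes one element of \<open>\<Omega>\<close> to another fixes
  every \<open>M c\<close> with \<open>c \<noteq> 0\<close>, because the image of a class sum
  depends only on its value. Hence it maps all of \<open>\<Omega>\<close> to
  \<open>\<Omega>\<close>.\<close>

lemma \<Omega>_transitive:
  assumes "\<Phi>1 \<in> \<Omega>" "\<Phi>2 \<in> \<Omega>"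
  obtains A B where "pair_map A B \<Phi>1 = \<Phi>2" "inj (pair_map A B)" "pair_map A B ` \<Omega> \<subseteq> \<Omega>"
proof -
  have "\<Phi>1 \<in> frames" "\<Phi>2 \<in> frames" using assms by (auto simp: \<Omega>_def)
  then obtain A B where AB: "pair_map A B \<Phi>1 = \<Phi>2" "inj (pair_map A B)" "pair_map A B ` frames \<subseteq> frames"
    by (rule pair_map_transitive)
  have "pair_map A B \<Phi> \<in> \<Omega>" if "\<Phi> \<in> \<Omega>" for \<Phi>
  proof -
    have "psum (cls c) (pair_map A B \<Phi>) = M c" if c: "c \<noteq> 0" for c
    proof -
      have "psum (cls c) \<Phi> = psum (cls c) \<Phi>1" using \<open>\<Phi> \<in> \<Omega>\<close> assms(1) c by (simp add: \<Omega>_def)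
      hence "psum (cls c) (pair_map A B \<Phi>) = psum (cls c) (pair_map A B \<Phi>1)"
        by (rule psum_pair_map_cong)
      thus ?thesis using AB(1) assms(2) c by (simp add: \<Omega>_def)
    qed
    thus ?thesis using AB(3) that by (auto simp: \<Omega>_def)
  qed
  thus ?thesis using that AB by blast
qed

lemma card_fiber_le:
  assumes "\<Phi>1 \<in> \<Omega>" "\<Phi>2 \<in> \<Omega>"
    and eq: "\<And>A B \<Phi> \<Phi>'. key \<Phi> = key \<Phi>' \<Longrightarrow> key (pair_map A B \<Phi>) = key (pair_map A B \<Phi>')"
  shows "card {\<Phi> \<in> \<Omega>. key \<Phi> = key \<Phi>1} \<le> card {\<Phi> \<in> \<Omega>. key \<Phi> = key \<Phi>2}"
proof -
  obtain A B where AB: "pair_map A B \<Phi>1 = \<Phi>2" "inj (pair_map A B)" "pair_map A B ` \<Omega> \<subseteq> \<Omega>"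
    using \<Omega>_transitive[OF assms(1,2)] by blast
  show ?thesis
  proof (rule card_inj_on_le[of "pair_map A B"])
    show "inj_on (pair_map A B) {\<Phi> \<in> \<Omega>. key \<Phi> = key \<Phi>1}" using AB(2) by (rule inj_on_subset) simp
    show "pair_map A B ` {\<Phi> \<in> \<Omega>. key \<Phi> = key \<Phi>1} \<subseteq> {\<Phi> \<in> \<Omega>. key \<Phi> = key \<Phi>2}"
      using AB(3) eq[of _ \<Phi>1 A B] unfolding AB(1) by blast
  qed simp
qed

text \<open>Transitivity makes all fibres equally large. Equivariance of \<open>key\<close> is
  expressed as compatibility of the action with equality of keys.\<close>

lemma card_fiber:
  assumes "\<Phi>1 \<in> \<Omega>" "\<Phi>2 \<in> \<Omega>"
    and "\<And>A B \<Phi> \<Phi>'. key \<Phi> = key \<Phi>' \<Longrightarrow> key (pair_map A B \<Phi>) = key (pair_map A B \<Phi>')"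
  shows "card {\<Phi> \<in> \<Omega>. key \<Phi> = key \<Phi>1} = card {\<Phi> \<in> \<Omega>. key \<Phi> = key \<Phi>2}"
proof (rule order.antisym)
  show "card {\<Phi> \<in> \<Omega>. key \<Phi> = key \<Phi>1} \<le> card {\<Phi> \<in> \<Omega>. key \<Phi> = key \<Phi>2}"
    by (rule card_fiber_le[where key = key, OF assms(1,2)]) (rule assms(3))
  show "card {\<Phi> \<in> \<Omega>. key \<Phi> = key \<Phi>2} \<le> card {\<Phi> \<in> \<Omega>. key \<Phi> = key \<Phi>1}"
    by (rule card_fiber_le[where key = key, OF assms(2,1)]) (rule assms(3))
qed

lemma M_mult:
  assumes "\<Phi> \<in> \<Omega>" "c \<noteq> 0"
  shows "M c *v v = (\<Sum>k\<in>cls c. dot (snd (\<Phi> k)) v *s fst (\<Phi> k))"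
proof -
  have "M c = psum (cls c) \<Phi>" using assms by (simp add: \<Omega>_def)
  thus ?thesis by (simp add: psum_def sum_matrix_vec outer_mult_vec)
qed

text \<open>Reads the first vectors of a class off \<open>M c\<close>: they are the images of the
  dual vectors of the second frame. In particular they lie in the range of
  \<open>M c\<close>.\<close>

lemma M_mult_dual:
  assumes "\<Phi> \<in> \<Omega>" "c \<noteq> 0" "dual \<eta> (\<lambda>k. snd (\<Phi> k))" "k \<in> cls c"
  shows "M c *v \<eta> k = fst (\<Phi> k)"
proof -
  have "M c *v \<eta> k = (\<Sum>l\<in>cls c. if l = k then fst (\<Phi> l) else 0)"
    unfolding M_mult[OF assms(1,2)]
    by (intro sum.cong refl) (simp add: dot_commute[of "snd _"] dualD[OF assms(3)])
  thus ?thesis using assms(4) by (simp add: sum.delta)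
qed

end

text \<open>Everything is conditioned on a key: the first vectors outside \<open>I - S\<close> and the second vectors on
  \<open>J\<close>. The flag \<open>full\<close> selects whether \<open>J\<close> contains the part of the class in \<open>S\<close>.\<close>

locale config_side = config cl M for cl :: "'n::finite \<Rightarrow> nat" and M :: "nat \<Rightarrow> 'q::{field,finite} ^ 'n ^ 'n" +
  fixes S :: "'n set" and c :: nat and full :: bool
begin

abbreviation "I \<equiv> cls c"

definition JI :: "'n set"
  where "JI = (if full then S \<inter> I else {})"

definition J :: "'n set"
  where "J = - I \<union> JI"

definition key :: "('q, 'n) pairs \<Rightarrow> ('n \<Rightarrow> 'q ^ 'n) \<times> ('n \<Rightarrow> 'q ^ 'n)"
  where "key \<Phi> = (\<lambda>k. if k \<in> I - S then 0 else fst (\<Phi> k), \<lambda>k. if k \<in> J then snd (\<Phi> k) else 0)"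

text \<open>Where a hidden first vector of the class can lie: by \<open>M_mult_dual\<close> it is
  \<open>M c\<close> applied to a dual vector, and this annihilates the visible second vectors of
  the class. Class 0 imposes nothing.\<close>

definition W :: "('n \<Rightarrow> 'q ^ 'n) \<times> ('n \<Rightarrow> 'q ^ 'n) \<Rightarrow> ('q ^ 'n) set"
  where "W x = (if c = 0 then UNIV else {M c *v \<eta> | \<eta>. \<forall>j\<in>JI. dot (snd x j) \<eta> = 0})"

definition \<tau> :: "'n \<Rightarrow> 'n \<Rightarrow> 'q \<Rightarrow> ('n \<Rightarrow> 'q ^ 'n) \<Rightarrow> ('n \<Rightarrow> 'q ^ 'n)"
  where "\<tau> i j t g = (if i \<in> J then g(i := g i - t *s g j) else g)"

lemma W_cong: "(\<And>\<eta>. (\<forall>j\<in>JI. dot (snd x j) \<eta> = 0) = (\<forall>j\<in>JI. dot (snd y j) \<eta> = 0)) \<Longrightarrow> W x = W y"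
  by (simp add: W_def)

lemma JI_subset: "JI \<subseteq> S \<inter> I" "JI \<subseteq> J" "k \<in> J \<Longrightarrow> k \<notin> I - S"
  by (auto simp: JI_def J_def split: if_splits)

sublocale coordinate_translations "S \<inter> I" W \<tau>
proof
  fix x
  show "vec.subspace (W x)"
  proof (cases "c = 0")
    case True
    show ?thesis unfolding W_def if_P[OF True] by (rule vec.subspace_UNIV)
  next
    case False
    show ?thesis unfolding vec.subspace_def
    proof (intro conjI ballI allI)
      show "0 \<in> W x" using False by (auto simp: W_def dot_simps intro!: exI[of _ 0])
    next
      fix u v assume "u \<in> W x" "v \<in> W x"
      then obtain \<eta> \<theta> where "u = M c *v \<eta>" "v = M c *v \<theta>" "\<forall>j\<in>JI. dot (snd x j) \<eta> = 0"
        "\<forall>j\<in>JI. dot (snd x j) \<theta> = 0" using False by (auto simp: W_def)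
      thus "u + v \<in> W x" using False
        by (auto simp: W_def dot_simps matrix_vector_right_distrib intro!: exI[of _ "\<eta> + \<theta>"])
    next
      fix t u assume "u \<in> W x"
      then obtain \<eta> where "u = M c *v \<eta>" "\<forall>j\<in>JI. dot (snd x j) \<eta> = 0"
        using False by (auto simp: W_def)
      thus "t *s u \<in> W x" using False
        by (auto simp: W_def dot_simps matrix_vec_scale intro!: exI[of _ "t *s \<eta>"])
    qed
  qed
next
  fix j a b y show "W (a(j := b), y) = W (a, y)" by (rule W_cong) simp
next
  fix i j a t y assume ij: "i \<in> S \<inter> I" "j \<in> S \<inter> I" "i \<noteq> j"
  show "W (a, \<tau> i j t y) = W (a, y)"
  proof (rule W_cong)
    fix \<eta>
    show "(\<forall>l\<in>JI. dot (snd (a, \<tau> i j t y) l) \<eta> = 0) = (\<forall>l\<in>JI. dot (snd (a, y) l) \<eta> = 0)"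
    proof (cases full)
      case True
      \<comment> \<open>The shear subtracts a multiple of one visible second vector from another, so
        their common annihilator stays the same.\<close>
      hence "JI = S \<inter> I" "i \<in> J" using ij unfolding J_def JI_def by auto
      have j: "j \<noteq> i" "j \<in> JI" "i \<in> JI" using ij \<open>JI = S \<inter> I\<close> by auto
      have \<tau>: "\<tau> i j t y = y(i := y i - t *s y j)" using \<open>i \<in> J\<close> by (simp add: \<tau>_def)
      show ?thesis
      proof
        assume *: "\<forall>l\<in>JI. dot (snd (a, \<tau> i j t y) l) \<eta> = 0"
        have "dot (y j) \<eta> = 0" using bspec[OF * j(2)] j(1) by (simp add: \<tau>)
        moreover have "dot (y i) \<eta> = 0" using bspec[OF * j(3)] calculation by (simp add: \<tau> dot_simps)
        moreover have "dot (y l) \<eta> = 0" if "l \<in> JI" "l \<noteq> i" for l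
          using bspec[OF * that(1)] that(2) by (simp add: \<tau>)
        ultimately show "\<forall>l\<in>JI. dot (snd (a, y) l) \<eta> = 0" by (metis snd_conv)
      next
        assume "\<forall>l\<in>JI. dot (snd (a, y) l) \<eta> = 0"
        thus "\<forall>l\<in>JI. dot (snd (a, \<tau> i j t y) l) \<eta> = 0" using j by (simp add: \<tau> dot_simps)
      qed
    next
      case False
      thus ?thesis unfolding JI_def by simp
    qed
  qed
next
  fix i j :: 'n and s t y assume "i \<noteq> j"
  thus "\<tau> i j s (\<tau> i j t y) = \<tau> i j (s + t) y"
    by (simp add: \<tau>_def vec.scale_left_distrib algebra_simps)
next
  fix i j y show "\<tau> i j 0 y = y" by (simp add: \<tau>_def)
qed

definition spn :: "('n \<Rightarrow> 'q ^ 'n) \<times> ('n \<Rightarrow> 'q ^ 'n) \<Rightarrow> ('q ^ 'n) set"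
  where "spn x = vec.span (range (fst x))"

lemma spn_key: "spn (key \<Phi>) = vec.span ((\<lambda>k. fst (\<Phi> k)) ` (- (I - S)))"
  unfolding spn_def
proof (intro subset_antisym vec.span_minimal vec.subspace_span image_subsetI)
  fix k
  show "fst (key \<Phi>) k \<in> vec.span ((\<lambda>k. fst (\<Phi> k)) ` (- (I - S)))"
    by (cases "k \<in> I - S") (auto simp: key_def vec.span_zero intro!: vec.span_base)
next
  fix k assume "k \<in> - (I - S)"
  hence "fst (\<Phi> k) = fst (key \<Phi>) k" by (auto simp: key_def)
  thus "fst (\<Phi> k) \<in> vec.span (range (fst (key \<Phi>)))" by (auto intro: vec.span_base)
qed

lemma key_T:
  assumes "i \<in> S \<inter> I" "j \<in> S \<inter> I" "i \<noteq> j"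
  shows "key (T i j t \<Phi>) = shear i j t (key \<Phi>)"
proof -
  have "i \<in> J \<longleftrightarrow> j \<in> J" using assms by (auto simp: J_def JI_def)
  thus ?thesis using assms
    by (simp add: key_def shear_def \<tau>_def fun_eq_iff) (simp add: T_def)
qed

text \<open>With \<open>i\<close> hidden, only the change of the first vector of \<open>j\<close> is
  visible: a translation by a multiple of the vector that is to be resampled.\<close>

lemma key_T_out:
  assumes "i \<in> I - S" "j \<in> S \<inter> I"
  shows "key (T i j t \<Phi>) = tr j (t *s fst (\<Phi> i)) (key \<Phi>)"
proof -
  have "i \<notin> J" using assms JI_subset(3) by blast
  moreover have "i \<noteq> j" using assms by auto
  ultimately show ?thesis using assms by (auto simp: key_def tr_def fun_eq_iff T_def)
qed

lemma fst_in_W: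
  assumes "\<Phi> \<in> \<Omega>" "k \<in> I - S"
  shows "fst (\<Phi> k) \<in> W (key \<Phi>)"
proof (cases "c = 0")
  case False
  obtain \<zeta> \<eta> where d: "dual \<zeta> (\<lambda>k. fst (\<Phi> k))" "dual \<eta> (\<lambda>k. snd (\<Phi> k))"
    by (rule framesE[of \<Phi>]) (use assms \<Omega>_def in auto)
  have "M c *v \<eta> k = fst (\<Phi> k)" using M_mult_dual[OF assms(1) False d(2)] assms(2) by simp
  moreover have "dot (snd (key \<Phi>) j) (\<eta> k) = 0" if "j \<in> JI" for j
    using that JI_subset assms(2) dualD[OF d(2), of k j]
    by (auto simp: key_def dot_commute[of "snd _"])
  ultimately show ?thesis unfolding W_def if_not_P[OF False]
    by (intro CollectI exI[of _ "\<eta> k"]) simp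
next
  case True
  show ?thesis unfolding W_def if_P[OF True] by simp
qed

text \<open>The dual vectors of \<open>k\<close> in the two frames pair equally with every common
  second vector, so their difference annihilates these.\<close>

lemma fst_diff_in_W:
  assumes "\<Phi> \<in> \<Omega>" "\<Phi>' \<in> \<Omega>" "k \<in> I" and eq: "\<And>j. j \<in> J \<Longrightarrow> snd (\<Phi>' j) = snd (\<Phi> j)"
  shows "fst (\<Phi>' k) - fst (\<Phi> k) \<in> W (key \<Phi>)"
proof (cases "c = 0")
  case False
  obtain \<zeta> \<eta> where d: "dual \<zeta> (\<lambda>k. fst (\<Phi> k))" "dual \<eta> (\<lambda>k. snd (\<Phi> k))"
    by (rule framesE[of \<Phi>]) (use assms \<Omega>_def in auto)
  obtain \<zeta>' \<eta>' where d': "dual \<zeta>' (\<lambda>k. fst (\<Phi>' k))" "dual \<eta>' (\<lambda>k. snd (\<Phi>' k))"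
    by (rule framesE[of \<Phi>']) (use assms \<Omega>_def in auto)
  have "M c *v (\<eta>' k - \<eta> k) = fst (\<Phi>' k) - fst (\<Phi> k)"
    using M_mult_dual[OF assms(1) False d(2)] M_mult_dual[OF assms(2) False d'(2)] assms(3)
    by (simp add: matrix_vector_mult_diff_distrib)
  moreover have "dot (snd (key \<Phi>) j) (\<eta>' k - \<eta> k) = 0" if "j \<in> JI" for j
  proof -
    have "j \<in> J" using that JI_subset by blast
    thus ?thesis
      using dualD[OF d(2), of k j] dualD[OF d'(2), of k j] eq[of j]
      by (simp add: key_def dot_commute[of "snd _"] dot_simps)
  qed
  ultimately show ?thesis unfolding W_def if_not_P[OF False]
    by (intro CollectI exI[of _ "\<eta>' k - \<eta> k"]) simp
next
  case True
  show ?thesis unfolding W_def if_P[OF True] by simp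
qed

lemma fst_notin_spn:
  assumes "\<Phi> \<in> \<Omega>" "k \<in> I - S"
  shows "fst (\<Phi> k) \<notin> spn (key \<Phi>)"
proof -
  obtain \<zeta> \<eta> where d: "dual \<zeta> (\<lambda>k. fst (\<Phi> k))" "dual \<eta> (\<lambda>k. snd (\<Phi> k))"
    by (rule framesE[of \<Phi>]) (use assms \<Omega>_def in auto)
  show ?thesis unfolding spn_key by (rule dual_not_in_span[OF d(1)]) (use assms in auto)
qed

text \<open>As \<open>b\<close> lies outside the visible span, it has a nonzero coordinate at some
  hidden label \<open>k0\<close>; swapping \<open>k0\<close> with \<open>i\<close> inside the class
  makes \<open>i\<close> a pivot. Then \<open>b\<close> replaces the first vector of
  \<open>i\<close>, and for \<open>c \<noteq> 0\<close> the second vectors of the class are adjusted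
  to keep the class sum.\<close>

lemma prescribe_fst:
  assumes \<Phi>: "\<Phi> \<in> \<Omega>" and i: "i \<in> I - S" and b: "b \<in> W (key \<Phi>)" "b \<notin> spn (key \<Phi>)"
  shows "\<exists>\<Phi>'\<in>\<Omega>. key \<Phi>' = key \<Phi> \<and> fst (\<Phi>' i) = b"
proof -
  obtain \<zeta> \<eta> where d: "dual \<zeta> (\<lambda>k. fst (\<Phi> k))" "dual \<eta> (\<lambda>k. snd (\<Phi> k))"
    by (rule framesE[of \<Phi>]) (use assms \<Omega>_def in auto)
  have "\<exists>k0\<in>I - S. dot (\<zeta> k0) b \<noteq> 0"
  proof (rule ccontr)
    assume "\<not> ?thesis"
    hence "dot (\<zeta> k) b = 0" if "k \<in> I - S" for k using that by blast
    hence "dot (\<zeta> k) b *s fst (\<Phi> k) \<in> vec.span ((\<lambda>k. fst (\<Phi> k)) ` (- (I - S)))" for k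
    proof (cases "k \<in> I - S")
      case False
      show ?thesis by (rule vec.span_scale, rule vec.span_base) (use False in blast)
    qed (simp add: vec.span_zero)
    hence "(\<Sum>k\<in>UNIV. dot (\<zeta> k) b *s fst (\<Phi> k)) \<in> spn (key \<Phi>)"
      unfolding spn_key by (intro vec.span_sum)
    thus False using b(2) frame_expand[OF d(1), of b] by simp
  qed
  then obtain k0 where k0: "k0 \<in> I - S" "dot (\<zeta> k0) b \<noteq> 0" by blast
  define p where "p k = (if k = i then k0 else if k = k0 then i else k)" for k
  have pp: "p (p k) = k" for k by (simp add: p_def)
  have bij: "bij p" by (rule involuntory_imp_bij) (rule pp)
  have p_id: "p k = k" if "k \<notin> I - S" for k using that i k0 by (auto simp: p_def)
  have p_cl: "cl (p k) = cl k" for k using i k0 by (auto simp: p_def cls_def)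
  define \<Psi> where "\<Psi> k = \<Phi> (p k)" for k
  have \<Psi>_psum: "psum (cls d) \<Psi> = psum (cls d) \<Phi>" for d
    unfolding psum_def \<Psi>_def
    by (rule sum.reindex_bij_betw, intro bij_betw_byWitness[where f' = p]) (auto simp: pp cls_def p_cl)
  have \<Psi>_frames: "frame (\<lambda>k. fst (\<Psi> k))" "frame (\<lambda>k. snd (\<Psi> k))"
    unfolding \<Psi>_def using \<Phi> frame_comp[OF _ bij, of "\<lambda>k. fst (\<Phi> k)"] frame_comp[OF _ bij, of "\<lambda>k. snd (\<Phi> k)"]
    by (auto simp: \<Omega>_def frames_def)
  have \<Psi>: "\<Psi> \<in> \<Omega>" using \<Psi>_frames \<Psi>_psum \<Phi> by (simp add: \<Omega>_def frames_def)
  have \<Psi>_out: "\<Psi> k = \<Phi> k" if "k \<notin> I - S" for k using that by (simp add: \<Psi>_def p_id)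
  have dz: "dual (\<lambda>k. \<zeta> (p k)) (\<lambda>k. fst (\<Psi> k))"
    using d(1) bij by (simp add: dual_def \<Psi>_def bij_is_inj inj_eq)
  have frame_b: "frame ((\<lambda>k. fst (\<Psi> k))(i := b))"
    by (rule frame_update[OF dz]) (simp add: p_def k0)
  have keyI: "key \<Phi>' = key \<Phi>" if "\<And>k. k \<notin> I - S \<Longrightarrow> fst (\<Phi>' k) = fst (\<Psi> k)"
    "\<And>k. k \<in> J \<Longrightarrow> snd (\<Phi>' k) = snd (\<Psi> k)" for \<Phi>'
  proof -
    have "snd (\<Phi>' k) = snd (\<Phi> k)" if "k \<in> J" for k
      using that \<Psi>_out[of k] JI_subset(3)[of k] \<open>\<And>k. k \<in> J \<Longrightarrow> snd (\<Phi>' k) = snd (\<Psi> k)\<close> by simp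
    moreover have "fst (\<Phi>' k) = fst (\<Phi> k)" if "k \<notin> I - S" for k
      using that \<Psi>_out[of k] \<open>\<And>k. k \<notin> I - S \<Longrightarrow> fst (\<Phi>' k) = fst (\<Psi> k)\<close> by simp
    ultimately show ?thesis by (simp add: key_def fun_eq_iff)
  qed
  have iJ: "i \<notin> J" using i JI_subset(3) by blast
  show ?thesis
  proof (cases "c = 0")
    case True
    define \<Phi>' where "\<Phi>' = \<Psi>(i := (b, snd (\<Psi> i)))"
    have "(\<lambda>k. fst (\<Phi>' k)) = (\<lambda>k. fst (\<Psi> k))(i := b)" "(\<lambda>k. snd (\<Phi>' k)) = (\<lambda>k. snd (\<Psi> k))"
      by (auto simp: \<Phi>'_def fun_eq_iff)
    hence fr: "\<Phi>' \<in> frames" using frame_b \<Psi>_frames by (simp add: frames_def)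
    have "psum (cls d) \<Phi>' = psum (cls d) \<Psi>" if "d \<noteq> 0" for d
      unfolding psum_def using that i True by (intro sum.cong refl) (auto simp: \<Phi>'_def cls_def)
    hence "\<Phi>' \<in> \<Omega>" using fr \<Psi> by (simp add: \<Omega>_def)
    moreover have "key \<Phi>' = key \<Phi>" using i by (intro keyI) (auto simp: \<Phi>'_def)
    ultimately show ?thesis by (auto simp: \<Phi>'_def)
  next
    case False
    obtain \<theta> where \<theta>: "b = M c *v \<theta>" "\<And>j. j \<in> JI \<Longrightarrow> dot (snd (key \<Phi>) j) \<theta> = 0"
      using b(1) False by (auto simp: W_def)
    \<comment> \<open>Coordinates of \<open>b\<close> in the first vectors of the class. They vanish
      on \<open>JI\<close> because \<open>\<theta>\<close> annihilates the visible second vectors,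
      so the adjustment below leaves the key alone.\<close>
    define \<gamma> where "\<gamma> k = dot (snd (\<Psi> k)) \<theta>" for k
    have b_sum: "b = (\<Sum>k\<in>I. \<gamma> k *s fst (\<Psi> k))" unfolding \<theta>(1) \<gamma>_def by (rule M_mult[OF \<Psi> False])
    have \<gamma>0: "\<gamma> j = 0" if "j \<in> JI" for j
      using \<theta>(2)[OF that] \<Psi>_out[of j] that JI_subset by (auto simp: \<gamma>_def key_def)
    have iI: "i \<in> I" using i by simp
    have "dot (\<zeta> (p i)) b = (\<Sum>k\<in>I. if k = i then \<gamma> k else 0)"
      unfolding b_sum dot_sum_right by (intro sum.cong refl) (simp add: dot_simps dualD[OF dz])
    hence \<gamma>i: "\<gamma> i \<noteq> 0" using k0(2) iI by (simp add: p_def sum.delta)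
    define w where "w k = (if k \<in> I then \<gamma> k / \<gamma> i else 0)" for k
    \<comment> \<open>Solving \<open>b_sum\<close> for the first vector of \<open>i\<close> and
      substituting into the class sum dictates the new second vectors.\<close>
    define \<Phi>' where "\<Phi>' k = (if k = i then b else fst (\<Psi> k),
      if k = i then inverse (\<gamma> i) *s snd (\<Psi> i) else snd (\<Psi> k) - w k *s snd (\<Psi> i))" for k
    have "(\<lambda>k. fst (\<Phi>' k)) = (\<lambda>k. fst (\<Psi> k))(i := b)" by (auto simp: \<Phi>'_def fun_eq_iff)
    moreover have "frame (\<lambda>k. snd (\<Phi>' k))"
      using frame_eliminate[OF \<Psi>_frames(2), of "inverse (\<gamma> i)" i w] \<gamma>i by (simp add: \<Phi>'_def)
    ultimately have fr: "\<Phi>' \<in> frames" using frame_b by (simp add: frames_def)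
    have "psum (cls d) \<Phi>' = psum (cls d) \<Psi>" for d
    proof (cases "d = c")
      case True
      define R where "R = I - {i}"
      have split: "(\<Sum>k\<in>I. h k) = h i + (\<Sum>k\<in>R. h k)" for h :: "'n \<Rightarrow> 'q ^ 'n"
        unfolding R_def by (rule sum.remove) (use iI in auto)
      have "psum I \<Phi>' *v v = psum I \<Psi> *v v" for v
      proof -
        define u where "u = dot (snd (\<Psi> i)) v"
        have "psum I \<Phi>' *v v = (\<Sum>k\<in>I. dot (snd (\<Phi>' k)) v *s fst (\<Phi>' k))"
          by (simp add: psum_def sum_matrix_vec outer_mult_vec)
        also have "\<dots> = (u / \<gamma> i) *s b
            + (\<Sum>k\<in>R. dot (snd (\<Psi> k)) v *s fst (\<Psi> k) - (u / \<gamma> i) *s (\<gamma> k *s fst (\<Psi> k)))"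
          unfolding split
          by (intro arg_cong2[where f = "(+)"] sum.cong refl)
            (auto simp: \<Phi>'_def u_def dot_simps w_def R_def vec.scale_left_diff_distrib field_simps)
        also have "(u / \<gamma> i) *s b = u *s fst (\<Psi> i) + (\<Sum>k\<in>R. (u / \<gamma> i) *s (\<gamma> k *s fst (\<Psi> k)))"
          using \<gamma>i by (simp add: b_sum split vec.scale_right_distrib vec.scale_sum_right)
        finally have "psum I \<Phi>' *v v = u *s fst (\<Psi> i) + (\<Sum>k\<in>R. dot (snd (\<Psi> k)) v *s fst (\<Psi> k))"
          by (simp add: sum_subtractf)
        also have "\<dots> = (\<Sum>k\<in>I. dot (snd (\<Psi> k)) v *s fst (\<Psi> k))" by (simp add: split u_def)
        finally show ?thesis by (simp add: psum_def sum_matrix_vec outer_mult_vec)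
      qed
      thus ?thesis using True by (simp add: matrix_eq)
    next
      case False
      hence "\<Phi>' k = \<Psi> k" if "k \<in> cls d" for k using that iI by (auto simp: \<Phi>'_def w_def cls_def)
      thus ?thesis unfolding psum_def by (intro sum.cong refl) simp
    qed
    hence "\<Phi>' \<in> \<Omega>" using fr \<Psi> by (simp add: \<Omega>_def)
    moreover have "key \<Phi>' = key \<Phi>"
    proof (rule keyI)
      fix k assume "k \<notin> I - S"
      thus "fst (\<Phi>' k) = fst (\<Psi> k)" using i by (auto simp: \<Phi>'_def)
    next
      fix k assume "k \<in> J"
      hence "k \<noteq> i" "w k = 0" using iJ \<gamma>0 by (auto simp: w_def J_def)
      thus "snd (\<Phi>' k) = snd (\<Psi> k)" by (simp add: \<Phi>'_def)
    qed
    ultimately show ?thesis by (auto simp: \<Phi>'_def)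
  qed
qed

lemma key_eq_iff:
  "key \<Phi> = key \<Phi>' \<longleftrightarrow> (\<forall>k. k \<notin> I - S \<longrightarrow> fst (\<Phi> k) = fst (\<Phi>' k)) \<and> (\<forall>k\<in>J. snd (\<Phi> k) = snd (\<Phi>' k))"
  unfolding key_def prod.inject fun_eq_iff by auto

lemma key_pair_map: "key \<Phi> = key \<Phi>' \<Longrightarrow> key (pair_map A B \<Phi>) = key (pair_map A B \<Phi>')"
  by (simp add: key_eq_iff pair_map_def)

end

section \<open>Resampling one vector\<close>

lemma two_le_card_field: "2 \<le> CARD('q::{field,finite})"
proof -
  have "card {0, 1 :: 'q} \<le> CARD('q)" by (rule card_mono) auto
  thus ?thesis by simp
qed

text \<open>\<open>A \<inter> L\<close> has q disjoint translates along \<open>v\<close> inside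
  \<open>A\<close>, so it fills at most 1/q of \<open>A\<close>.\<close>

lemma card_diff_subspace_ge:
  fixes A L :: "('q::{field,finite} ^ 'n::finite) set"
  assumes A: "vec.subspace A" and L: "vec.subspace L" and v: "v \<in> A" "v \<notin> L"
  shows "(real CARD('q) - 1) * card A \<le> real CARD('q) * card (A - L)"
proof -
  let ?f = "\<lambda>(t :: 'q, l). t *s v + l"
  have "inj_on ?f (UNIV \<times> (A \<inter> L))"
  proof (rule inj_onI)
    fix x y assume xy: "x \<in> UNIV \<times> (A \<inter> L)" "y \<in> UNIV \<times> (A \<inter> L)" "?f x = ?f y"
    obtain s l t m where st: "x = (s, l)" "y = (t, m)" by (cases x; cases y)
    have lm: "l \<in> L" "m \<in> L" and eq: "s *s v + l = t *s v + m" using xy st by auto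
    have "s = t"
    proof (rule ccontr)
      assume "s \<noteq> t"
      have "(s - t) *s v = m - l" using eq by (simp add: vec.scale_left_diff_distrib algebra_simps)
      hence "(s - t) *s v \<in> L" using lm L by (simp add: vec.subspace_diff)
      hence "inverse (s - t) *s ((s - t) *s v) \<in> L" using L by (rule vec.subspace_scale[rotated])
      thus False using v(2) \<open>s \<noteq> t\<close> by simp
    qed
    thus "x = y" using eq st by simp
  qed
  moreover have "?f ` (UNIV \<times> (A \<inter> L)) \<subseteq> A"
    using A v(1) by (auto intro: vec.subspace_add vec.subspace_scale)
  ultimately have "card ((UNIV :: 'q set) \<times> (A \<inter> L)) \<le> card A" by (rule card_inj_on_le) simp
  hence 1: "CARD('q) * card (A \<inter> L) \<le> card A" by (simp add: card_cartesian_product)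
  have "card (A - L) = card A - card (A \<inter> L)" by (rule card_Diff_subset_Int) simp
  moreover have "card (A \<inter> L) \<le> card A" by (rule card_mono) auto
  ultimately have "real (card (A - L)) = real (card A) - real (card (A \<inter> L))" by simp
  moreover have "real CARD('q) * real (card (A \<inter> L)) \<le> real (card A)"
    using 1 by (metis of_nat_le_iff of_nat_mult)
  ultimately show ?thesis by (simp only: right_diff_distrib left_diff_distrib)
qed

context config_side
begin

lemma W_snd: "snd x = snd y \<Longrightarrow> W x = W y"
  by (rule W_cong) simp

text \<open>The key together with one hidden first vector is uniformly distributed on its possible
  values: \<open>prescribe_fst\<close> says which these are, and transitivity makes the fibres
  equal.\<close>

lemma card_key_fst:
  assumes \<Phi>0: "\<Phi>0 \<in> \<Omega>" and i: "i \<in> I - S"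
  shows "card {\<Phi> \<in> \<Omega>. (key \<Phi>, fst (\<Phi> i)) = (x, b)}
    = (if x \<in> key ` \<Omega> \<and> b \<in> W x - spn x
       then card {\<Phi> \<in> \<Omega>. (key \<Phi>, fst (\<Phi> i)) = (key \<Phi>0, fst (\<Phi>0 i))} else 0)"
proof (cases "x \<in> key ` \<Omega> \<and> b \<in> W x - spn x")
  case True
  then obtain \<Phi>1 where \<Phi>1: "\<Phi>1 \<in> \<Omega>" "x = key \<Phi>1" by blast
  have b: "b \<in> W (key \<Phi>1)" "b \<notin> spn (key \<Phi>1)"
    using True unfolding \<Phi>1(2) by blast+
  obtain \<Phi>2 where \<Phi>2: "\<Phi>2 \<in> \<Omega>" "key \<Phi>2 = x" "fst (\<Phi>2 i) = b"
    using prescribe_fst[OF \<Phi>1(1) i b] unfolding \<Phi>1(2) by blast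
  have "card {\<Phi> \<in> \<Omega>. (key \<Phi>, fst (\<Phi> i)) = (key \<Phi>2, fst (\<Phi>2 i))}
      = card {\<Phi> \<in> \<Omega>. (key \<Phi>, fst (\<Phi> i)) = (key \<Phi>0, fst (\<Phi>0 i))}"
  proof (rule card_fiber[where key = "\<lambda>\<Phi>. (key \<Phi>, fst (\<Phi> i))", OF \<Phi>2(1) \<Phi>0])
    fix A B \<Phi> \<Phi>' assume "(key \<Phi>, fst (\<Phi> i)) = (key \<Phi>', fst (\<Phi>' i))"
    hence 1: "key \<Phi> = key \<Phi>'" and 2: "fst (\<Phi> i) = fst (\<Phi>' i)" by blast+
    show "(key (pair_map A B \<Phi>), fst (pair_map A B \<Phi> i)) = (key (pair_map A B \<Phi>'), fst (pair_map A B \<Phi>' i))"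
      unfolding key_pair_map[OF 1] pair_map_def by (simp add: 2)
  qed
  thus ?thesis unfolding if_P[OF True] by (simp only: \<Phi>2)
next
  case False
  have "\<Phi> \<notin> \<Omega>" if "key \<Phi> = x" "fst (\<Phi> i) = b" for \<Phi>
  proof
    assume "\<Phi> \<in> \<Omega>"
    thus False using False that fst_in_W[OF \<open>\<Phi> \<in> \<Omega>\<close> i] fst_notin_spn[OF \<open>\<Phi> \<in> \<Omega>\<close> i] by blast
  qed
  hence "{\<Phi> \<in> \<Omega>. (key \<Phi>, fst (\<Phi> i)) = (x, b)} = {}" by blast
  thus ?thesis using False by (simp only: card.empty if_False)
qed

lemma sum_key_fst:
  fixes h :: "_ \<Rightarrow> _ \<Rightarrow> real"
  assumes \<Phi>0: "\<Phi>0 \<in> \<Omega>" and i: "i \<in> I - S"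
  shows "(\<Sum>\<Phi>\<in>\<Omega>. h (key \<Phi>) (fst (\<Phi> i)))
    = card {\<Phi> \<in> \<Omega>. (key \<Phi>, fst (\<Phi> i)) = (key \<Phi>0, fst (\<Phi>0 i))}
      * (\<Sum>x\<in>key ` \<Omega>. \<Sum>b\<in>W x - spn x. h x b)"
proof -
  let ?\<kappa> = "card {\<Phi> \<in> \<Omega>. (key \<Phi>, fst (\<Phi> i)) = (key \<Phi>0, fst (\<Phi>0 i))}"
  have "(\<Sum>\<Phi>\<in>\<Omega>. h (key \<Phi>) (fst (\<Phi> i))) = (\<Sum>\<Phi>\<in>\<Omega>. case_prod h (key \<Phi>, fst (\<Phi> i)))" by simp
  also have "\<dots> = (\<Sum>p\<in>UNIV. card {\<Phi> \<in> \<Omega>. (key \<Phi>, fst (\<Phi> i)) = p} * case_prod h p)"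
    by (rule sum_fibers[where h = "case_prod h" and g = "\<lambda>\<Phi>. (key \<Phi>, fst (\<Phi> i))"]) simp
  also have "\<dots> = (\<Sum>p\<in>(SIGMA x:key ` \<Omega>. W x - spn x). ?\<kappa> * case_prod h p)"
  proof (rule sum.mono_neutral_cong_right)
    show "\<forall>p\<in>UNIV - (SIGMA x:key ` \<Omega>. W x - spn x).
        real (card {\<Phi> \<in> \<Omega>. (key \<Phi>, fst (\<Phi> i)) = p}) * case_prod h p = 0"
    proof
      fix p assume "p \<in> UNIV - (SIGMA x:key ` \<Omega>. W x - spn x)"
      moreover obtain x b where p: "p = (x, b)" by (cases p)
      ultimately have n: "\<not> (x \<in> key ` \<Omega> \<and> b \<in> W x - spn x)" by blast
      show "real (card {\<Phi> \<in> \<Omega>. (key \<Phi>, fst (\<Phi> i)) = p}) * case_prod h p = 0"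
        unfolding p card_key_fst[OF assms, of x b] if_not_P[OF n] by simp
    qed
    fix p assume "p \<in> (SIGMA x:key ` \<Omega>. W x - spn x)"
    moreover obtain x b where p: "p = (x, b)" by (cases p)
    ultimately have y: "x \<in> key ` \<Omega> \<and> b \<in> W x - spn x" by blast
    show "real (card {\<Phi> \<in> \<Omega>. (key \<Phi>, fst (\<Phi> i)) = p}) * case_prod h p = ?\<kappa> * case_prod h p"
      unfolding p card_key_fst[OF assms, of x b] if_P[OF y] by simp
  qed simp_all
  also have "\<dots> = ?\<kappa> * (\<Sum>x\<in>key ` \<Omega>. \<Sum>b\<in>W x - spn x. h x b)"
    unfolding sum_distrib_left by (subst sum.Sigma) (auto simp: case_prod_unfold)
  finally show ?thesis .
qed

lemma fst_key_eq: "k \<notin> I - S \<Longrightarrow> fst (key \<Phi>) k = fst (\<Phi> k)"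
  by (auto simp: key_def)

text \<open>Shows that translation by \<open>W x \<inter> spn x\<close> between keys is an
  equivalence relation, so that the corresponding sum is a sum of squares. The span is preserved by
  exchange: the translated vector lies in the old span and is independent of the other visible
  ones.\<close>

lemma same_line_iff:
  assumes j: "j \<in> S \<inter> I" and x: "x \<in> key ` \<Omega>" and y: "y \<in> key ` \<Omega>"
  shows "(spn y = spn x \<and> (fst y)(j := 0) = (fst x)(j := 0) \<and> snd y = snd x)
    \<longleftrightarrow> (\<exists>b\<in>W x \<inter> spn x. y = tr j b x)" (is "?l \<longleftrightarrow> ?r")
proof
  assume l: ?l
  obtain \<Phi>1 \<Phi>2 where \<Phi>: "\<Phi>1 \<in> \<Omega>" "x = key \<Phi>1" "\<Phi>2 \<in> \<Omega>" "y = key \<Phi>2" using x y by auto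
  let ?b = "fst y j - fst x j"
  have "y = tr j ?b x"
  proof (rule prod_eqI)
    show "fst y = fst (tr j ?b x)"
    proof
      fix k
      have "((fst y)(j := 0)) k = ((fst x)(j := 0)) k" using l by simp
      thus "fst y k = fst (tr j ?b x) k" by (cases "k = j") (simp_all add: tr_def)
    qed
  qed (use l in \<open>simp add: tr_def\<close>)
  moreover have "?b \<in> spn x"
  proof -
    have "fst y j \<in> spn y" "fst x j \<in> spn x" by (auto simp: spn_def intro: vec.span_base)
    thus ?thesis using l unfolding spn_def by (intro vec.span_diff) auto
  qed
  moreover have "?b \<in> W x"
  proof -
    have "snd (\<Phi>2 k) = snd (\<Phi>1 k)" if "k \<in> J" for k
    proof -
      have "snd y k = snd x k" using l by simp
      thus ?thesis using that by (simp add: \<Phi>(2,4) key_def)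
    qed
    thus ?thesis using fst_diff_in_W[OF \<Phi>(1,3), of j] j by (simp add: \<Phi> fst_key_eq)
  qed
  ultimately show ?r by blast
next
  assume ?r
  then obtain b where b: "b \<in> W x" "b \<in> spn x" "y = tr j b x" by blast
  obtain \<Phi>2 where \<Phi>2: "\<Phi>2 \<in> \<Omega>" "y = key \<Phi>2" using y by auto
  obtain \<zeta> \<eta> where d: "dual \<zeta> (\<lambda>k. fst (\<Phi>2 k))" "dual \<eta> (\<lambda>k. snd (\<Phi>2 k))"
    by (rule framesE[of \<Phi>2]) (use \<Phi>2 \<Omega>_def in auto)
  let ?R = "fst x ` (UNIV - {j})"
  have Ry: "fst y ` (UNIV - {j}) = ?R" by (rule image_cong) (auto simp: b(3) tr_def)
  have range: "range f = insert (f j) (f ` (UNIV - {j}))" for f :: "'n \<Rightarrow> 'q ^ 'n" by auto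
  have rx: "range (fst x) = insert (fst x j) ?R" by (rule range)
  have ry: "range (fst y) = insert (fst y j) ?R" using range[of "fst y"] unfolding Ry .
  have yj: "fst y j = fst x j + b" by (simp add: b(3) tr_def)
  have in_x: "fst y j \<in> spn x" unfolding yj using b(2) by (auto simp: spn_def intro: vec.span_add vec.span_base)
  have notin: "fst y j \<notin> vec.span ?R"
  proof
    assume "fst y j \<in> vec.span ?R"
    moreover have "dot (\<zeta> j) v = 0" if "v \<in> ?R" for v
    proof -
      have "v \<in> fst y ` (UNIV - {j})" using that unfolding Ry .
      then obtain k where "k \<noteq> j" "v = fst y k" by blast
      thus ?thesis using dualD[OF d(1), of j k]
        by (cases "k \<in> I - S") (simp_all add: \<Phi>2(2) key_def dot_simps)
    qed
    ultimately have "dot (\<zeta> j) (fst y j) = 0" by (rule dot_span_zero[rotated])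
    thus False using dualD[OF d(1), of j j] j by (simp add: \<Phi>2(2) fst_key_eq)
  qed
  have "fst x j \<in> spn y"
    unfolding spn_def ry by (rule vec.in_span_insert[OF _ notin]) (use in_x in \<open>simp add: spn_def rx\<close>)
  hence "spn x \<subseteq> spn y"
    unfolding spn_def rx ry
    by (intro vec.span_minimal vec.subspace_span insert_subsetI) (auto intro: vec.span_base)
  moreover have "spn y \<subseteq> spn x"
    using in_x unfolding spn_def rx ry
    by (intro vec.span_minimal vec.subspace_span insert_subsetI) (auto intro: vec.span_base)
  ultimately show ?l by (simp add: b(3) tr_def)
qed

text \<open>Given its key, \<open>fst (\<Phi> i)\<close> is uniform on \<open>W - spn\<close>. Replacing that set by the subspace \<open>W\<close> costs only a
  nonnegative term, and on \<open>W\<close> the bound \<open>avg_norm_le\<close> applies.\<close>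

lemma resample_bound:
  fixes F :: "('q, 'n) pairs \<Rightarrow> real"
  assumes dep: "\<And>\<Phi> \<Phi>'. \<Phi> \<in> \<Omega> \<Longrightarrow> \<Phi>' \<in> \<Omega> \<Longrightarrow> key \<Phi> = key \<Phi>' \<Longrightarrow> F \<Phi> = F \<Phi>'"
    and inv: "\<And>i j t \<Phi>. i \<in> S \<inter> I \<Longrightarrow> j \<in> S \<inter> I \<Longrightarrow> i \<noteq> j \<Longrightarrow> \<Phi> \<in> \<Omega> \<Longrightarrow> F (T i j t \<Phi>) = F \<Phi>"
    and zero: "\<And>\<Phi>0. \<Phi>0 \<in> \<Omega> \<Longrightarrow> (\<Sum>\<Phi>\<in>{\<Phi> \<in> \<Omega>. (\<forall>k\<in>- I. fst (\<Phi> k) = fst (\<Phi>0 k)) \<and>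
      (\<forall>k\<in>J. snd (\<Phi> k) = snd (\<Phi>0 k))}. F \<Phi>) = 0"
    and i: "i \<in> I - S" and j: "j \<in> S \<inter> I"
  shows "(\<Sum>\<Phi>\<in>\<Omega>. (param_avg (T i j) F \<Phi>)\<^sup>2)
    \<le> (1 / CARD('q) + 1 / (real CARD('q) - 1)) * (\<Sum>\<Phi>\<in>\<Omega>. (F \<Phi>)\<^sup>2)"
proof (cases "\<Omega> = {}")
  case False
  then obtain \<Phi>0 where \<Phi>0: "\<Phi>0 \<in> \<Omega>" by blast
  define q where "q = real CARD('q)"
  have q: "q \<ge> 2" using two_le_card_field[where 'q = 'q] by (simp add: q_def)
  \<comment> \<open>Fibre sizes: \<open>\<kappa>\<close> elements of \<open>\<Omega>\<close> for
    each occurring key, \<open>\<kappa>'\<close> for each such key with a possible value of the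
    hidden vector.\<close>
  define \<kappa> where "\<kappa> = real (card {\<Phi> \<in> \<Omega>. key \<Phi> = key \<Phi>0})"
  define \<kappa>' where "\<kappa>' = real (card {\<Phi> \<in> \<Omega>. (key \<Phi>, fst (\<Phi> i)) = (key \<Phi>0, fst (\<Phi>0 i))})"
  have \<kappa>: "\<kappa> > 0" using \<Phi>0 by (auto simp: \<kappa>_def card_gt_0_iff)
  have \<kappa>': "\<kappa>' \<ge> 0" by (simp add: \<kappa>'_def)
  \<comment> \<open>\<open>F\<close>, up to the factor \<open>\<kappa>\<close>, as a function of
    keys, extended by 0 to the keys that do not occur.\<close>
  define \<Psi> where "\<Psi> x = (\<Sum>\<Phi>\<in>\<Omega>. if key \<Phi> = x then F \<Phi> else 0)" for x
  define X where "X = key ` \<Omega>"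
  have finX: "finite X" by simp
  have \<Psi>_key: "\<Psi> (key \<Phi>) = \<kappa> * F \<Phi>" if \<Phi>: "\<Phi> \<in> \<Omega>" for \<Phi>
  proof -
    have "\<Psi> (key \<Phi>) = (\<Sum>\<Phi>'\<in>{\<Phi>' \<in> \<Omega>. key \<Phi>' = key \<Phi>}. F \<Phi>')"
      unfolding \<Psi>_def by (rule sum.inter_filter[symmetric]) simp
    also have "\<dots> = (\<Sum>\<Phi>'\<in>{\<Phi>' \<in> \<Omega>. key \<Phi>' = key \<Phi>}. F \<Phi>)"
      by (rule sum.cong[OF refl]) (use dep \<Phi> in blast)
    also have "\<dots> = card {\<Phi>' \<in> \<Omega>. key \<Phi>' = key \<Phi>} * F \<Phi>" by simp
    also have "card {\<Phi>' \<in> \<Omega>. key \<Phi>' = key \<Phi>} = card {\<Phi>' \<in> \<Omega>. key \<Phi>' = key \<Phi>0}"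
      by (rule card_fiber[where key = key, OF \<Phi> \<Phi>0]) (rule key_pair_map)
    finally show ?thesis by (simp add: \<kappa>_def)
  qed
  have \<Psi>_0: "\<Psi> x = 0" if "x \<notin> X" for x
    unfolding \<Psi>_def using that by (intro sum.neutral) (auto simp: X_def)
  have \<Psi>_shear: "\<Psi> (shear k l t x) = \<Psi> x" if kl: "k \<in> S \<inter> I" "l \<in> S \<inter> I" "k \<noteq> l" for k l t x
  proof -
    have cl: "cl k = cl l" using kl by (simp add: cls_def)
    have "\<Psi> (shear k l t x) = (\<Sum>\<Phi>\<in>\<Omega>. if key (T k l t \<Phi>) = shear k l t x then F (T k l t \<Phi>) else 0)"
      unfolding \<Psi>_def by (rule sum_param_action[OF T_action[OF kl(3) cl], symmetric])
    also have "\<dots> = \<Psi> x"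
      unfolding \<Psi>_def
    proof (rule sum.cong[OF refl])
      fix \<Phi> assume "\<Phi> \<in> \<Omega>"
      moreover have "shear k l t (key \<Phi>) = shear k l t x \<longleftrightarrow> key \<Phi> = x"
      proof
        assume "shear k l t (key \<Phi>) = shear k l t x"
        hence "shear k l (- t) (shear k l t (key \<Phi>)) = shear k l (- t) (shear k l t x)" by (rule arg_cong)
        thus "key \<Phi> = x"
          by (simp add: param_actionD(1)[OF shear_act[OF kl(3)]] param_actionD(2)[OF shear_act[OF kl(3)]])
      qed simp
      ultimately show "(if key (T k l t \<Phi>) = shear k l t x then F (T k l t \<Phi>) else 0)
          = (if key \<Phi> = x then F \<Phi> else 0)"
        using kl by (simp add: key_T inv)
    qed
    finally show ?thesis .
  qed
  \<comment> \<open>By \<open>fst_diff_in_W\<close>, the keys of \<open>\<Omega>\<close> in a coset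
    are either none or exactly those of one of the sets over which \<open>zero\<close> makes
    \<open>F\<close> sum to 0.\<close>
  have \<Psi>_zero: "(\<Sum>a\<in>coset (S \<inter> I) x. \<Psi> (a, snd x)) = 0" for x
  proof -
    define P where "P \<Phi> \<longleftrightarrow> snd (key \<Phi>) = snd x \<and> fst (key \<Phi>) \<in> coset (S \<inter> I) x" for \<Phi>
    have "(\<Sum>a\<in>coset (S \<inter> I) x. \<Psi> (a, snd x))
        = (\<Sum>\<Phi>\<in>\<Omega>. \<Sum>a\<in>coset (S \<inter> I) x. if key \<Phi> = (a, snd x) then F \<Phi> else 0)"
      unfolding \<Psi>_def by (rule sum.swap)
    also have "\<dots> = (\<Sum>\<Phi>\<in>\<Omega>. if P \<Phi> then F \<Phi> else 0)"
    proof (rule sum.cong[OF refl])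
      fix \<Phi>
      have "(\<Sum>a\<in>coset (S \<inter> I) x. if key \<Phi> = (a, snd x) then F \<Phi> else 0)
          = (\<Sum>a\<in>coset (S \<inter> I) x. if a = fst (key \<Phi>) then if snd (key \<Phi>) = snd x then F \<Phi> else 0 else 0)"
        by (intro sum.cong refl) (auto simp: prod_eq_iff)
      thus "(\<Sum>a\<in>coset (S \<inter> I) x. if key \<Phi> = (a, snd x) then F \<Phi> else 0) = (if P \<Phi> then F \<Phi> else 0)"
        by (simp add: P_def)
    qed
    also have "\<dots> = (\<Sum>\<Phi>\<in>{\<Phi> \<in> \<Omega>. P \<Phi>}. F \<Phi>)" by (rule sum.inter_filter[symmetric]) simp
    also have "\<dots> = 0"
    proof (cases "{\<Phi> \<in> \<Omega>. P \<Phi>} = {}")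
      case False
      then obtain \<Phi>1 where \<Phi>1: "\<Phi>1 \<in> \<Omega>" "P \<Phi>1" by blast
      have "{\<Phi> \<in> \<Omega>. P \<Phi>} = {\<Phi> \<in> \<Omega>. (\<forall>k\<in>- I. fst (\<Phi> k) = fst (\<Phi>1 k)) \<and>
          (\<forall>k\<in>J. snd (\<Phi> k) = snd (\<Phi>1 k))}"
      proof (rule Collect_cong, rule conj_cong[OF refl])
        fix \<Phi> assume \<Phi>: "\<Phi> \<in> \<Omega>"
        show "P \<Phi> \<longleftrightarrow> (\<forall>k\<in>- I. fst (\<Phi> k) = fst (\<Phi>1 k)) \<and> (\<forall>k\<in>J. snd (\<Phi> k) = snd (\<Phi>1 k))"
        proof
          assume P: "P \<Phi>"
          have "fst (\<Phi> k) = fst (\<Phi>1 k)" if "k \<in> - I" for k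
          proof -
            have "fst (key \<Phi>) k = fst x k" "fst (key \<Phi>1) k = fst x k"
              using P \<Phi>1(2) that by (auto simp: P_def coset_def)
            thus ?thesis using that by (simp add: fst_key_eq)
          qed
          moreover have "snd (\<Phi> k) = snd (\<Phi>1 k)" if "k \<in> J" for k
          proof -
            have "snd (key \<Phi>) k = snd (key \<Phi>1) k" using P \<Phi>1(2) by (simp add: P_def)
            thus ?thesis using that by (simp add: key_def)
          qed
          ultimately show "(\<forall>k\<in>- I. fst (\<Phi> k) = fst (\<Phi>1 k)) \<and> (\<forall>k\<in>J. snd (\<Phi> k) = snd (\<Phi>1 k))"
            by blast
        next
          assume eq: "(\<forall>k\<in>- I. fst (\<Phi> k) = fst (\<Phi>1 k)) \<and> (\<forall>k\<in>J. snd (\<Phi> k) = snd (\<Phi>1 k))"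
          have snd_eq: "snd (key \<Phi>) = snd (key \<Phi>1)" using eq by (auto simp: key_def)
          have Wx: "W x = W (key \<Phi>1)" using \<Phi>1(2) by (intro W_snd) (simp add: P_def)
          have "fst (key \<Phi>) k - fst x k \<in> W x" if k: "k \<in> S \<inter> I" for k
          proof -
            have "fst (\<Phi> k) - fst (\<Phi>1 k) \<in> W x"
              unfolding Wx by (rule fst_diff_in_W[OF \<Phi>1(1) \<Phi>]) (use k eq in auto)
            moreover have "fst (key \<Phi>1) k - fst x k \<in> W x"
              using \<Phi>1(2) k by (simp add: P_def coset_def)
            ultimately have "(fst (\<Phi> k) - fst (\<Phi>1 k)) + (fst (key \<Phi>1) k - fst x k) \<in> W x"
              by (rule W_closed(2))
            thus ?thesis using k by (simp add: fst_key_eq)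
          qed
          moreover have "fst (key \<Phi>) k = fst x k" if k: "k \<notin> S \<inter> I" for k
          proof -
            have "fst (key \<Phi>1) k = fst x k" using \<Phi>1(2) k by (simp add: P_def coset_def)
            moreover have "fst (key \<Phi>) k = fst (key \<Phi>1) k"
              using k eq by (auto simp: key_def)
            ultimately show ?thesis by simp
          qed
          ultimately show "P \<Phi>" using snd_eq \<Phi>1(2) by (simp add: P_def coset_def)
        qed
      qed
      thus ?thesis using zero[OF \<Phi>1(1)] by simp
    next
      case True
      show ?thesis unfolding True by simp
    qed
    finally show ?thesis .
  qed
  \<comment> \<open>The weight turns the normalised averages over \<open>W x\<close> into plain
    sums, matching the counting in \<open>sum_key_fst\<close>.\<close>
  define \<Psi>' where "\<Psi>' x = sqrt (card (W x)) * \<Psi> x" for x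
  have R1: "(q - 1) * (\<Sum>x\<in>UNIV. \<Sum>b\<in>W x. \<Psi> (tr j b x) * \<Psi> x) \<le> (\<Sum>x\<in>UNIV. card (W x) * (\<Psi> x)\<^sup>2)"
  proof -
    have "(real CARD('q) - 1) * (\<Sum>x\<in>UNIV. \<Psi>' x * avg j \<Psi>' x) \<le> (\<Sum>x\<in>UNIV. (\<Psi>' x)\<^sup>2)"
    proof (rule avg_norm_le[OF j])
      fix k l t x assume "k \<in> S \<inter> I" "l \<in> S \<inter> I" "k \<noteq> l"
      thus "\<Psi>' (shear k l t x) = \<Psi>' x" by (simp add: \<Psi>'_def \<Psi>_shear)
    next
      fix x
      have "(\<Sum>a\<in>coset (S \<inter> I) x. \<Psi>' (a, snd x)) = (\<Sum>a\<in>coset (S \<inter> I) x. sqrt (card (W x)) * \<Psi> (a, snd x))"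
        unfolding \<Psi>'_def by (intro sum.cong refl) (simp add: W_snd[of "(_, snd x)" x])
      also have "\<dots> = 0" by (simp add: \<Psi>_zero flip: sum_distrib_left)
      finally show "(\<Sum>a\<in>coset (S \<inter> I) x. \<Psi>' (a, snd x)) = 0" .
    qed
    moreover have "\<Psi>' x * avg j \<Psi>' x = (\<Sum>b\<in>W x. \<Psi> (tr j b x) * \<Psi> x)" for x
    proof -
      have "avg j \<Psi>' x = (\<Sum>b\<in>W x. sqrt (card (W x)) * \<Psi> (tr j b x)) / card (W x)"
        unfolding avg_def \<Psi>'_def using j by simp
      also have "\<dots> = sqrt (card (W x)) * (\<Sum>b\<in>W x. \<Psi> (tr j b x)) / card (W x)"
        by (simp add: sum_distrib_left)
      finally have "\<Psi>' x * avg j \<Psi>' x = (sqrt (card (W x)) * sqrt (card (W x))) * ((\<Sum>b\<in>W x. \<Psi> (tr j b x)) * \<Psi> x) / card (W x)"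
        by (simp add: \<Psi>'_def del: real_sqrt_mult_self)
      also have "\<dots> = (\<Sum>b\<in>W x. \<Psi> (tr j b x)) * \<Psi> x" using card_W[of x] by simp
      finally show ?thesis by (simp add: sum_distrib_right)
    qed
    moreover have "(\<Psi>' x)\<^sup>2 = card (W x) * (\<Psi> x)\<^sup>2" for x by (simp add: \<Psi>'_def power_mult_distrib)
    ultimately show ?thesis by (simp add: q_def)
  qed
  have N: "\<kappa>\<^sup>2 * (\<Sum>\<Phi>\<in>\<Omega>. (F \<Phi>)\<^sup>2) = \<kappa>' * (\<Sum>x\<in>X. card (W x - spn x) * (\<Psi> x)\<^sup>2)"
  proof -
    have "\<kappa>\<^sup>2 * (\<Sum>\<Phi>\<in>\<Omega>. (F \<Phi>)\<^sup>2) = (\<Sum>\<Phi>\<in>\<Omega>. (\<lambda>x b. (\<Psi> x)\<^sup>2) (key \<Phi>) (fst (\<Phi> i)))"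
      unfolding sum_distrib_left by (intro sum.cong refl) (simp add: \<Psi>_key power_mult_distrib)
    also have "\<dots> = \<kappa>' * (\<Sum>x\<in>X. \<Sum>b\<in>W x - spn x. (\<Psi> x)\<^sup>2)"
      unfolding \<kappa>'_def X_def by (rule sum_key_fst[OF \<Phi>0 i])
    finally show ?thesis by simp
  qed
  \<comment> \<open>The translations inside the span, which the hidden vector avoids. Their
    contribution is subtracted below, so its sign is the favourable one.\<close>
  have S5: "0 \<le> (\<Sum>x\<in>X. \<Sum>b\<in>W x \<inter> spn x. \<Psi> (tr j b x) * \<Psi> x)"
  proof -
    define cc where "cc x = (spn x, (fst x)(j := 0), snd x)" for x
    have "(\<Sum>b\<in>W x \<inter> spn x. \<Psi> (tr j b x) * \<Psi> x) = (\<Sum>y\<in>{y \<in> X. cc y = cc x}. \<Psi> y * \<Psi> x)"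
      if x: "x \<in> X" for x
    proof -
      have eq: "{y \<in> X. cc y = cc x} = (\<lambda>b. tr j b x) ` {b \<in> W x \<inter> spn x. tr j b x \<in> X}"
      proof -
        have "cc y = cc x \<longleftrightarrow> (\<exists>b\<in>W x \<inter> spn x. y = tr j b x)" if "y \<in> X" for y
          unfolding cc_def prod.inject by (rule same_line_iff[OF j]) (use x that X_def in auto)
        thus ?thesis by blast
      qed
      have "inj_on (\<lambda>b. tr j b x) {b \<in> W x \<inter> spn x. tr j b x \<in> X}"
        by (rule inj_onI) (auto simp: tr_def dest: fun_cong[of _ _ j])
      hence "(\<Sum>y\<in>{y \<in> X. cc y = cc x}. \<Psi> y * \<Psi> x) = (\<Sum>b\<in>{b \<in> W x \<inter> spn x. tr j b x \<in> X}. \<Psi> (tr j b x) * \<Psi> x)"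
        unfolding eq by (simp add: sum.reindex)
      also have "\<dots> = (\<Sum>b\<in>W x \<inter> spn x. \<Psi> (tr j b x) * \<Psi> x)"
        by (rule sum.mono_neutral_left) (auto simp: \<Psi>_0)
      finally show ?thesis by simp
    qed
    hence "(\<Sum>x\<in>X. \<Sum>b\<in>W x \<inter> spn x. \<Psi> (tr j b x) * \<Psi> x) = (\<Sum>x\<in>X. \<Sum>y\<in>{y \<in> X. cc y = cc x}. \<Psi> y * \<Psi> x)"
      by (intro sum.cong refl)
    thus ?thesis using sum_same_class_nonneg[OF finX, where c = cc and f = \<Psi>] by simp
  qed
  \<comment> \<open>For \<open>t \<noteq> 0\<close> the step translates by a nonzero multiple of the
    hidden vector, and the multiple does not matter. One factor q - 1 comes from
    \<open>avg_norm_le\<close>; the other, together with the q on the right, from passing from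
    \<open>W x\<close> to \<open>W x - spn x\<close>.\<close>
  have corr: "(q - 1)\<^sup>2 * (\<Sum>\<Phi>\<in>\<Omega>. F (T i j t \<Phi>) * F \<Phi>) \<le> q * (\<Sum>\<Phi>\<in>\<Omega>. (F \<Phi>)\<^sup>2)"
    if t: "t \<noteq> 0" for t
  proof -
    have ij: "i \<noteq> j" "cl i = cl j" using i j by (auto simp: cls_def)
    have "\<kappa>\<^sup>2 * (\<Sum>\<Phi>\<in>\<Omega>. F (T i j t \<Phi>) * F \<Phi>)
        = (\<Sum>\<Phi>\<in>\<Omega>. (\<lambda>x b. \<Psi> (tr j (t *s b) x) * \<Psi> x) (key \<Phi>) (fst (\<Phi> i)))"
      unfolding sum_distrib_left
      by (intro sum.cong refl)
        (simp add: \<Psi>_key T_\<Omega>[OF ij] power2_eq_square flip: key_T_out[OF i j])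
    also have "\<dots> = \<kappa>' * (\<Sum>x\<in>X. \<Sum>b\<in>W x - spn x. \<Psi> (tr j (t *s b) x) * \<Psi> x)"
      unfolding \<kappa>'_def X_def by (rule sum_key_fst[OF \<Phi>0 i])
    also have "(\<Sum>x\<in>X. \<Sum>b\<in>W x - spn x. \<Psi> (tr j (t *s b) x) * \<Psi> x)
        = (\<Sum>x\<in>X. \<Sum>b\<in>W x - spn x. \<Psi> (tr j b x) * \<Psi> x)"
    proof (rule sum.cong[OF refl])
      fix x
      have spn_scale: "s *s b \<in> spn x \<longleftrightarrow> b \<in> spn x" if "s \<noteq> 0" for s b
      proof
        assume "s *s b \<in> spn x"
        hence "inverse s *s (s *s b) \<in> spn x" unfolding spn_def by (rule vec.span_scale)
        thus "b \<in> spn x" using that by simp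
      qed (simp add: spn_def vec.span_scale)
      have "bij_betw (\<lambda>b. t *s b) (W x - spn x) (W x - spn x)"
        by (intro bij_betw_byWitness[where f' = "\<lambda>b. inverse t *s b"])
          (use t W_closed(3)[of _ x] spn_scale in auto)
      thus "(\<Sum>b\<in>W x - spn x. \<Psi> (tr j (t *s b) x) * \<Psi> x) = (\<Sum>b\<in>W x - spn x. \<Psi> (tr j b x) * \<Psi> x)"
        by (rule sum.reindex_bij_betw)
    qed
    also have "\<dots> = (\<Sum>x\<in>X. \<Sum>b\<in>W x. \<Psi> (tr j b x) * \<Psi> x) - (\<Sum>x\<in>X. \<Sum>b\<in>W x \<inter> spn x. \<Psi> (tr j b x) * \<Psi> x)"
      unfolding sum_subtractf[symmetric]
    proof (rule sum.cong[OF refl])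
      fix x
      have "W x - spn x = W x - W x \<inter> spn x" by blast
      thus "(\<Sum>b\<in>W x - spn x. \<Psi> (tr j b x) * \<Psi> x)
          = (\<Sum>b\<in>W x. \<Psi> (tr j b x) * \<Psi> x) - (\<Sum>b\<in>W x \<inter> spn x. \<Psi> (tr j b x) * \<Psi> x)"
        by (simp add: sum_diff)
    qed
    finally have "\<kappa>\<^sup>2 * (\<Sum>\<Phi>\<in>\<Omega>. F (T i j t \<Phi>) * F \<Phi>)
        \<le> \<kappa>' * (\<Sum>x\<in>X. \<Sum>b\<in>W x. \<Psi> (tr j b x) * \<Psi> x)"
      using S5 \<kappa>' by (simp add: mult_left_mono)
    moreover have "(\<Sum>x\<in>X. \<Sum>b\<in>W x. \<Psi> (tr j b x) * \<Psi> x) = (\<Sum>x\<in>UNIV. \<Sum>b\<in>W x. \<Psi> (tr j b x) * \<Psi> x)"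
      by (rule sum.mono_neutral_left) (auto simp: \<Psi>_0)
    ultimately have "(q - 1) * (\<kappa>\<^sup>2 * (\<Sum>\<Phi>\<in>\<Omega>. F (T i j t \<Phi>) * F \<Phi>))
        \<le> (q - 1) * (\<kappa>' * (\<Sum>x\<in>UNIV. \<Sum>b\<in>W x. \<Psi> (tr j b x) * \<Psi> x))"
      using q by (simp add: mult_left_mono)
    also have "\<dots> = \<kappa>' * ((q - 1) * (\<Sum>x\<in>UNIV. \<Sum>b\<in>W x. \<Psi> (tr j b x) * \<Psi> x))" by simp
    also have "\<dots> \<le> \<kappa>' * (\<Sum>x\<in>UNIV. card (W x) * (\<Psi> x)\<^sup>2)"
      using R1 \<kappa>' by (rule mult_left_mono)
    also have "(\<Sum>x\<in>UNIV. card (W x) * (\<Psi> x)\<^sup>2) = (\<Sum>x\<in>X. card (W x) * (\<Psi> x)\<^sup>2)"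
      by (rule sum.mono_neutral_right) (auto simp: \<Psi>_0)
    finally have "(q - 1) * ((q - 1) * (\<kappa>\<^sup>2 * (\<Sum>\<Phi>\<in>\<Omega>. F (T i j t \<Phi>) * F \<Phi>)))
        \<le> (q - 1) * (\<kappa>' * (\<Sum>x\<in>X. card (W x) * (\<Psi> x)\<^sup>2))"
      using q by (simp add: mult_left_mono)
    also have "\<dots> = \<kappa>' * (\<Sum>x\<in>X. ((q - 1) * card (W x)) * (\<Psi> x)\<^sup>2)"
      by (simp add: sum_distrib_left algebra_simps)
    also have "\<dots> \<le> \<kappa>' * (\<Sum>x\<in>X. (q * card (W x - spn x)) * (\<Psi> x)\<^sup>2)"
    proof (intro mult_left_mono sum_mono mult_right_mono \<kappa>')
      fix x assume "x \<in> X"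
      then obtain \<Phi> where "\<Phi> \<in> \<Omega>" "x = key \<Phi>" by (auto simp: X_def)
      hence v: "fst (\<Phi> i) \<in> W x" "fst (\<Phi> i) \<notin> spn x"
        using fst_in_W[OF \<open>\<Phi> \<in> \<Omega>\<close> i] fst_notin_spn[OF \<open>\<Phi> \<in> \<Omega>\<close> i] by simp_all
      have "vec.subspace (spn x)" by (simp add: spn_def)
      thus "(q - 1) * card (W x) \<le> q * card (W x - spn x)"
        unfolding q_def using card_diff_subspace_ge[OF W_subspace _ v] by blast
    qed simp
    also have "\<dots> = q * (\<kappa>' * (\<Sum>x\<in>X. card (W x - spn x) * (\<Psi> x)\<^sup>2))"
      by (simp add: sum_distrib_left algebra_simps)
    also have "\<dots> = \<kappa>\<^sup>2 * (q * (\<Sum>\<Phi>\<in>\<Omega>. (F \<Phi>)\<^sup>2))" unfolding N[symmetric] by simp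
    finally have "\<kappa>\<^sup>2 * ((q - 1)\<^sup>2 * (\<Sum>\<Phi>\<in>\<Omega>. F (T i j t \<Phi>) * F \<Phi>)) \<le> \<kappa>\<^sup>2 * (q * (\<Sum>\<Phi>\<in>\<Omega>. (F \<Phi>)\<^sup>2))"
      by (simp add: power2_eq_square algebra_simps)
    thus ?thesis using \<kappa> by simp
  qed
  define n2 where "n2 = (\<Sum>\<Phi>\<in>\<Omega>. (F \<Phi>)\<^sup>2)"
  have ij: "i \<noteq> j" "cl i = cl j" using i j by (auto simp: cls_def)
  note act = T_action[OF ij]
  have "(\<Sum>\<Phi>\<in>\<Omega>. (param_avg (T i j) F \<Phi>)\<^sup>2) = (\<Sum>\<Phi>\<in>\<Omega>. F \<Phi> * param_avg (T i j) F \<Phi>)"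
    by (rule sum_inner_selfadj_idem) (rule param_avg_adjoint[OF act], rule ext, rule param_avg_idem[OF act])
  also have "\<dots> = (\<Sum>\<Phi>\<in>\<Omega>. \<Sum>t\<in>UNIV. F (T i j t \<Phi>) * F \<Phi>) / q"
    unfolding sum_divide_distrib[of _ \<Omega>]
    by (intro sum.cong refl) (simp add: param_avg_def q_def sum_distrib_left mult.commute)
  also have "(\<Sum>\<Phi>\<in>\<Omega>. \<Sum>t\<in>UNIV. F (T i j t \<Phi>) * F \<Phi>) = (\<Sum>t\<in>UNIV. \<Sum>\<Phi>\<in>\<Omega>. F (T i j t \<Phi>) * F \<Phi>)"
    by (rule sum.swap)
  \<comment> \<open>The term \<open>t = 0\<close> is \<open>n2\<close> itself and yields the 1/q of
    the bound; the remaining q - 1 terms yield the 1/(q - 1).\<close>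
  also have "\<dots> \<le> (\<Sum>t\<in>(UNIV :: 'q set). (if t = 0 then n2 - q / (q - 1)\<^sup>2 * n2 else 0) + q / (q - 1)\<^sup>2 * n2)"
  proof (rule sum_mono)
    fix t :: 'q
    show "(\<Sum>\<Phi>\<in>\<Omega>. F (T i j t \<Phi>) * F \<Phi>)
        \<le> (if t = 0 then n2 - q / (q - 1)\<^sup>2 * n2 else 0) + q / (q - 1)\<^sup>2 * n2"
    proof (cases "t = 0")
      case True
      thus ?thesis by (simp add: T_param n2_def power2_eq_square)
    next
      case False
      have "(q - 1)\<^sup>2 > 0" using q by simp
      thus ?thesis using corr[OF False] False by (simp add: field_simps n2_def)
    qed
  qed
  also have "\<dots> = n2 - q / (q - 1)\<^sup>2 * n2 + q * (q / (q - 1)\<^sup>2 * n2)"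
    by (simp add: sum.distrib q_def)
  also have "\<dots> = n2 + q / (q - 1) * n2"
  proof -
    define r where "r = q - 1"
    have "r \<noteq> 0" "q = r + 1" using q by (auto simp: r_def)
    thus ?thesis by (simp add: field_simps power2_eq_square)
  qed
  finally have "(\<Sum>\<Phi>\<in>\<Omega>. (param_avg (T i j) F \<Phi>)\<^sup>2) \<le> (n2 + q / (q - 1) * n2) / q"
    using q by (simp add: divide_right_mono)
  also have "\<dots> = (1 / q + 1 / (q - 1)) * n2" using q by (simp add: field_simps)
  finally show ?thesis by (simp add: q_def n2_def)
qed simp

end

section \<open>Correlation of functions of two partial sums\<close>

text \<open>Conditional expectation of \<open>F\<close> given \<open>K\<close> under the uniform
  distribution on \<open>\<Omega>\<close>.\<close>

definition cexp :: "'w set \<Rightarrow> ('w \<Rightarrow> 'k) \<Rightarrow> ('w \<Rightarrow> real) \<Rightarrow> 'w \<Rightarrow> real"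
  where "cexp \<Omega> K F w = (\<Sum>v\<in>{v \<in> \<Omega>. K v = K w}. F v) / card {v \<in> \<Omega>. K v = K w}"

lemma cexp_cong: "K w = K w' \<Longrightarrow> cexp \<Omega> K F w = cexp \<Omega> K F w'"
  by (simp add: cexp_def)

lemma sum_cexp_fiber:
  assumes "finite \<Omega>" "w \<in> \<Omega>"
  shows "(\<Sum>v\<in>{v \<in> \<Omega>. K v = K w}. cexp \<Omega> K F v) = (\<Sum>v\<in>{v \<in> \<Omega>. K v = K w}. F v)"
proof -
  let ?A = "{v \<in> \<Omega>. K v = K w}"
  have "card ?A > 0" using assms by (auto simp: card_gt_0_iff)
  moreover have "(\<Sum>v\<in>?A. cexp \<Omega> K F v) = (\<Sum>v\<in>?A. cexp \<Omega> K F w)"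
    by (rule sum.cong[OF refl], rule cexp_cong) simp
  ultimately show ?thesis by (simp add: cexp_def)
qed

lemma sum_cexp_mult:
  assumes fin: "finite \<Omega>" and G: "\<And>v w. v \<in> \<Omega> \<Longrightarrow> w \<in> \<Omega> \<Longrightarrow> K v = K w \<Longrightarrow> G v = G w"
  shows "(\<Sum>w\<in>\<Omega>. cexp \<Omega> K F w * G w) = (\<Sum>w\<in>\<Omega>. F w * G w)"
proof -
  have group: "(\<Sum>w\<in>\<Omega>. h w) = (\<Sum>k\<in>K ` \<Omega>. \<Sum>w\<in>{w \<in> \<Omega>. K w = k}. h w)" for h :: "_ \<Rightarrow> real"
    by (rule sum.group[symmetric]) (use fin in auto)
  show ?thesis unfolding group
  proof (rule sum.cong[OF refl])
    fix k assume "k \<in> K ` \<Omega>"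
    then obtain v where v: "v \<in> \<Omega>" "k = K v" by blast
    have Gv: "G w = G v" if "w \<in> \<Omega>" "K w = k" for w by (rule G) (use that v in auto)
    have "(\<Sum>w\<in>{w \<in> \<Omega>. K w = k}. H w * G w) = (\<Sum>w\<in>{w \<in> \<Omega>. K w = k}. H w) * G v" for H
      unfolding sum_distrib_right by (rule sum.cong[OF refl]) (use Gv in simp)
    thus "(\<Sum>w\<in>{w \<in> \<Omega>. K w = k}. cexp \<Omega> K F w * G w) = (\<Sum>w\<in>{w \<in> \<Omega>. K w = k}. F w * G w)"
      using sum_cexp_fiber[OF fin v(1), of K F] by (simp add: v(2))
  qed
qed

lemma sum_cexp_split:
  assumes "finite \<Omega>"
  shows "(\<Sum>w\<in>\<Omega>. (F w)\<^sup>2) = (\<Sum>w\<in>\<Omega>. (F w - cexp \<Omega> K F w)\<^sup>2) + (\<Sum>w\<in>\<Omega>. (cexp \<Omega> K F w)\<^sup>2)"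
proof -
  have "(\<Sum>w\<in>\<Omega>. cexp \<Omega> K F w * cexp \<Omega> K F w) = (\<Sum>w\<in>\<Omega>. F w * cexp \<Omega> K F w)"
    by (rule sum_cexp_mult[OF assms]) (rule cexp_cong)
  moreover have "(\<Sum>w\<in>\<Omega>. (F w - cexp \<Omega> K F w)\<^sup>2) = (\<Sum>w\<in>\<Omega>. F w * F w) - (\<Sum>w\<in>\<Omega>. F w * cexp \<Omega> K F w)
      - (\<Sum>w\<in>\<Omega>. F w * cexp \<Omega> K F w) + (\<Sum>w\<in>\<Omega>. cexp \<Omega> K F w * cexp \<Omega> K F w)"
    unfolding sum.distrib[symmetric] sum_subtractf[symmetric]
    by (rule sum.cong[OF refl]) (simp add: power2_eq_square algebra_simps)
  ultimately show ?thesis unfolding power2_eq_square by linarith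
qed

text \<open>The action permutes the fibres of \<open>K\<close>, so conditioning keeps
  invariance.\<close>

lemma cexp_action:
  assumes u: "param_action \<Omega> u" and F: "\<And>w. w \<in> \<Omega> \<Longrightarrow> F (u t w) = F w"
    and K: "\<And>t v w. K v = K w \<Longrightarrow> K (u t v) = K (u t w)"
  shows "cexp \<Omega> K F (u t w) = cexp \<Omega> K F w"
proof -
  have iff: "K (u t v) = K (u t w) \<longleftrightarrow> K v = K w" for v
    using K[of v w t] K[of "u t v" "u t w" "- t"] by (auto simp: param_actionD(1,2)[OF u])
  have bij: "bij_betw (u t) {v \<in> \<Omega>. K v = K w} {v \<in> \<Omega>. K v = K (u t w)}"
  proof (rule bij_betw_byWitness[where f' = "u (- t)"])
    have "K (u (- t) v) = K w" if "K v = K (u t w)" for v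
      using iff[of "u (- t) v"] that by (simp add: param_actionD(1,2)[OF u])
    thus "u (- t) ` {v \<in> \<Omega>. K v = K (u t w)} \<subseteq> {v \<in> \<Omega>. K v = K w}"
      using param_actionD(3)[OF u] by blast
    show "u t ` {v \<in> \<Omega>. K v = K w} \<subseteq> {v \<in> \<Omega>. K v = K (u t w)}"
      using param_actionD(3)[OF u] iff by blast
  qed (simp_all add: param_actionD(1,2)[OF u])
  have "(\<Sum>v\<in>{v \<in> \<Omega>. K v = K (u t w)}. F v) = (\<Sum>v\<in>{v \<in> \<Omega>. K v = K w}. F v)"
    unfolding sum.reindex_bij_betw[OF bij, symmetric] by (rule sum.cong[OF refl]) (simp add: F)
  thus ?thesis unfolding cexp_def using bij_betw_same_card[OF bij] by simp
qed

text \<open>Relations of elementary matrices. The commutators of \<open>T p j\<close> with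
  \<open>T i p\<close> and of \<open>T i m\<close> with \<open>T m j\<close> are transvections
  \<open>T i j\<close>, with opposite signs in the order given.\<close>

lemma T_commute:
  assumes "distinct [i, j, p, m]"
  shows "T i j s (T p j t w) = T p j t (T i j s w)" "T i j s (T i m t w) = T i m t (T i j s w)"
    "T i j s (T p m t w) = T p m t (T i j s w)"
    and "T p j s (T i p t w) = T i p t (T p j s (T i j (s * t) w))"
    and "T i m s (T m j t w) = T m j t (T i m s (T i j (- (s * t)) w))"
  by (rule ext, use assms in \<open>auto simp: T_def vec.scale_right_distrib vec.scale_right_diff_distrib algebra_simps\<close>)+

text \<open>Transposes all sums of rank-one matrices; it reduces statements about second vectors to
  statements about first vectors.\<close>

definition swap_pairs :: "('q, 'n) pairs \<Rightarrow> ('q::field, 'n::finite) pairs"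
  where "swap_pairs \<Phi> k = (snd (\<Phi> k), fst (\<Phi> k))"

lemma swap_swap [simp]: "swap_pairs (swap_pairs \<Phi>) = \<Phi>"
  by (simp add: swap_pairs_def fun_eq_iff)

lemma swap_T: "i \<noteq> j \<Longrightarrow> swap_pairs (T i j t \<Phi>) = T j i (- t) (swap_pairs \<Phi>)"
  by (rule ext) (simp add: swap_pairs_def T_def)

lemma psum_swap: "psum K (swap_pairs \<Phi>) = transpose (psum K \<Phi>)"
  by (simp add: Finite_Cartesian_Product.vec_eq_iff psum_def swap_pairs_def outer_def
    Finite_Cartesian_Product.transpose_def mult.commute)

lemma frame_of_trivial_annihilator:
  fixes e :: "'n::finite \<Rightarrow> 'q::field ^ 'n"
  assumes "\<And>z. (\<And>k. dot z (e k) = 0) \<Longrightarrow> z = 0"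
  shows "frame e"
proof -
  define A :: "'q ^ 'n ^ 'n" where "A = (\<chi> k i. e k $ i)"
  have "x = 0" if "A *v x = 0" for x
  proof (rule assms)
    fix k
    have "(A *v x) $ k = 0" using that by simp
    thus "dot x (e k) = 0" by (simp add: A_def matrix_vector_mult_def dot_def mult.commute)
  qed
  then obtain B where "B ** A = Finite_Cartesian_Product.mat 1"
    using matrix_left_invertible_ker[of A] by blast
  hence AB: "A ** B = Finite_Cartesian_Product.mat 1" by (simp add: matrix_left_right_inverse)
  have "dual (\<lambda>l. \<chi> i. B $ i $ l) e"
    unfolding dual_def
  proof (intro allI)
    fix k l
    have "(A ** B) $ l $ k = (if k = l then 1 else 0)"
      unfolding AB by (simp add: Finite_Cartesian_Product.mat_def)
    thus "dot (\<chi> i. B $ i $ k) (e l) = (if k = l then 1 else 0)"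
      by (simp add: A_def matrix_matrix_mult_def dot_def mult.commute)
  qed
  thus ?thesis by (auto simp: frame_def)
qed

lemma dual_commute: "dual \<zeta> e \<Longrightarrow> dual e \<zeta>"
  unfolding dual_def by (auto simp: dot_commute[of "e _" "\<zeta> _"])

lemma frame_annihilator:
  assumes "frame e" "\<And>k. dot z (e k) = 0"
  shows "z = 0"
proof -
  obtain \<zeta> where \<zeta>: "dual \<zeta> e" using assms(1) by (auto simp: frame_def)
  have "z = (\<Sum>k\<in>UNIV. dot (e k) z *s \<zeta> k)" by (rule frame_expand[OF dual_commute[OF \<zeta>], symmetric])
  also have "\<dots> = 0"
  proof (rule sum.neutral, rule ballI)
    fix k
    have "dot (e k) z = 0" unfolding dot_commute[of "e k" z] by (rule assms(2))
    thus "dot (e k) z *s \<zeta> k = 0" by simp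
  qed
  finally show ?thesis .
qed

section \<open>Independence of the classes\<close>

definition mix :: "'n set \<Rightarrow> ('n \<Rightarrow> 'a) \<Rightarrow> ('n \<Rightarrow> 'a) \<Rightarrow> 'n \<Rightarrow> 'a"
  where "mix K \<Phi> \<Psi> k = (if k \<in> K then \<Phi> k else \<Psi> k)"

context config
begin

lemma \<Omega>_frame:
  assumes "\<Phi> \<in> \<Omega>"
  shows "frame (\<lambda>k. fst (\<Phi> k))" "frame (\<lambda>k. snd (\<Phi> k))"
  using assms by (simp_all add: \<Omega>_def frames_def)

lemma swap_\<Omega>: "swap_pairs \<Phi> \<in> config.\<Omega> cl (\<lambda>c. transpose (M c)) \<longleftrightarrow> \<Phi> \<in> \<Omega>"
proof -
  have "transpose A = transpose B \<longleftrightarrow> A = B" for A B :: "'q ^ 'n ^ 'n"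
  proof
    assume "transpose A = transpose B"
    hence "transpose (transpose A) = transpose (transpose B)" by (rule arg_cong)
    thus "A = B" by simp
  qed simp
  moreover have "swap_pairs \<Phi> \<in> frames \<longleftrightarrow> \<Phi> \<in> frames"
    by (simp add: frames_def swap_pairs_def conj_commute)
  ultimately show ?thesis by (simp add: config.\<Omega>_def psum_swap config.cls_def)
qed

text \<open>For a nonzero class the first vectors of all elements of \<open>\<Omega>\<close> span
  the same space, the range of \<open>M c\<close>, so a covector killing them for one element kills
  them for all. Every other class can therefore be transferred to the element that supplies class 0,
  for which there is no such common span.\<close>

lemma mix_fst_frame:
  assumes "\<Phi> \<in> \<Omega>" "\<Psi> \<in> \<Omega>"
  shows "frame (\<lambda>k. fst (mix (cl -` C) \<Phi> \<Psi> k))"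
proof (rule frame_of_trivial_annihilator)
  fix z assume z: "\<And>k. dot z (fst (mix (cl -` C) \<Phi> \<Psi> k)) = 0"
  have transfer: "dot z (fst (\<Psi>' k)) = 0"
    if h: "\<Phi>' \<in> \<Omega>" "\<Psi>' \<in> \<Omega>" "cl k \<noteq> 0" "\<And>l. cl l = cl k \<Longrightarrow> dot z (fst (\<Phi>' l)) = 0" for \<Phi>' \<Psi>' k
  proof -
    obtain \<zeta> \<eta> where d: "dual \<zeta> (\<lambda>k. fst (\<Psi>' k))" "dual \<eta> (\<lambda>k. snd (\<Psi>' k))"
      by (rule framesE[of \<Psi>']) (use h(2) \<Omega>_def in auto)
    have "fst (\<Psi>' k) = M (cl k) *v \<eta> k"
      by (rule M_mult_dual[OF h(2,3) d(2), symmetric]) (simp add: cls_def)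
    also have "\<dots> = (\<Sum>l\<in>cls (cl k). dot (snd (\<Phi>' l)) (\<eta> k) *s fst (\<Phi>' l))"
      by (rule M_mult[OF h(1,3)])
    also have "dot z \<dots> = 0"
      unfolding dot_sum_right by (rule sum.neutral) (use h(4) in \<open>simp add: cls_def dot_simps\<close>)
    finally show ?thesis .
  qed
  have in_C: "dot z (fst (\<Phi> k)) = 0" if "cl k \<in> C" for k
    using z[of k] that by (simp add: mix_def)
  have notin_C: "dot z (fst (\<Psi> k)) = 0" if "cl k \<notin> C" for k
    using z[of k] that by (simp add: mix_def)
  show "z = 0"
  proof (cases "0 \<in> C")
    case True
    show ?thesis
    proof (rule frame_annihilator[OF \<Omega>_frame(1)[OF assms(1)]])
      fix k
      show "dot z (fst (\<Phi> k)) = 0"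
      proof (cases "cl k \<in> C")
        case False
        hence "cl k \<noteq> 0" using True by (intro notI) simp
        thus ?thesis by (rule transfer[OF assms(2,1)]) (use notin_C False in simp)
      qed (rule in_C)
    qed
  next
    case False
    show ?thesis
    proof (rule frame_annihilator[OF \<Omega>_frame(1)[OF assms(2)]])
      fix k
      show "dot z (fst (\<Psi> k)) = 0"
      proof (cases "cl k \<in> C")
        case True
        hence "cl k \<noteq> 0" using False by (intro notI) simp
        thus ?thesis by (rule transfer[OF assms(1,2)]) (use in_C True in simp)
      qed (rule notin_C)
    qed
  qed
qed

lemma mix_\<Omega>:
  assumes "\<Phi> \<in> \<Omega>" "\<Psi> \<in> \<Omega>"
  shows "mix (cl -` C) \<Phi> \<Psi> \<in> \<Omega>"
proof -
  have "frame (\<lambda>k. fst (mix (cl -` C) (swap_pairs \<Phi>) (swap_pairs \<Psi>) k))"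
    by (rule config.mix_fst_frame[where M = "\<lambda>c. transpose (M c)", OF iffD2[OF swap_\<Omega> assms(1)] iffD2[OF swap_\<Omega> assms(2)]])
  moreover have "fst (mix (cl -` C) (swap_pairs \<Phi>) (swap_pairs \<Psi>) k) = snd (mix (cl -` C) \<Phi> \<Psi> k)" for k
    by (simp add: mix_def swap_pairs_def)
  hence "(\<lambda>k. fst (mix (cl -` C) (swap_pairs \<Phi>) (swap_pairs \<Psi>) k)) = (\<lambda>k. snd (mix (cl -` C) \<Phi> \<Psi> k))"
    by (rule ext)
  ultimately have "frame (\<lambda>k. snd (mix (cl -` C) \<Phi> \<Psi> k))" by simp
  hence fr: "mix (cl -` C) \<Phi> \<Psi> \<in> frames" unfolding frames_def mem_Collect_eq
    by (rule conjI[OF mix_fst_frame[OF assms]])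
  have "psum (cls c) (mix (cl -` C) \<Phi> \<Psi>) = M c" if c: "c \<noteq> 0" for c
  proof (cases "c \<in> C")
    case True
    have "psum (cls c) (mix (cl -` C) \<Phi> \<Psi>) = psum (cls c) \<Phi>"
      unfolding psum_def by (rule sum.cong[OF refl]) (use True in \<open>simp add: mix_def cls_def\<close>)
    thus ?thesis using assms(1) c by (simp add: \<Omega>_def)
  next
    case False
    have "psum (cls c) (mix (cl -` C) \<Phi> \<Psi>) = psum (cls c) \<Psi>"
      unfolding psum_def by (rule sum.cong[OF refl]) (use False in \<open>simp add: mix_def cls_def\<close>)
    thus ?thesis using assms(2) c by (simp add: \<Omega>_def)
  qed
  thus ?thesis using fr by (simp add: \<Omega>_def)
qed

end

lemma Cauchy_Schwarz_two:
  fixes a b c d :: real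
  assumes "0 \<le> a" "0 \<le> b" "0 \<le> c" "0 \<le> d"
  shows "sqrt a * sqrt b + sqrt c * sqrt d \<le> sqrt (a + c) * sqrt (b + d)"
proof -
  have "0 \<le> (sqrt a * sqrt d - sqrt c * sqrt b)\<^sup>2" by simp
  hence "(sqrt a * sqrt b + sqrt c * sqrt d)\<^sup>2 \<le> (a + c) * (b + d)"
    using assms by (simp add: power2_eq_square algebra_simps)
  hence "sqrt a * sqrt b + sqrt c * sqrt d \<le> sqrt ((a + c) * (b + d))"
    by (rule real_le_rsqrt)
  thus ?thesis by (simp add: real_sqrt_mult)
qed

lemma sqrt_add_le: "0 \<le> a \<Longrightarrow> 0 \<le> b \<Longrightarrow> sqrt a + sqrt b \<le> sqrt 2 * sqrt (a + b)"
  using Cauchy_Schwarz_two[of a 1 b 1] by (simp add: mult.commute)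

section \<open>Contraction by resampling and the bound for a single class\<close>

context config
begin

definition nrm :: "(('q, 'n) pairs \<Rightarrow> real) \<Rightarrow> real"
  where "nrm F = sqrt (\<Sum>\<Phi>\<in>\<Omega>. (F \<Phi>)\<^sup>2)"

lemma nrm_nonneg: "0 \<le> nrm F"
  by (simp add: nrm_def sum_nonneg)

definition contracted :: "real \<Rightarrow> 'n \<Rightarrow> 'n \<Rightarrow> (('q, 'n) pairs \<Rightarrow> real) \<Rightarrow> bool"
  where "contracted \<delta> i j F \<longleftrightarrow> nrm (param_avg (T i j) F) \<le> sqrt \<delta> * nrm F"

definition T_inv :: "'n \<Rightarrow> 'n \<Rightarrow> (('q, 'n) pairs \<Rightarrow> real) \<Rightarrow> bool"
  where "T_inv i j F \<longleftrightarrow> (\<forall>t. \<forall>\<Phi>\<in>\<Omega>. F (T i j t \<Phi>) = F \<Phi>)"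

text \<open>\<open>heisenberg_bound\<close> with centre \<open>T i j\<close>. In the application
  \<open>i\<close> and \<open>j\<close> lie in opposite cells: \<open>p\<close> agrees with
  \<open>j\<close> and \<open>m\<close> with \<open>i\<close> in the bit that \<open>F\<close>
  reads, while for \<open>G\<close> the pairing is the other one.\<close>

lemma heisenberg_T:
  assumes dist: "distinct [i, j, p, m]" and cl: "cl i = c" "cl j = c" "cl p = c" "cl m = c"
    and F: "T_inv p j F" "T_inv i m F" and G: "T_inv m j G" "T_inv i p G"
    and contracted: "contracted \<delta> i j F" "contracted \<delta> i j G" and \<delta>: "0 \<le> \<delta>"
  shows "\<bar>\<Sum>\<Phi>\<in>\<Omega>. F \<Phi> * G \<Phi>\<bar> \<le> (1 / CARD('q) + \<delta>) * (nrm F * nrm G)"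
proof -
  have d: "i \<noteq> j" "p \<noteq> j" "i \<noteq> m" "m \<noteq> j" "i \<noteq> p" using dist by auto
  have dist': "distinct [i, j, m, p]" "distinct [m, j, i, p]" "distinct [p, j, m, i]" "distinct [i, m, j, p]"
    using dist by auto
  have "\<bar>\<Sum>\<Phi>\<in>\<Omega>. F \<Phi> * G \<Phi>\<bar> \<le> 1 / CARD('q) * (nrm F * nrm G)
      + nrm (param_avg (T i j) F) * nrm (param_avg (T i j) G)"
    unfolding nrm_def
  proof (rule heisenberg_bound[where ?a1.0 = "T p j" and ?a2.0 = "T i m" and ?b1.0 = "T m j" and ?b2.0 = "T i p"])
    show "param_action \<Omega> (T p j)" "param_action \<Omega> (T i m)" "param_action \<Omega> (T m j)"
        "param_action \<Omega> (T i p)" "param_action \<Omega> (T i j)"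
      by (rule T_action, fact d, simp add: cl)+
  next
    fix t \<Phi> assume "\<Phi> \<in> \<Omega>"
    thus "F (T p j t \<Phi>) = F \<Phi>" "F (T i m t \<Phi>) = F \<Phi>" "G (T m j t \<Phi>) = G \<Phi>" "G (T i p t \<Phi>) = G \<Phi>"
      using F G unfolding T_inv_def by blast+
  next
    fix s t and \<Phi> :: "('q, 'n) pairs"
    show "T i j s (T p j t \<Phi>) = T p j t (T i j s \<Phi>)" by (rule T_commute(1)[OF dist])
    show "T i j s (T i m t \<Phi>) = T i m t (T i j s \<Phi>)" by (rule T_commute(2)[OF dist])
    show "T i j s (T m j t \<Phi>) = T m j t (T i j s \<Phi>)" by (rule T_commute(1)[OF dist'(1)])
    show "T i j s (T i p t \<Phi>) = T i p t (T i j s \<Phi>)" by (rule T_commute(2)[OF dist'(1)])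
    show "T m j s (T i p t \<Phi>) = T i p t (T m j s \<Phi>)" by (rule T_commute(3)[OF dist'(2)])
    show "T p j s (T m j t \<Phi>) = T m j t (T p j s \<Phi>)" by (rule T_commute(1)[OF dist'(3)])
    show "T i m s (T i p t \<Phi>) = T i p t (T i m s \<Phi>)" by (rule T_commute(2)[OF dist'(4)])
    show "T p j s (T i p t \<Phi>) = T i p t (T p j s (T i j (s * t) \<Phi>))" by (rule T_commute(4)[OF dist])
    show "T i m s (T m j t \<Phi>) = T m j t (T i m s (T i j (- (s * t)) \<Phi>))" by (rule T_commute(5)[OF dist])
  qed
  also have "nrm (param_avg (T i j) F) * nrm (param_avg (T i j) G) \<le> (sqrt \<delta> * nrm F) * (sqrt \<delta> * nrm G)"
    using contracted \<delta> by (intro mult_mono) (auto simp: contracted_def nrm_nonneg)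
  also have "(sqrt \<delta> * nrm F) * (sqrt \<delta> * nrm G) = (sqrt \<delta> * sqrt \<delta>) * (nrm F * nrm G)"
    by (simp only: ac_simps)
  also have "sqrt \<delta> * sqrt \<delta> = \<delta>" using \<delta> by simp
  finally show ?thesis by (simp add: distrib_right)
qed

definition depends :: "'n set \<Rightarrow> (('q, 'n) pairs \<Rightarrow> real) \<Rightarrow> bool"
  where "depends S F \<longleftrightarrow> (\<forall>\<Phi> \<Phi>'. (\<forall>k\<in>S. \<Phi> k = \<Phi>' k) \<longrightarrow> F \<Phi> = F \<Phi>')"

definition admissible :: "'n set \<Rightarrow> (('q, 'n) pairs \<Rightarrow> real) \<Rightarrow> bool"
  where "admissible S F \<longleftrightarrow> depends S F \<and>
    (\<forall>i\<in>S. \<forall>j\<in>S. i \<noteq> j \<longrightarrow> cl i = cl j \<longrightarrow> T_inv i j F)"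

definition half_key :: "'n set \<Rightarrow> nat \<Rightarrow> ('q, 'n) pairs \<Rightarrow> ('n \<Rightarrow> 'q ^ 'n) \<times> ('n \<Rightarrow> 'q ^ 'n)"
  where "half_key S c \<Phi> = (\<lambda>k. if k \<in> cls c then 0 else fst (\<Phi> k),
    \<lambda>k. if k \<in> - cls c \<union> S then snd (\<Phi> k) else 0)"

lemma half_key_eq_iff: "half_key S c \<Phi> = half_key S c \<Phi>' \<longleftrightarrow>
  (\<forall>k. k \<notin> cls c \<longrightarrow> fst (\<Phi> k) = fst (\<Phi>' k)) \<and> (\<forall>k\<in>- cls c \<union> S. snd (\<Phi> k) = snd (\<Phi>' k))"
  unfolding half_key_def prod.inject fun_eq_iff by auto

text \<open>Every admissible function splits into \<open>lower\<close>, which does not see the first vectors of the class, and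
  \<open>upper\<close>, which has mean zero over them. Resampling a first vector contracts the upper part,
  resampling a second vector the lower part.\<close>

definition lower :: "'n set \<Rightarrow> nat \<Rightarrow> (('q, 'n) pairs \<Rightarrow> real) \<Rightarrow> ('q, 'n) pairs \<Rightarrow> real"
  where "lower S c F = cexp \<Omega> (half_key S c) F"

definition upper :: "'n set \<Rightarrow> nat \<Rightarrow> (('q, 'n) pairs \<Rightarrow> real) \<Rightarrow> ('q, 'n) pairs \<Rightarrow> real"
  where "upper S c F \<Phi> = F \<Phi> - lower S c F \<Phi>"

lemma inv_of_depends:
  assumes "depends S F" "i \<notin> S" "j \<notin> S"
  shows "T_inv i j F"
proof -
  have "F (T i j t \<Phi>) = F \<Phi>" for t \<Phi>
  proof -
    have "\<forall>k\<in>S. T i j t \<Phi> k = \<Phi> k" using assms(2,3) by (auto simp: T_def)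
    thus ?thesis using assms(1) unfolding depends_def by blast
  qed
  thus ?thesis unfolding T_inv_def by blast
qed

lemma lower_inv:
  assumes F: "T_inv i j F" and ij: "i \<noteq> j" "i \<in> cls c" "j \<in> cls c" "i \<in> S \<longleftrightarrow> j \<in> S"
  shows "T_inv i j (lower S c F)"
proof -
  have act: "param_action \<Omega> (T i j)" by (rule T_action) (use ij in \<open>auto simp: cls_def\<close>)
  have "cexp \<Omega> (half_key S c) F (T i j t \<Phi>) = cexp \<Omega> (half_key S c) F \<Phi>" for t \<Phi>
  proof (rule cexp_action[OF act])
    show "\<And>w. w \<in> \<Omega> \<Longrightarrow> F (T i j t w) = F w" using F by (simp add: T_inv_def)
    fix t v w assume "half_key S c v = half_key S c w"
    thus "half_key S c (T i j t v) = half_key S c (T i j t w)"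
      using ij unfolding half_key_eq_iff by (auto simp: T_def)
  qed
  thus ?thesis by (simp add: T_inv_def lower_def)
qed

lemma upper_inv:
  assumes "T_inv i j F" "i \<noteq> j" "i \<in> cls c" "j \<in> cls c" "i \<in> S \<longleftrightarrow> j \<in> S"
  shows "T_inv i j (upper S c F)"
  using assms(1) lower_inv[OF assms] by (simp add: T_inv_def upper_def)

text \<open>The constant of \<open>resample_bound\<close>; it bounds squared norms, hence the
  \<open>sqrt\<close> in \<open>contracted\<close>.\<close>

definition \<delta>0 :: real
  where "\<delta>0 = 1 / CARD('q) + 1 / (real CARD('q) - 1)"

lemma \<delta>0_nonneg: "0 \<le> \<delta>0"
  using two_le_card_field[where 'q = 'q] by (simp add: \<delta>0_def)

text \<open>Here \<open>full = True\<close>: the second vectors on \<open>S\<close> are visible, and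
  \<open>upper\<close> sums to 0 over each fibre of \<open>half_key\<close>, which is what
  \<open>resample_bound\<close> asks for.\<close>

lemma upper_contracted:
  assumes F: "admissible S F" and i: "i \<in> cls c - S" and j: "j \<in> S \<inter> cls c"
  shows "contracted \<delta>0 i j (upper S c F)"
proof -
  interpret config_side cl M S c True .
  have J: "J = - I \<union> S" by (auto simp: J_def JI_def)
  have "(\<Sum>\<Phi>\<in>\<Omega>. (param_avg (T i j) (upper S c F) \<Phi>)\<^sup>2) \<le> \<delta>0 * (\<Sum>\<Phi>\<in>\<Omega>. (upper S c F \<Phi>)\<^sup>2)"
    unfolding \<delta>0_def
  proof (rule resample_bound[OF _ _ _ i j])
    fix \<Phi> \<Phi>' assume "key \<Phi> = key \<Phi>'"
    hence *: "\<forall>k. k \<notin> I - S \<longrightarrow> fst (\<Phi> k) = fst (\<Phi>' k)" "\<forall>k\<in>- I \<union> S. snd (\<Phi> k) = snd (\<Phi>' k)"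
      unfolding key_eq_iff J by blast+
    have eq: "fst (\<Phi> k) = fst (\<Phi>' k)" if "k \<notin> I - S" for k using *(1) that by blast
    have eq': "snd (\<Phi> k) = snd (\<Phi>' k)" if "k \<in> - I \<union> S" for k using *(2) that by blast
    have "\<Phi> k = \<Phi>' k" if "k \<in> S" for k using eq[of k] eq'[of k] that by (simp add: prod_eq_iff)
    hence "F \<Phi> = F \<Phi>'" using F by (simp add: admissible_def depends_def)
    moreover have "half_key S c \<Phi> = half_key S c \<Phi>'" unfolding half_key_eq_iff using eq eq' by simp
    hence "lower S c F \<Phi> = lower S c F \<Phi>'" unfolding lower_def by (rule cexp_cong[where K = "half_key S c"])
    ultimately show "upper S c F \<Phi> = upper S c F \<Phi>'" by (simp add: upper_def)
  next
    fix k l t \<Phi> assume kl: "k \<in> S \<inter> I" "l \<in> S \<inter> I" "k \<noteq> l" and \<Phi>: "\<Phi> \<in> \<Omega>"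
    have "T_inv k l F" using F kl by (simp add: admissible_def cls_def)
    hence "T_inv k l (upper S c F)" by (rule upper_inv) (use kl in auto)
    thus "upper S c F (T k l t \<Phi>) = upper S c F \<Phi>" using \<Phi> by (simp add: T_inv_def)
  next
    fix \<Phi>0 assume \<Phi>0: "\<Phi>0 \<in> \<Omega>"
    have "{\<Phi> \<in> \<Omega>. (\<forall>k\<in>- I. fst (\<Phi> k) = fst (\<Phi>0 k)) \<and> (\<forall>k\<in>J. snd (\<Phi> k) = snd (\<Phi>0 k))}
        = {\<Phi> \<in> \<Omega>. half_key S c \<Phi> = half_key S c \<Phi>0}"
      unfolding half_key_eq_iff J by auto
    thus "(\<Sum>\<Phi>\<in>{\<Phi> \<in> \<Omega>. (\<forall>k\<in>- I. fst (\<Phi> k) = fst (\<Phi>0 k)) \<and> (\<forall>k\<in>J. snd (\<Phi> k) = snd (\<Phi>0 k))}.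
        upper S c F \<Phi>) = 0"
      using sum_cexp_fiber[OF _ \<Phi>0, of "half_key S c" F] by (simp add: upper_def lower_def sum_subtractf)
  qed
  thus ?thesis unfolding contracted_def nrm_def by (simp add: real_sqrt_mult[symmetric])
qed

definition balanced :: "nat \<Rightarrow> (('q, 'n) pairs \<Rightarrow> real) \<Rightarrow> bool"
  where "balanced c F \<longleftrightarrow> (\<forall>\<Phi>0\<in>\<Omega>. (\<Sum>\<Phi>\<in>{\<Phi> \<in> \<Omega>. \<forall>k\<in>- cls c. \<Phi> k = \<Phi>0 k}. F \<Phi>) = 0)"

text \<open>Whether the pairs outside the class take prescribed values can be read off
  \<open>half_key\<close>, so conditioning on it preserves the sum over this event.\<close>

lemma lower_balanced:
  assumes "balanced c F"
  shows "balanced c (lower S c F)"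
  unfolding balanced_def
proof
  fix \<Phi>0 assume \<Phi>0: "\<Phi>0 \<in> \<Omega>"
  define B where "B = {\<Phi> \<in> \<Omega>. \<forall>k\<in>- cls c. \<Phi> k = \<Phi>0 k}"
  define G where "G \<Phi> = (if \<Phi> \<in> B then 1 else 0 :: real)" for \<Phi>
  have "(\<Sum>\<Phi>\<in>\<Omega>. cexp \<Omega> (half_key S c) F \<Phi> * G \<Phi>) = (\<Sum>\<Phi>\<in>\<Omega>. F \<Phi> * G \<Phi>)"
  proof (rule sum_cexp_mult)
    fix v w assume "v \<in> \<Omega>" "w \<in> \<Omega>" "half_key S c v = half_key S c w"
    hence "v k = w k" if "k \<in> - cls c" for k
      using that unfolding half_key_eq_iff by (simp add: prod_eq_iff)
    thus "G v = G w" using \<open>v \<in> \<Omega>\<close> \<open>w \<in> \<Omega>\<close> by (simp add: G_def B_def)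
  qed simp
  moreover have "(\<Sum>\<Phi>\<in>\<Omega>. H \<Phi> * G \<Phi>) = (\<Sum>\<Phi>\<in>B. H \<Phi>)" for H
    by (rule sum.mono_neutral_cong_right) (auto simp: G_def B_def)
  ultimately have "(\<Sum>\<Phi>\<in>B. lower S c F \<Phi>) = (\<Sum>\<Phi>\<in>B. F \<Phi>)" by (simp add: lower_def)
  thus "(\<Sum>\<Phi>\<in>{\<Phi> \<in> \<Omega>. \<forall>k\<in>- cls c. \<Phi> k = \<Phi>0 k}. lower S c F \<Phi>) = 0"
    using assms \<Phi>0 by (simp add: balanced_def B_def)
qed

lemma sum_swap_pairs:
  "(\<Sum>\<Phi>\<in>config.\<Omega> cl (\<lambda>c. transpose (M c)). h (swap_pairs \<Phi>)) = (\<Sum>\<Phi>\<in>\<Omega>. h \<Phi> :: real)"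
proof (rule sum.reindex_bij_betw)
  show "bij_betw swap_pairs (config.\<Omega> cl (\<lambda>c. transpose (M c))) \<Omega>"
  proof (rule bij_betw_byWitness[where f' = swap_pairs])
    have "swap_pairs \<Phi> \<in> \<Omega>" if "\<Phi> \<in> config.\<Omega> cl (\<lambda>c. transpose (M c))" for \<Phi>
      using swap_\<Omega>[of "swap_pairs \<Phi>"] that by simp
    thus "swap_pairs ` config.\<Omega> cl (\<lambda>c. transpose (M c)) \<subseteq> \<Omega>" by blast
    show "swap_pairs ` \<Omega> \<subseteq> config.\<Omega> cl (\<lambda>c. transpose (M c))" using swap_\<Omega> by blast
  qed simp_all
qed

text \<open>After exchanging first and second vectors, \<open>lower\<close> reads only first vectors
  inside the class, so \<open>full = False\<close>; mean zero over the class comes from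
  \<open>balanced\<close>. The exchange reverses the transvection, hence the order
  \<open>j i\<close>.\<close>

lemma lower_contracted:
  assumes F: "admissible S F" and bal: "balanced c F" and i: "i \<in> cls c - S" and j: "j \<in> S \<inter> cls c"
  shows "contracted \<delta>0 j i (lower S c F)"
proof -
  interpret sw: config_side cl "\<lambda>c. transpose (M c)" S c False .
  have J: "sw.J = - cls c" unfolding sw.J_def sw.JI_def by simp
  let ?\<Omega>' = "config.\<Omega> cl (\<lambda>c. transpose (M c))"
  define F' where "F' \<Phi> = lower S c F (swap_pairs \<Phi>)" for \<Phi>
  have in\<Omega>: "swap_pairs \<Phi> \<in> \<Omega>" if "\<Phi> \<in> ?\<Omega>'" for \<Phi> using swap_\<Omega>[of "swap_pairs \<Phi>"] that by simp
  have "(\<Sum>\<Phi>\<in>?\<Omega>'. (param_avg (T i j) F' \<Phi>)\<^sup>2) \<le> \<delta>0 * (\<Sum>\<Phi>\<in>?\<Omega>'. (F' \<Phi>)\<^sup>2)"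
    unfolding \<delta>0_def
  proof (rule sw.resample_bound[OF _ _ _ i j])
    fix \<Phi> \<Phi>' assume "sw.key \<Phi> = sw.key \<Phi>'"
    hence "half_key S c (swap_pairs \<Phi>) = half_key S c (swap_pairs \<Phi>')"
      unfolding sw.key_eq_iff half_key_eq_iff J by (auto simp: swap_pairs_def)
    thus "F' \<Phi> = F' \<Phi>'" unfolding F'_def lower_def by (rule cexp_cong[where K = "half_key S c"])
  next
    fix k l t \<Phi> assume kl: "k \<in> S \<inter> cls c" "l \<in> S \<inter> cls c" "k \<noteq> l" and \<Phi>: "\<Phi> \<in> ?\<Omega>'"
    have "T_inv l k F" using F kl by (simp add: admissible_def cls_def)
    hence "T_inv l k (lower S c F)" by (rule lower_inv) (use kl in auto)
    thus "F' (T k l t \<Phi>) = F' \<Phi>" using in\<Omega>[OF \<Phi>] kl(3) by (simp add: T_inv_def F'_def swap_T)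
  next
    fix \<Phi>0 assume \<Phi>0: "\<Phi>0 \<in> ?\<Omega>'"
    have "(\<Sum>\<Phi>\<in>{\<Phi> \<in> ?\<Omega>'. (\<forall>k\<in>- cls c. fst (\<Phi> k) = fst (\<Phi>0 k)) \<and> (\<forall>k\<in>sw.J. snd (\<Phi> k) = snd (\<Phi>0 k))}. F' \<Phi>)
        = (\<Sum>\<Phi>\<in>?\<Omega>'. if \<forall>k\<in>- cls c. swap_pairs \<Phi> k = swap_pairs \<Phi>0 k then lower S c F (swap_pairs \<Phi>) else 0)"
      unfolding J F'_def
      by (subst sum.inter_filter[symmetric]) (auto simp: swap_pairs_def intro!: sum.cong)
    also have "\<dots> = (\<Sum>\<Phi>\<in>\<Omega>. if \<forall>k\<in>- cls c. \<Phi> k = swap_pairs \<Phi>0 k then lower S c F \<Phi> else 0)"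
      by (rule sum_swap_pairs)
    also have "\<dots> = (\<Sum>\<Phi>\<in>{\<Phi> \<in> \<Omega>. \<forall>k\<in>- cls c. \<Phi> k = swap_pairs \<Phi>0 k}. lower S c F \<Phi>)"
      by (rule sum.inter_filter[symmetric]) simp
    also have "\<dots> = 0" using lower_balanced[OF bal] in\<Omega>[OF \<Phi>0] by (simp add: balanced_def)
    finally show "(\<Sum>\<Phi>\<in>{\<Phi> \<in> ?\<Omega>'. (\<forall>k\<in>- cls c. fst (\<Phi> k) = fst (\<Phi>0 k)) \<and>
        (\<forall>k\<in>sw.J. snd (\<Phi> k) = snd (\<Phi>0 k))}. F' \<Phi>) = 0" .
  qed
  moreover have "param_avg (T i j) F' \<Phi> = param_avg (T j i) (lower S c F) (swap_pairs \<Phi>)" for \<Phi>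
  proof -
    have "i \<noteq> j" using i j by auto
    thus ?thesis
      using sum_UNIV_uminus[of "\<lambda>t. lower S c F (T j i t (swap_pairs \<Phi>))"]
      by (simp add: param_avg_def F'_def swap_T)
  qed
  ultimately have "(\<Sum>\<Phi>\<in>\<Omega>. (param_avg (T j i) (lower S c F) \<Phi>)\<^sup>2) \<le> \<delta>0 * (\<Sum>\<Phi>\<in>\<Omega>. (lower S c F \<Phi>)\<^sup>2)"
    using sum_swap_pairs[of "\<lambda>\<Phi>. (param_avg (T j i) (lower S c F) \<Phi>)\<^sup>2"]
      sum_swap_pairs[of "\<lambda>\<Phi>. (lower S c F \<Phi>)\<^sup>2"]
    by (simp add: F'_def)
  thus ?thesis unfolding contracted_def nrm_def by (simp add: real_sqrt_mult[symmetric])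
qed

lemma nrm_split: "nrm (upper S c F) + nrm (lower S c F) \<le> sqrt 2 * nrm F"
proof -
  have "(\<Sum>\<Phi>\<in>\<Omega>. (F \<Phi>)\<^sup>2) = (\<Sum>\<Phi>\<in>\<Omega>. (upper S c F \<Phi>)\<^sup>2) + (\<Sum>\<Phi>\<in>\<Omega>. (lower S c F \<Phi>)\<^sup>2)"
    unfolding upper_def lower_def by (rule sum_cexp_split) simp
  thus ?thesis unfolding nrm_def by (simp only:) (rule sqrt_add_le; simp add: sum_nonneg)
qed

definition cells :: "'n set \<Rightarrow> 'n set \<Rightarrow> nat \<Rightarrow> bool"
  where "cells S S' c \<longleftrightarrow> cls c \<inter> S \<inter> S' \<noteq> {} \<and> cls c \<inter> S - S' \<noteq> {} \<and> cls c \<inter> S' - S \<noteq> {}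
    \<and> cls c - S - S' \<noteq> {}"

lemma inv_of_admissible:
  assumes "admissible S F" "i \<noteq> j" "i \<in> cls c" "j \<in> cls c" "i \<in> S \<longleftrightarrow> j \<in> S"
  shows "T_inv i j F"
proof (cases "i \<in> S")
  case True
  moreover have "cl i = cl j" using assms(3,4) by (simp add: cls_def)
  ultimately show ?thesis using assms unfolding admissible_def by blast
next
  case False
  have "depends S F" using assms(1) unfolding admissible_def by (rule conjunct1)
  thus ?thesis by (rule inv_of_depends) (use False assms(5) in simp_all)
qed

text \<open>An upper part is contracted by \<open>T i j\<close> with \<open>i\<close> outside and
  \<open>j\<close> inside its support, a lower part by the reverse. Each of the four products thus
  determines which two opposite cells supply the centre. The bounds recombine into a product of sums
  of norms, and \<open>nrm_split\<close> costs \<open>sqrt 2\<close> for each factor, whence the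
  2.\<close>

lemma class_correlation:
  assumes F: "admissible S F" "balanced c F" and G: "admissible S' G" "balanced c G" and "cells S S' c"
  shows "\<bar>\<Sum>\<Phi>\<in>\<Omega>. F \<Phi> * G \<Phi>\<bar> \<le> 2 * (1 / CARD('q) + \<delta>0) * (nrm F * nrm G)"
proof -
  obtain x1 x2 x3 x4 where x: "x1 \<in> cls c \<inter> S \<inter> S'" "x2 \<in> cls c \<inter> S - S'" "x3 \<in> cls c \<inter> S' - S"
    "x4 \<in> cls c - S - S'" using assms(5) unfolding cells_def by blast
  define \<epsilon> where "\<epsilon> = 1 / real CARD('q) + \<delta>0"
  have \<epsilon>: "0 \<le> \<epsilon>" using \<delta>0_nonneg by (simp add: \<epsilon>_def)
  have invF: "T_inv i j H" if "H \<in> {upper S c F, lower S c F}" "i \<noteq> j" "i \<in> cls c" "j \<in> cls c" "i \<in> S \<longleftrightarrow> j \<in> S" for i j H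
  proof -
    have "T_inv i j F" by (rule inv_of_admissible[OF F(1) that(2-5)])
    from lower_inv[OF this that(2-5)] upper_inv[OF this that(2-5)] show ?thesis
      using that(1) by (elim insertE emptyE) simp_all
  qed
  have invG: "T_inv i j H" if "H \<in> {upper S' c G, lower S' c G}" "i \<noteq> j" "i \<in> cls c" "j \<in> cls c" "i \<in> S' \<longleftrightarrow> j \<in> S'" for i j H
  proof -
    have "T_inv i j G" by (rule inv_of_admissible[OF G(1) that(2-5)])
    from lower_inv[OF this that(2-5)] upper_inv[OF this that(2-5)] show ?thesis
      using that(1) by (elim insertE emptyE) simp_all
  qed
  have bound: "\<bar>\<Sum>\<Phi>\<in>\<Omega>. H \<Phi> * K \<Phi>\<bar> \<le> \<epsilon> * (nrm H * nrm K)"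
    if H: "H \<in> {upper S c F, lower S c F}" and K: "K \<in> {upper S' c G, lower S' c G}"
      and d: "distinct [i, j, p, m]" "i \<in> cls c" "j \<in> cls c" "p \<in> cls c" "m \<in> cls c"
      and S: "p \<in> S \<longleftrightarrow> j \<in> S" "i \<in> S \<longleftrightarrow> m \<in> S" "m \<in> S' \<longleftrightarrow> j \<in> S'" "i \<in> S' \<longleftrightarrow> p \<in> S'"
      and g: "contracted \<delta>0 i j H" "contracted \<delta>0 i j K" for H K i j p m
    unfolding \<epsilon>_def
  proof (rule heisenberg_T[OF d(1)])
    show "cl i = c" "cl j = c" "cl p = c" "cl m = c" using d by (auto simp: cls_def)
    show "T_inv p j H" "T_inv i m H" by (rule invF[OF H]; use d S in auto)+
    show "T_inv m j K" "T_inv i p K" by (rule invG[OF K]; use d S in auto)+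
  qed (use g \<delta>0_nonneg in auto)
  have uu: "\<bar>\<Sum>\<Phi>\<in>\<Omega>. upper S c F \<Phi> * upper S' c G \<Phi>\<bar> \<le> \<epsilon> * (nrm (upper S c F) * nrm (upper S' c G))"
  proof -
    have "contracted \<delta>0 x4 x1 (upper S c F)" by (rule upper_contracted[OF F(1)]) (use x in auto)
    moreover have "contracted \<delta>0 x4 x1 (upper S' c G)" by (rule upper_contracted[OF G(1)]) (use x in auto)
    ultimately show ?thesis
      by (rule bound[where p = x2 and m = x3, rotated -2]) (use x in auto)
  qed
  have ll: "\<bar>\<Sum>\<Phi>\<in>\<Omega>. lower S c F \<Phi> * lower S' c G \<Phi>\<bar> \<le> \<epsilon> * (nrm (lower S c F) * nrm (lower S' c G))"
  proof -
    have "contracted \<delta>0 x1 x4 (lower S c F)" by (rule lower_contracted[OF F]) (use x in auto)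
    moreover have "contracted \<delta>0 x1 x4 (lower S' c G)" by (rule lower_contracted[OF G]) (use x in auto)
    ultimately show ?thesis
      by (rule bound[where p = x3 and m = x2, rotated -2]) (use x in auto)
  qed
  have ul: "\<bar>\<Sum>\<Phi>\<in>\<Omega>. upper S c F \<Phi> * lower S' c G \<Phi>\<bar> \<le> \<epsilon> * (nrm (upper S c F) * nrm (lower S' c G))"
  proof -
    have "contracted \<delta>0 x3 x2 (upper S c F)" by (rule upper_contracted[OF F(1)]) (use x in auto)
    moreover have "contracted \<delta>0 x3 x2 (lower S' c G)" by (rule lower_contracted[OF G]) (use x in auto)
    ultimately show ?thesis
      by (rule bound[where p = x1 and m = x4, rotated -2]) (use x in auto)
  qed
  have lu: "\<bar>\<Sum>\<Phi>\<in>\<Omega>. lower S c F \<Phi> * upper S' c G \<Phi>\<bar> \<le> \<epsilon> * (nrm (lower S c F) * nrm (upper S' c G))"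
  proof -
    have "contracted \<delta>0 x2 x3 (lower S c F)" by (rule lower_contracted[OF F]) (use x in auto)
    moreover have "contracted \<delta>0 x2 x3 (upper S' c G)" by (rule upper_contracted[OF G(1)]) (use x in auto)
    ultimately show ?thesis
      by (rule bound[where p = x4 and m = x1, rotated -2]) (use x in auto)
  qed
  have "(\<Sum>\<Phi>\<in>\<Omega>. F \<Phi> * G \<Phi>) = (\<Sum>\<Phi>\<in>\<Omega>. upper S c F \<Phi> * upper S' c G \<Phi>) + (\<Sum>\<Phi>\<in>\<Omega>. lower S c F \<Phi> * lower S' c G \<Phi>)
      + (\<Sum>\<Phi>\<in>\<Omega>. upper S c F \<Phi> * lower S' c G \<Phi>) + (\<Sum>\<Phi>\<in>\<Omega>. lower S c F \<Phi> * upper S' c G \<Phi>)"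
    unfolding sum.distrib[symmetric] by (rule sum.cong[OF refl]) (simp add: upper_def algebra_simps)
  hence "\<bar>\<Sum>\<Phi>\<in>\<Omega>. F \<Phi> * G \<Phi>\<bar> \<le> \<epsilon> * (nrm (upper S c F) * nrm (upper S' c G)) + \<epsilon> * (nrm (lower S c F) * nrm (lower S' c G))
      + \<epsilon> * (nrm (upper S c F) * nrm (lower S' c G)) + \<epsilon> * (nrm (lower S c F) * nrm (upper S' c G))"
    using uu ll ul lu by linarith
  also have "\<dots> = \<epsilon> * ((nrm (upper S c F) + nrm (lower S c F)) * (nrm (upper S' c G) + nrm (lower S' c G)))"
    by (simp add: algebra_simps)
  also have "\<dots> \<le> \<epsilon> * ((sqrt 2 * nrm F) * (sqrt 2 * nrm G))"
    by (intro mult_left_mono mult_mono nrm_split \<epsilon>) (simp_all add: nrm_nonneg)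
  also have "\<dots> = (sqrt 2 * sqrt 2) * \<epsilon> * (nrm F * nrm G)" by (simp only: ac_simps)
  finally show ?thesis by (simp add: \<epsilon>_def)
qed

section \<open>Conditioning on one class after another\<close>

definition class_avg :: "nat set \<Rightarrow> (('q, 'n) pairs \<Rightarrow> real) \<Rightarrow> ('q, 'n) pairs \<Rightarrow> real"
  where "class_avg C F \<Phi> = (\<Sum>\<Psi>\<in>\<Omega>. F (mix (cl -` C) \<Psi> \<Phi>)) / card \<Omega>"

text \<open>Exchanging the classes in \<open>C\<close> between two elements is an involution of
  \<open>\<Omega> \<times> \<Omega>\<close>. It makes \<open>class_avg\<close> behave as the
  conditional expectation given the remaining classes: self-adjoint, and composing by union.\<close>

lemma sum_swap_mix:
  "(\<Sum>\<Phi>\<in>\<Omega>. \<Sum>\<Psi>\<in>\<Omega>. h (mix (cl -` C) \<Psi> \<Phi>) (mix (cl -` C) \<Phi> \<Psi>)) = (\<Sum>\<Phi>\<in>\<Omega>. \<Sum>\<Psi>\<in>\<Omega>. h \<Phi> \<Psi> :: real)"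
proof -
  let ?f = "\<lambda>(\<Phi>, \<Psi>). (mix (cl -` C) \<Psi> \<Phi>, mix (cl -` C) \<Phi> \<Psi>)"
  have "bij_betw ?f (\<Omega> \<times> \<Omega>) (\<Omega> \<times> \<Omega>)"
  proof (rule bij_betw_byWitness[where f' = ?f])
    show "\<forall>a\<in>\<Omega> \<times> \<Omega>. ?f (?f a) = a" "\<forall>a\<in>\<Omega> \<times> \<Omega>. ?f (?f a) = a"
      by (auto simp: mix_def fun_eq_iff)
    show "?f ` (\<Omega> \<times> \<Omega>) \<subseteq> \<Omega> \<times> \<Omega>" "?f ` (\<Omega> \<times> \<Omega>) \<subseteq> \<Omega> \<times> \<Omega>"
      using mix_\<Omega> by auto
  qed
  from sum.reindex_bij_betw[OF this, of "\<lambda>p. h (fst p) (snd p)"]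
  show ?thesis by (simp add: sum.cartesian_product case_prod_unfold)
qed

lemma class_avg_adjoint: "(\<Sum>\<Phi>\<in>\<Omega>. class_avg C F \<Phi> * G \<Phi>) = (\<Sum>\<Phi>\<in>\<Omega>. F \<Phi> * class_avg C G \<Phi>)"
proof -
  have "(\<Sum>\<Phi>\<in>\<Omega>. class_avg C F \<Phi> * G \<Phi>) = (\<Sum>\<Phi>\<in>\<Omega>. \<Sum>\<Psi>\<in>\<Omega>. F (mix (cl -` C) \<Psi> \<Phi>) * G \<Phi>) / card \<Omega>"
    by (simp add: class_avg_def sum_distrib_right sum_divide_distrib)
  also have "(\<Sum>\<Phi>\<in>\<Omega>. \<Sum>\<Psi>\<in>\<Omega>. F (mix (cl -` C) \<Psi> \<Phi>) * G \<Phi>)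
      = (\<Sum>\<Phi>\<in>\<Omega>. \<Sum>\<Psi>\<in>\<Omega>. F (mix (cl -` C) (mix (cl -` C) \<Phi> \<Psi>) (mix (cl -` C) \<Psi> \<Phi>)) * G (mix (cl -` C) \<Psi> \<Phi>))"
    by (rule sum_swap_mix[of "\<lambda>\<Phi> \<Psi>. F (mix (cl -` C) \<Psi> \<Phi>) * G \<Phi>" C, symmetric])
  also have "\<dots> = (\<Sum>\<Phi>\<in>\<Omega>. \<Sum>\<Psi>\<in>\<Omega>. F \<Phi> * G (mix (cl -` C) \<Psi> \<Phi>))"
  proof -
    have "mix (cl -` C) (mix (cl -` C) \<Phi> \<Psi>) (mix (cl -` C) \<Psi> \<Phi>) = \<Phi>" for \<Phi> \<Psi> :: "('q, 'n) pairs"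
      by (simp add: mix_def fun_eq_iff)
    thus ?thesis by simp
  qed
  finally show ?thesis by (simp add: class_avg_def sum_distrib_left sum_divide_distrib)
qed

lemma class_avg_class_avg: "\<Phi> \<in> \<Omega> \<Longrightarrow> class_avg C (class_avg D F) \<Phi> = class_avg (C \<union> D) F \<Phi>"
proof -
  assume \<Phi>: "\<Phi> \<in> \<Omega>"
  have n: "card \<Omega> > 0" using \<Phi> by (auto simp: card_gt_0_iff)
  have "class_avg C (class_avg D F) \<Phi> = (\<Sum>\<Psi>\<in>\<Omega>. \<Sum>\<Theta>\<in>\<Omega>. F (mix (cl -` D) \<Theta> (mix (cl -` C) \<Psi> \<Phi>))) / (real (card \<Omega>))\<^sup>2"
    by (simp add: class_avg_def power2_eq_square sum_divide_distrib)
  also have "(\<Sum>\<Psi>\<in>\<Omega>. \<Sum>\<Theta>\<in>\<Omega>. F (mix (cl -` D) \<Theta> (mix (cl -` C) \<Psi> \<Phi>)))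
      = (\<Sum>\<Psi>\<in>\<Omega>. \<Sum>\<Theta>\<in>\<Omega>. F (mix (cl -` (C \<union> D)) (mix (cl -` D) \<Theta> \<Psi>) \<Phi>))"
  proof (intro sum.cong refl)
    fix \<Psi> \<Theta> :: "('q, 'n) pairs"
    have "mix (cl -` D) \<Theta> (mix (cl -` C) \<Psi> \<Phi>) = mix (cl -` (C \<union> D)) (mix (cl -` D) \<Theta> \<Psi>) \<Phi>"
      by (simp add: mix_def fun_eq_iff)
    thus "F (mix (cl -` D) \<Theta> (mix (cl -` C) \<Psi> \<Phi>)) = F (mix (cl -` (C \<union> D)) (mix (cl -` D) \<Theta> \<Psi>) \<Phi>)" by simp
  qed
  also have "\<dots> = (\<Sum>\<Psi>\<in>\<Omega>. \<Sum>\<Theta>\<in>\<Omega>. F (mix (cl -` (C \<union> D)) \<Psi> \<Phi>))"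
    by (rule sum_swap_mix[of "\<lambda>\<Psi> \<Theta>. F (mix (cl -` (C \<union> D)) \<Psi> \<Phi>)" D])
  finally show ?thesis using n by (simp add: class_avg_def power2_eq_square flip: sum_distrib_left)
qed

lemma class_avg_admissible:
  assumes F: "admissible S F"
  shows "admissible S (class_avg C F)"
proof -
  have "depends S (class_avg C F)"
    unfolding depends_def
  proof (intro allI impI)
    fix \<Phi> \<Phi>' :: "('q, 'n) pairs" assume eq: "\<forall>k\<in>S. \<Phi> k = \<Phi>' k"
    have "F (mix (cl -` C) \<Psi> \<Phi>) = F (mix (cl -` C) \<Psi> \<Phi>')" for \<Psi>
    proof -
      have "\<forall>k\<in>S. mix (cl -` C) \<Psi> \<Phi> k = mix (cl -` C) \<Psi> \<Phi>' k" using eq by (simp add: mix_def)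
      thus ?thesis using F unfolding admissible_def depends_def by blast
    qed
    thus "class_avg C F \<Phi> = class_avg C F \<Phi>'" by (simp add: class_avg_def)
  qed
  moreover have "T_inv i j (class_avg C F)" if ij: "i \<in> S" "j \<in> S" "i \<noteq> j" "cl i = cl j" for i j
    unfolding T_inv_def
  proof (intro allI ballI)
    fix t \<Phi> assume \<Phi>: "\<Phi> \<in> \<Omega>"
    have "F (mix (cl -` C) \<Psi> (T i j t \<Phi>)) = F (mix (cl -` C) \<Psi> \<Phi>)" if \<Psi>: "\<Psi> \<in> \<Omega>" for \<Psi>
    proof (cases "cl i \<in> C")
      case True
      hence "mix (cl -` C) \<Psi> (T i j t \<Phi>) = mix (cl -` C) \<Psi> \<Phi>"
        using ij by (intro ext) (simp add: mix_def T_def)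
      thus ?thesis by simp
    next
      case False
      hence "mix (cl -` C) \<Psi> (T i j t \<Phi>) = T i j t (mix (cl -` C) \<Psi> \<Phi>)"
        using ij by (intro ext) (simp add: mix_def T_def)
      moreover have "T_inv i j F" using F ij unfolding admissible_def by blast
      ultimately show ?thesis using mix_\<Omega>[OF \<Psi> \<Phi>, of C] by (simp add: T_inv_def)
    qed
    thus "class_avg C F (T i j t \<Phi>) = class_avg C F \<Phi>" by (simp add: class_avg_def)
  qed
  ultimately show ?thesis unfolding admissible_def by blast
qed

lemma admissible_diff: "admissible S F \<Longrightarrow> admissible S G \<Longrightarrow> admissible S (\<lambda>\<Phi>. F \<Phi> - G \<Phi>)"
proof -
  assume FG: "admissible S F" "admissible S G"
  have "depends S (\<lambda>\<Phi>. F \<Phi> - G \<Phi>)"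
    unfolding depends_def
  proof (intro allI impI)
    fix \<Phi> \<Phi>' :: "('q, 'n) pairs" assume "\<forall>k\<in>S. \<Phi> k = \<Phi>' k"
    hence "F \<Phi> = F \<Phi>'" "G \<Phi> = G \<Phi>'" using FG unfolding admissible_def depends_def by blast+
    thus "F \<Phi> - G \<Phi> = F \<Phi>' - G \<Phi>'" by simp
  qed
  thus ?thesis using FG by (simp add: admissible_def T_inv_def)
qed

text \<open>When the class part of \<open>\<Phi>0\<close> is redrawn from a random element, every
  completion in \<open>\<Omega>\<close> is reached equally often: by \<open>mix_\<Omega>\<close> the
  number of elements with a given class part is constant.\<close>

lemma balanced_of_class_avg:
  assumes "\<And>\<Phi>. \<Phi> \<in> \<Omega> \<Longrightarrow> class_avg {c} F \<Phi> = 0"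
  shows "balanced c F"
  unfolding balanced_def
proof
  fix \<Phi>0 assume \<Phi>0: "\<Phi>0 \<in> \<Omega>"
  have K: "cl -` {c} = cls c" by (auto simp: cls_def)
  let ?B = "{\<Phi> \<in> \<Omega>. \<forall>k\<in>- cls c. \<Phi> k = \<Phi>0 k}"
  define N where "N \<Phi> = {\<Psi> \<in> \<Omega>. \<forall>k\<in>cls c. \<Psi> k = \<Phi> k}" for \<Phi> :: "('q, 'n) pairs"
  have N_le: "card (N \<Phi>) \<le> card (N \<Phi>')" if "\<Phi> \<in> \<Omega>" "\<Phi>' \<in> \<Omega>" for \<Phi> \<Phi>'
  proof (rule card_inj_on_le[of "mix (cls c) \<Phi>'"])
    show "inj_on (mix (cls c) \<Phi>') (N \<Phi>)"
    proof (rule inj_onI, rule ext)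
      fix \<Psi> \<Theta> k assume *: "\<Psi> \<in> N \<Phi>" "\<Theta> \<in> N \<Phi>" "mix (cls c) \<Phi>' \<Psi> = mix (cls c) \<Phi>' \<Theta>"
      have "mix (cls c) \<Phi>' \<Psi> k = mix (cls c) \<Phi>' \<Theta> k" using *(3) by simp
      thus "\<Psi> k = \<Theta> k" using *(1,2) by (cases "k \<in> cls c") (simp_all add: mix_def N_def)
    qed
    have "mix (cls c) \<Phi>' \<Psi> \<in> N \<Phi>'" if "\<Psi> \<in> N \<Phi>" for \<Psi>
      using mix_\<Omega>[OF \<open>\<Phi>' \<in> \<Omega>\<close>, of \<Psi> "{c}"] that unfolding K by (simp add: N_def mix_def)
    thus "mix (cls c) \<Phi>' ` N \<Phi> \<subseteq> N \<Phi>'" by blast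
  qed simp
  have N: "card (N \<Phi>) = card (N \<Phi>0)" if "\<Phi> \<in> \<Omega>" for \<Phi>
    using N_le[OF that \<Phi>0] N_le[OF \<Phi>0 that] by simp
  have N0: "card (N \<Phi>0) > 0" using \<Phi>0 by (auto simp: N_def card_gt_0_iff)
  have "(\<Sum>\<Psi>\<in>\<Omega>. F (mix (cls c) \<Psi> \<Phi>0)) = (\<Sum>\<Phi>\<in>?B. \<Sum>\<Psi>\<in>{\<Psi> \<in> \<Omega>. mix (cls c) \<Psi> \<Phi>0 = \<Phi>}. F (mix (cls c) \<Psi> \<Phi>0))"
  proof (rule sum.group[symmetric])
    have "mix (cls c) \<Psi> \<Phi>0 \<in> ?B" if "\<Psi> \<in> \<Omega>" for \<Psi>
      using mix_\<Omega>[OF that \<Phi>0, of "{c}"] unfolding K by (simp add: mix_def)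
    thus "(\<lambda>\<Psi>. mix (cls c) \<Psi> \<Phi>0) ` \<Omega> \<subseteq> ?B" by blast
  qed simp_all
  also have "\<dots> = (\<Sum>\<Phi>\<in>?B. card (N \<Phi>0) * F \<Phi>)"
  proof (rule sum.cong[OF refl])
    fix \<Phi> assume \<Phi>: "\<Phi> \<in> ?B"
    have "{\<Psi> \<in> \<Omega>. mix (cls c) \<Psi> \<Phi>0 = \<Phi>} = N \<Phi>"
      unfolding N_def fun_eq_iff using \<Phi> by (auto simp: mix_def)
    hence "(\<Sum>\<Psi>\<in>{\<Psi> \<in> \<Omega>. mix (cls c) \<Psi> \<Phi>0 = \<Phi>}. F (mix (cls c) \<Psi> \<Phi>0)) = card (N \<Phi>) * F \<Phi>"
    proof -
      have "(\<Sum>\<Psi>\<in>{\<Psi> \<in> \<Omega>. mix (cls c) \<Psi> \<Phi>0 = \<Phi>}. F (mix (cls c) \<Psi> \<Phi>0))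
          = (\<Sum>\<Psi>\<in>{\<Psi> \<in> \<Omega>. mix (cls c) \<Psi> \<Phi>0 = \<Phi>}. F \<Phi>)"
        by (rule sum.cong[OF refl]) simp
      thus ?thesis using \<open>{\<Psi> \<in> \<Omega>. mix (cls c) \<Psi> \<Phi>0 = \<Phi>} = N \<Phi>\<close> by simp
    qed
    thus "(\<Sum>\<Psi>\<in>{\<Psi> \<in> \<Omega>. mix (cls c) \<Psi> \<Phi>0 = \<Phi>}. F (mix (cls c) \<Psi> \<Phi>0)) = card (N \<Phi>0) * F \<Phi>"
      using N \<Phi> by simp
  qed
  finally have "card (N \<Phi>0) * (\<Sum>\<Phi>\<in>?B. F \<Phi>) = (\<Sum>\<Psi>\<in>\<Omega>. F (mix (cls c) \<Psi> \<Phi>0))"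
    by (simp add: sum_distrib_left)
  also have "\<dots> = 0"
  proof -
    have "real (card \<Omega>) \<noteq> 0" using \<Phi>0 by auto
    moreover have "(\<Sum>\<Psi>\<in>\<Omega>. F (mix (cls c) \<Psi> \<Phi>0)) / real (card \<Omega>) = 0"
      using assms[OF \<Phi>0] unfolding class_avg_def K .
    ultimately show ?thesis by (simp only: divide_eq_0_iff) simp
  qed
  finally show "(\<Sum>\<Phi>\<in>?B. F \<Phi>) = 0" using N0 by (auto simp: card_gt_0_iff)
qed

text \<open>\<open>F\<close> and \<open>G\<close> are split orthogonally into
  \<open>class_avg C\<close> and the rest. The rest is killed by \<open>class_avg C\<close> and
  falls under the induction hypothesis; the averages are balanced in the new class \<open>c\<close>.
  Cauchy-Schwarz over the two parts keeps the constant from growing with the number of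
  classes.\<close>

lemma classes_correlation:
  assumes "finite C" "\<And>c. c \<in> C \<Longrightarrow> cells S S' c"
    and "admissible S F" "admissible S' G"
    and "\<And>\<Phi>. \<Phi> \<in> \<Omega> \<Longrightarrow> class_avg C F \<Phi> = 0" "\<And>\<Phi>. \<Phi> \<in> \<Omega> \<Longrightarrow> class_avg C G \<Phi> = 0"
  shows "\<bar>\<Sum>\<Phi>\<in>\<Omega>. F \<Phi> * G \<Phi>\<bar> \<le> 2 * (1 / CARD('q) + \<delta>0) * (nrm F * nrm G)"
  using assms
proof (induction C arbitrary: F G rule: finite_induct)
  case empty
  have "F \<Phi> = 0" if \<Phi>: "\<Phi> \<in> \<Omega>" for \<Phi>
  proof -
    have "card \<Omega> > 0" using \<Phi> by (auto simp: card_gt_0_iff)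
    moreover have "mix {} \<Psi> \<Phi> = \<Phi>" for \<Psi> by (simp add: mix_def fun_eq_iff)
    ultimately have "class_avg {} F \<Phi> = F \<Phi>" by (auto simp: class_avg_def card_gt_0_iff)
    thus ?thesis using empty.prems(4)[OF \<Phi>] by simp
  qed
  hence "(\<Sum>\<Phi>\<in>\<Omega>. F \<Phi> * G \<Phi>) = 0" by (intro sum.neutral) simp
  thus ?case using \<delta>0_nonneg nrm_nonneg by simp
next
  case (insert c C)
  define \<epsilon> where "\<epsilon> = 2 * (1 / real CARD('q) + \<delta>0)"
  have \<epsilon>: "0 \<le> \<epsilon>" using \<delta>0_nonneg by (simp add: \<epsilon>_def)
  let ?F1 = "\<lambda>\<Phi>. F \<Phi> - class_avg C F \<Phi>" and ?G1 = "\<lambda>\<Phi>. G \<Phi> - class_avg C G \<Phi>"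
  have class_avg_diff: "class_avg C (\<lambda>\<Phi>. H \<Phi> - class_avg C H \<Phi>) \<Phi> = 0" if "\<Phi> \<in> \<Omega>" for H \<Phi>
  proof -
    have "class_avg C (\<lambda>\<Phi>. H \<Phi> - class_avg C H \<Phi>) \<Phi> = class_avg C H \<Phi> - class_avg C (class_avg C H) \<Phi>"
      by (simp add: class_avg_def[of C "\<lambda>\<Phi>. H \<Phi> - class_avg C H \<Phi>"] class_avg_def[of C H \<Phi>] class_avg_def[of C "class_avg C H" \<Phi>]
        sum_subtractf diff_divide_distrib)
    thus ?thesis using class_avg_class_avg[OF that, of C C H] by simp
  qed
  have 1: "\<bar>\<Sum>\<Phi>\<in>\<Omega>. ?F1 \<Phi> * ?G1 \<Phi>\<bar> \<le> \<epsilon> * (nrm ?F1 * nrm ?G1)"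
    unfolding \<epsilon>_def
    by (rule insert.IH) (use insert.prems class_avg_diff in \<open>auto intro: admissible_diff class_avg_admissible\<close>)
  have bal: "balanced c (class_avg C H)" if "\<And>\<Phi>. \<Phi> \<in> \<Omega> \<Longrightarrow> class_avg (insert c C) H \<Phi> = 0" for H
    by (rule balanced_of_class_avg) (simp add: class_avg_class_avg that)
  have 2: "\<bar>\<Sum>\<Phi>\<in>\<Omega>. class_avg C F \<Phi> * class_avg C G \<Phi>\<bar> \<le> \<epsilon> * (nrm (class_avg C F) * nrm (class_avg C G))"
    unfolding \<epsilon>_def
    by (rule class_correlation) (use insert.prems bal in \<open>auto intro: class_avg_admissible\<close>)
  have split: "(\<Sum>\<Phi>\<in>\<Omega>. H \<Phi> * K \<Phi>)
      = (\<Sum>\<Phi>\<in>\<Omega>. (H \<Phi> - class_avg C H \<Phi>) * (K \<Phi> - class_avg C K \<Phi>)) + (\<Sum>\<Phi>\<in>\<Omega>. class_avg C H \<Phi> * class_avg C K \<Phi>)" for H K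
  proof -
    have idem: "(\<Sum>\<Phi>\<in>\<Omega>. class_avg C (class_avg C H) \<Phi> * K \<Phi>) = (\<Sum>\<Phi>\<in>\<Omega>. class_avg C H \<Phi> * K \<Phi>)" for H K
      by (rule sum.cong[OF refl]) (simp add: class_avg_class_avg)
    have a: "(\<Sum>\<Phi>\<in>\<Omega>. class_avg C H \<Phi> * class_avg C K \<Phi>) = (\<Sum>\<Phi>\<in>\<Omega>. class_avg C H \<Phi> * K \<Phi>)"
      using class_avg_adjoint[of C "class_avg C H" K] idem[of H K] by simp
    have b: "(\<Sum>\<Phi>\<in>\<Omega>. H \<Phi> * class_avg C K \<Phi>) = (\<Sum>\<Phi>\<in>\<Omega>. class_avg C H \<Phi> * K \<Phi>)"
      by (rule class_avg_adjoint[symmetric])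
    have "(\<Sum>\<Phi>\<in>\<Omega>. (H \<Phi> - class_avg C H \<Phi>) * (K \<Phi> - class_avg C K \<Phi>)) = (\<Sum>\<Phi>\<in>\<Omega>. H \<Phi> * K \<Phi>) - (\<Sum>\<Phi>\<in>\<Omega>. H \<Phi> * class_avg C K \<Phi>)
        - (\<Sum>\<Phi>\<in>\<Omega>. class_avg C H \<Phi> * K \<Phi>) + (\<Sum>\<Phi>\<in>\<Omega>. class_avg C H \<Phi> * class_avg C K \<Phi>)"
      unfolding sum.distrib[symmetric] sum_subtractf[symmetric]
      by (rule sum.cong[OF refl]) (simp add: algebra_simps)
    thus ?thesis using a b by linarith
  qed
  have norm_split: "nrm H = sqrt ((nrm (\<lambda>\<Phi>. H \<Phi> - class_avg C H \<Phi>))\<^sup>2 + (nrm (class_avg C H))\<^sup>2)" for H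
    using split[of H H] by (simp add: nrm_def power2_eq_square sum_nonneg)
  have "\<bar>\<Sum>\<Phi>\<in>\<Omega>. F \<Phi> * G \<Phi>\<bar> \<le> \<epsilon> * (nrm ?F1 * nrm ?G1) + \<epsilon> * (nrm (class_avg C F) * nrm (class_avg C G))"
    using split[of F G] 1 2 by linarith
  also have "\<dots> = \<epsilon> * (nrm ?F1 * nrm ?G1 + nrm (class_avg C F) * nrm (class_avg C G))" by (simp add: distrib_left)
  also have "nrm ?F1 * nrm ?G1 + nrm (class_avg C F) * nrm (class_avg C G) \<le> nrm F * nrm G"
    unfolding norm_split[of F] norm_split[of G]
    using Cauchy_Schwarz_two[of "(nrm ?F1)\<^sup>2" "(nrm ?G1)\<^sup>2" "(nrm (class_avg C F))\<^sup>2" "(nrm (class_avg C G))\<^sup>2"]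
    by (simp add: nrm_nonneg)
  finally show ?case using \<epsilon> by (simp add: \<epsilon>_def mult_left_mono)
qed

text \<open>Averaging over all classes at once is taking the mean.\<close>

theorem correlation:
  assumes "\<And>c. c \<in> range cl \<Longrightarrow> cells S S' c" "admissible S F" "admissible S' G"
    and "(\<Sum>\<Phi>\<in>\<Omega>. F \<Phi>) = 0" "(\<Sum>\<Phi>\<in>\<Omega>. G \<Phi>) = 0"
  shows "\<bar>\<Sum>\<Phi>\<in>\<Omega>. F \<Phi> * G \<Phi>\<bar> \<le> 2 * (1 / CARD('q) + \<delta>0) * (nrm F * nrm G)"
proof (rule classes_correlation[where C = "range cl"])
  have "mix (cl -` range cl) \<Psi> \<Phi> = \<Psi>" for \<Phi> \<Psi> :: "('q, 'n) pairs"
    by (simp add: mix_def fun_eq_iff)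
  thus "class_avg (range cl) F \<Phi> = 0" "class_avg (range cl) G \<Phi> = 0" for \<Phi> using assms by (simp_all add: class_avg_def)
qed (use assms in auto)

end

section \<open>Faces of the Hadamard complex\<close>

lemma extend_to_frame:
  fixes e :: "'n::finite \<Rightarrow> 'q::field ^ 'n"
  assumes "inj_on e P" "vec.independent (e ` P)"
  obtains e' where "frame e'" "\<And>k. k \<in> P \<Longrightarrow> e' k = e k"
proof -
  define B where "B = vec.extend_basis (e ` P)"
  have B: "e ` P \<subseteq> B" "vec.independent B" "vec.span B = UNIV"
    using vec.extend_basis_superset[OF assms(2)] vec.independent_extend_basis[OF assms(2)]
      vec.span_extend_basis[OF assms(2)] by (simp_all add: B_def)
  have finB: "finite B" using B(2) by (rule vec.finiteI_independent)
  have "card B = CARD('n)"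
    using vec.dim_span_eq_card_independent[OF B(2)] B(3) by (simp add: card_cart_basis vec.dim_UNIV vec.dimension_def)
  hence "card (B - e ` P) = card (- P)"
    using card_Diff_subset[of "e ` P" B] B(1) card_image[OF assms(1)]
    by (simp add: card_Diff_subset Compl_eq_Diff_UNIV)
  then obtain g where g: "bij_betw g (- P) (B - e ` P)"
    using finite_same_card_bij[of "- P" "B - e ` P"] finB by auto
  define e' where "e' k = (if k \<in> P then e k else g k)" for k
  have "B \<subseteq> range e'"
  proof
    fix b assume "b \<in> B"
    thus "b \<in> range e'"
    proof (cases "b \<in> e ` P")
      case True
      then obtain k where "k \<in> P" "b = e k" by blast
      thus ?thesis by (intro image_eqI[of _ _ k]) (simp_all add: e'_def)
    next
      case False
      hence "b \<in> g ` (- P)" using \<open>b \<in> B\<close> bij_betw_imp_surj_on[OF g] by blast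
      then obtain k where "k \<in> - P" "b = g k" by blast
      thus ?thesis by (intro image_eqI[of _ _ k]) (simp_all add: e'_def)
    qed
  qed
  hence span: "vec.span (range e') = UNIV" using vec.span_mono[of B "range e'"] B(3) by blast
  have "frame e'"
  proof (rule frame_of_trivial_annihilator)
    fix z :: "'q ^ 'n" assume z: "\<And>k. dot z (e' k) = 0"
    have "dot z v = 0" for v
      by (rule dot_span_zero[of "range e'"]) (use z span in auto)
    hence "dot z (axis i 1) = 0" for i by blast
    moreover have "dot z (axis i 1) = z $ i" for i
      by (simp add: dot_def axis_def if_distrib[of "\<lambda>x. _ * x"] cong: if_cong)
    ultimately show "z = 0" by (simp add: Finite_Cartesian_Product.vec_eq_iff)
  qed
  thus ?thesis using that[of e'] by (simp add: e'_def)
qed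

lemma f2_subspaceI:
  assumes "vector_space (f2_scale :: bit \<Rightarrow> 'v::ab_group_add \<Rightarrow> 'v)" "0 \<in> A" "\<And>x y. x \<in> A \<Longrightarrow> y \<in> A \<Longrightarrow> x + y \<in> A"
  shows "f2_subspace (A :: 'v set)"
proof -
  interpret V: vector_space "f2_scale :: bit \<Rightarrow> 'v \<Rightarrow> 'v" by (rule assms)
  show ?thesis by (rule V.subspaceI) (use assms in \<open>auto simp: f2_scale_def\<close>)
qed

text \<open>With \<open>z\<close> and \<open>y\<close> dual vectors of the two frames this is the
  coefficient of one rank-one summand. Being additive, it carries over from generators to their
  span.\<close>

definition bicoeff :: "'q::field ^ 'n \<Rightarrow> 'q ^ 'n \<Rightarrow> 'q ^ 'n ^ 'n \<Rightarrow> 'q"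
  where "bicoeff z y A = dot z (A *v y)"

lemma bicoeff_add: "bicoeff z y (A + B) = bicoeff z y A + bicoeff z y B"
  by (simp add: bicoeff_def matrix_vector_mult_add_rdistrib dot_simps)

lemma bicoeff_0: "bicoeff z y 0 = 0"
  by (simp add: bicoeff_def dot_simps)

lemma bicoeff_sum_outer:
  assumes "finite A" "\<And>l. l \<in> A \<Longrightarrow> dot z (e l) = (if l = k then 1 else 0)"
    "\<And>l. l \<in> A \<Longrightarrow> dot y (f l) = (if l = k then 1 else 0)"
  shows "bicoeff z y (\<Sum>l\<in>A. outer (e l) (f l)) = (if k \<in> A then 1 else 0)"
proof -
  have "bicoeff z y (\<Sum>l\<in>A. outer (e l) (f l)) = (\<Sum>l\<in>A. if l = k then 1 else 0)"
    unfolding bicoeff_def sum_matrix_vec dot_sum_right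
    by (rule sum.cong[OF refl]) (simp add: outer_mult_vec dot_simps dot_commute[of "f _" y] assms)
  thus ?thesis using assms(1) by (simp add: sum.delta)
qed

text \<open>Each nonzero label is used once and label 0 takes all remaining indices. These occur in
  no matrix of a face; they complete its vectors to frames and fill the last cell of class 0. The
  parameter \<open>ty\<close> names the field, which \<open>lab\<close> does not mention.\<close>

locale had_labels =
  fixes lab :: "'n::finite \<Rightarrow> nat" and r :: nat and ty :: "'q::{field,finite} itself"
  assumes char2: "(x :: 'q) + x = 0"
    and lab_less: "lab k < 2 ^ (r + 1)"
    and lab_ex: "v < 2 ^ (r + 1) \<Longrightarrow> \<exists>k. lab k = v"
    and lab_inj: "lab k = lab l \<Longrightarrow> lab k \<noteq> 0 \<Longrightarrow> k = l"
begin

lemma mat_char2: "(A :: 'q ^ 'n ^ 'n) + A = 0"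
  unfolding Finite_Cartesian_Product.vec_eq_iff vector_add_component zero_index char2 by simp

lemma f2_vector_space: "vector_space (f2_scale :: bit \<Rightarrow> 'q ^ 'n ^ 'n \<Rightarrow> 'q ^ 'n ^ 'n)"
  by (rule vector_space_f2_scale) (rule mat_char2)

sublocale V: vector_space "f2_scale :: bit \<Rightarrow> 'q ^ 'n ^ 'n \<Rightarrow> 'q ^ 'n ^ 'n"
  by (rule f2_vector_space)

lemmas subspace_matrixI = f2_subspaceI[OF f2_vector_space]

lemma subspace_bicoeff_eq: "V.subspace {A. bicoeff z y A = bicoeff z' y' A}"
  by (rule subspace_matrixI) (auto simp: bicoeff_add bicoeff_0)

lemma subspace_bicoeff_0: "V.subspace {A. bicoeff z y A = 0}"
  by (rule subspace_matrixI) (auto simp: bicoeff_add bicoeff_0)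

definition ms :: "nat \<Rightarrow> 'n set"
  where "ms j = {k. bit (lab k) j}"

lemma ms_pos: "k \<in> ms j \<Longrightarrow> lab k \<noteq> 0"
  by (rule notI) (simp add: ms_def)

definition m :: "nat \<Rightarrow> ('q, 'n) pairs \<Rightarrow> 'q ^ 'n ^ 'n"
  where "m j \<Phi> = psum (ms j) \<Phi>"

definition LS :: "nat set \<Rightarrow> ('q, 'n) pairs \<Rightarrow> ('q ^ 'n ^ 'n) set"
  where "LS K \<Phi> = V.span ((\<lambda>j. m j \<Phi>) ` K)"

text \<open>The summand with label \<open>2 ^ j\<close> occurs in \<open>m j\<close> and in no other
  \<open>m i\<close>, so its coefficient isolates \<open>m j\<close>.\<close>

lemma ex_bicoeff:
  assumes "\<Phi> \<in> frames" "j < r + 1"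
  shows "\<exists>z y. \<forall>i. bicoeff z y (m i \<Phi>) = (if i = j then 1 else 0)"
proof -
  obtain \<zeta> \<eta> where d: "dual \<zeta> (\<lambda>k. fst (\<Phi> k))" "dual \<eta> (\<lambda>k. snd (\<Phi> k))" by (rule framesE[OF assms(1)])
  have "(2::nat) ^ j < 2 ^ (r + 1)" using assms(2) by (intro power_strict_increasing) auto
  then obtain k where k: "lab k = 2 ^ j" using lab_ex by blast
  have "bicoeff (\<zeta> k) (\<eta> k) (m i \<Phi>) = (if k \<in> ms i then 1 else 0)" for i
    unfolding m_def psum_def by (rule bicoeff_sum_outer) (simp_all add: dualD[OF d(1)] dualD[OF d(2)] eq_commute)
  moreover have "k \<in> ms i \<longleftrightarrow> i = j" for i by (auto simp: ms_def k bit_exp_iff)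
  ultimately have "\<forall>i. bicoeff (\<zeta> k) (\<eta> k) (m i \<Phi>) = (if i = j then 1 else 0)" by simp
  thus ?thesis by blast
qed

lemma m_notin_span:
  assumes "\<Phi> \<in> frames" "j < r + 1" "j \<notin> K"
  shows "m j \<Phi> \<notin> LS K \<Phi>"
proof
  assume *: "m j \<Phi> \<in> LS K \<Phi>"
  obtain z y where c: "\<And>i. bicoeff z y (m i \<Phi>) = (if i = j then 1 else 0)" using ex_bicoeff[OF assms(1,2)] by blast
  have "(\<lambda>j. m j \<Phi>) ` K \<subseteq> {A. bicoeff z y A = 0}" using c assms(3) by auto
  hence "LS K \<Phi> \<subseteq> {A. bicoeff z y A = 0}" unfolding LS_def by (rule V.span_minimal[OF _ subspace_bicoeff_0])
  thus False using * c[of j] by auto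
qed

lemma m_inj:
  assumes "\<Phi> \<in> frames" "K \<subseteq> {..<r + 1}"
  shows "inj_on (\<lambda>j. m j \<Phi>) K"
proof (rule inj_onI, rule ccontr)
  fix i j assume ij: "i \<in> K" "j \<in> K" "m i \<Phi> = m j \<Phi>" "i \<noteq> j"
  have "m j \<Phi> \<notin> LS {i} \<Phi>" using ij assms by (intro m_notin_span) auto
  moreover have "m i \<Phi> \<in> LS {i} \<Phi>" unfolding LS_def by (rule V.span_base) simp
  ultimately show False using ij(3) by simp
qed

lemma m_independent:
  assumes "\<Phi> \<in> frames" "K \<subseteq> {..<r + 1}"
  shows "V.independent ((\<lambda>j. m j \<Phi>) ` K)"
proof
  assume "V.dependent ((\<lambda>j. m j \<Phi>) ` K)"
  then obtain j where j: "j \<in> K" "m j \<Phi> \<in> V.span ((\<lambda>j. m j \<Phi>) ` K - {m j \<Phi>})"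
    unfolding V.dependent_def by blast
  have "V.span ((\<lambda>j. m j \<Phi>) ` K - {m j \<Phi>}) \<subseteq> LS (K - {j}) \<Phi>"
    unfolding LS_def by (rule V.span_mono) blast
  moreover have "m j \<Phi> \<notin> LS (K - {j}) \<Phi>" using j(1) assms by (intro m_notin_span) auto
  ultimately show False using j(2) by blast
qed

lemma dim_LS: "\<Phi> \<in> frames \<Longrightarrow> K \<subseteq> {..<r + 1} \<Longrightarrow> V.dim (LS K \<Phi>) = card K"
  unfolding LS_def using V.dim_span_eq_card_independent[OF m_independent] card_image[OF m_inj] by simp

text \<open>The number whose binary digits form row \<open>k\<close> of the matrix, rows being
  counted from 0; the rows run through the nonzero labels in decreasing order.\<close>

definition row_value :: "nat \<Rightarrow> nat"
  where "row_value k = 2 ^ (r + 1) - (k + 1)"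

lemma had_index:
  assumes "u \<in> carrier_vec (r + 1)" "k < 2 ^ (r + 1) - 1"
  shows "vec_index (had_matrix r *\<^sub>v u) k
    = (\<Sum>j<r + 1. of_bool (bit (row_value k) (r - j)) * vec_index u j)"
  using assms by (auto simp: had_matrix_def scalar_prod_def atLeast0LessThan row_value_def intro!: sum.cong)

lemma had_face_eq:
  "had_face r e f = (\<lambda>u. \<Sum>k\<in>{k. k < 2 ^ (r + 1) - 1 \<and> vec_index (had_matrix r *\<^sub>v u) k = 1}.
    outer (e k) (f k)) ` carrier_vec (r + 1)"
proof -
  have "(\<Sum>k<2 ^ (r + 1) - 1. f2_scale (vec_index (had_matrix r *\<^sub>v u) k) (outer (e k) (f k)))
      = (\<Sum>k\<in>{k. k < 2 ^ (r + 1) - 1 \<and> vec_index (had_matrix r *\<^sub>v u) k = 1}. outer (e k) (f k))" for u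
    by (rule sum.mono_neutral_cong_right) (auto simp: f2_scale_def)
  thus ?thesis unfolding had_face_def by auto
qed

lemma row_value_bij: "bij_betw row_value {..<2 ^ (r + 1) - 1} {1..<2 ^ (r + 1)}"
  by (rule bij_betw_byWitness[where f' = row_value]) (auto simp: row_value_def)

text \<open>The family is shorter than a basis. Indexed by the labels shifted by one, it is
  completed to a frame, and the dual of the frame is restricted to it.\<close>

lemma indep_family_dual:
  assumes "indep_family {..<2 ^ (r + 1) - 1} (e :: nat \<Rightarrow> 'q ^ 'n)"
  obtains \<zeta> where "\<And>k l :: nat. k < 2 ^ (r + 1) - 1 \<Longrightarrow> l < 2 ^ (r + 1) - 1 \<Longrightarrow>
    dot (\<zeta> k) (e l) = (if l = k then 1 else 0)"
proof -
  let ?P = "{k. lab k \<noteq> 0}"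
  have lt: "lab k - 1 \<in> {..<2 ^ (r + 1) - 1}" if "k \<in> ?P" for k using that lab_less[of k] by auto
  have inj: "inj_on e {..<2 ^ (r + 1) - 1}" and ind: "vec.independent (e ` {..<2 ^ (r + 1) - 1})"
    using assms by (simp_all add: indep_family_def)
  have "inj_on (\<lambda>k. e (lab k - 1)) ?P"
  proof (rule inj_onI)
    fix k l assume kl: "k \<in> ?P" "l \<in> ?P" "e (lab k - 1) = e (lab l - 1)"
    hence "lab k - 1 = lab l - 1" using inj_onD[OF inj] lt by blast
    hence "lab k = lab l" using kl by simp
    thus "k = l" using lab_inj kl by blast
  qed
  moreover have "(\<lambda>k. e (lab k - 1)) ` ?P \<subseteq> e ` {..<2 ^ (r + 1) - 1}" using lt by blast
  hence "vec.independent ((\<lambda>k. e (lab k - 1)) ` ?P)" by (rule vec.independent_mono[OF ind])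
  ultimately obtain e' where e': "frame e'" "\<And>k. k \<in> ?P \<Longrightarrow> e' k = e (lab k - 1)"
    using extend_to_frame[of "\<lambda>k. e (lab k - 1)" ?P] by blast
  obtain \<zeta> where \<zeta>: "dual \<zeta> e'" using e'(1) by (auto simp: frame_def)
  have "\<forall>k::nat. \<exists>h. k < 2 ^ (r + 1) - 1 \<longrightarrow> lab h = k + 1" proof
    fix k :: nat show "\<exists>h. k < 2 ^ (r + 1) - 1 \<longrightarrow> lab h = k + 1" using lab_ex[of "k + 1"] by (cases "k + 1 < 2 ^ (r + 1)") auto
  qed
  then obtain h where h: "\<And>k. k < 2 ^ (r + 1) - 1 \<Longrightarrow> lab (h k) = k + 1" by metis
  show ?thesis
  proof (rule that[of "\<lambda>k. \<zeta> (h k)"])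
    fix k l :: nat assume kl: "k < 2 ^ (r + 1) - 1" "l < 2 ^ (r + 1) - 1"
    have "h l \<in> ?P" "lab (h l) - 1 = l" using h[OF kl(2)] by simp_all
    hence el: "e' (h l) = e l" using e'(2) by metis
    have "h k = h l \<longleftrightarrow> l = k" using h[OF kl(1)] h[OF kl(2)] by (metis add_right_cancel)
    thus "dot (\<zeta> (h k)) (e l) = (if l = k then 1 else 0)" unfolding el[symmetric] dualD[OF \<zeta>] by simp
  qed
qed

text \<open>The rows of the Hadamard matrix are all nonzero vectors of F_2^(r+1), so a change of
  basis of the face permutes them. Relabelling the summands by this permutation turns the given
  basis into m 0, ..., m r.\<close>

lemma frame_of_face_basis:
  assumes F: "F \<in> had_faces r" and \<mu>: "\<And>j. j < r + 1 \<Longrightarrow> \<mu> j \<in> F"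
    and \<mu>_inj: "inj_on \<mu> {..<r + 1}" and \<mu>_ind: "V.independent (\<mu> ` {..<r + 1})"
  obtains \<Phi> where "\<Phi> \<in> frames" "\<And>j. j < r + 1 \<Longrightarrow> m j \<Phi> = \<mu> j"
proof -
  let ?N = "2 ^ (r + 1) - 1 :: nat"
  obtain e f where ef: "indep_family {..<?N} e" "indep_family {..<?N} f" "F = had_face r e f"
      and Fs: "V.subspace F" "V.dim F = r + 1"
    using F unfolding had_faces_def by blast
  obtain \<zeta> where \<zeta>: "\<And>k l. k < ?N \<Longrightarrow> l < ?N \<Longrightarrow> dot (\<zeta> k) (e l) = (if l = k then 1 else 0)"
    using indep_family_dual[OF ef(1)] by blast
  obtain \<eta> where \<eta>: "\<And>k l. k < ?N \<Longrightarrow> l < ?N \<Longrightarrow> dot (\<eta> k) (f l) = (if l = k then 1 else 0)"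
    using indep_family_dual[OF ef(2)] by blast
  define A where "A u = {k. k < ?N \<and> vec_index (had_matrix r *\<^sub>v u) k = 1}" for u
  have face: "F = (\<lambda>u. \<Sum>k\<in>A u. outer (e k) (f k)) ` carrier_vec (r + 1)"
    unfolding ef(3) had_face_eq A_def ..
  have cf: "bicoeff (\<zeta> k) (\<eta> k) (\<Sum>l\<in>A u. outer (e l) (f l)) = (if k \<in> A u then 1 else 0)" if "k < ?N" for k u
    by (rule bicoeff_sum_outer) (use that \<zeta> \<eta> in \<open>auto simp: A_def\<close>)
  have span: "F \<subseteq> V.span (\<mu> ` {..<r + 1})"
  proof -
    have "\<mu> ` {..<r + 1} \<subseteq> F" using \<mu> by auto
    then obtain B where B: "\<mu> ` {..<r + 1} \<subseteq> B" "B \<subseteq> F" "V.independent B" "F \<subseteq> V.span B"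
      by (rule V.maximal_independent_subset_extend[OF _ \<mu>_ind])
    have "card B = card (\<mu> ` {..<r + 1})"
      using V.basis_card_eq_dim[OF B(2,4,3)] Fs(2) card_image[OF \<mu>_inj] by simp
    hence "\<mu> ` {..<r + 1} = B" by (intro card_subset_eq B(1)) simp_all
    thus ?thesis using B(4) by simp
  qed
  have "\<forall>j. \<exists>u. j < r + 1 \<longrightarrow> u \<in> carrier_vec (r + 1) \<and> \<mu> j = (\<Sum>k\<in>A u. outer (e k) (f k))"
    using \<mu> face by auto
  then obtain U where U: "\<And>j. j < r + 1 \<Longrightarrow> \<mu> j = (\<Sum>k\<in>A (U j). outer (e k) (f k))" by metis
  \<comment> \<open>The new label of row \<open>k\<close>: bit \<open>j\<close> tells whether
    summand \<open>k\<close> occurs in \<open>\<mu> j\<close>.\<close>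
  define \<nu> :: "nat \<Rightarrow> nat" where "\<nu> k = horner_sum of_bool 2 (map (\<lambda>j. k \<in> A (U j)) [0..<r + 1])" for k
  have bit_\<nu>: "bit (\<nu> k :: nat) j \<longleftrightarrow> j < r + 1 \<and> k \<in> A (U j)" for k j
    unfolding \<nu>_def bit_horner_sum_bit_iff by (auto simp del: upt_Suc)
  have \<nu>_less: "(\<nu> k :: nat) < 2 ^ (r + 1)" for k
    using horner_sum_of_bool_2_less[of "map (\<lambda>j. k \<in> A (U j)) [0..<r + 1]"] by (simp add: \<nu>_def del: upt_Suc)
  have unit: "vec_index (had_matrix r *\<^sub>v unit_vec (r + 1) (r - j)) k = of_bool (bit (row_value k) j)"
    if "k < ?N" "j < r + 1" for k j
  proof -
    have "vec_index (had_matrix r *\<^sub>v unit_vec (r + 1) (r - j)) k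
        = (\<Sum>i<r + 1. if i = r - j then of_bool (bit (row_value k) (r - i)) else 0)"
      unfolding had_index[OF unit_vec_carrier that(1)] by (rule sum.cong[OF refl]) auto
    also have "\<dots> = of_bool (bit (row_value k) j)" proof -
      have "r - (r - j) = j" "r - j \<in> {..<r + 1}" using that(2) by auto
      thus ?thesis by (simp only: sum.delta finite_lessThan if_True)
    qed
    finally show ?thesis .
  qed
  have bits_row_value: "bit (row_value k) j \<longleftrightarrow> k \<in> A (unit_vec (r + 1) (r - j))" if "k < ?N" "j < r + 1" for k j
    using unit[OF that] that(1) by (simp add: A_def)
  have row_value_less: "row_value k < 2 ^ (r + 1)" for k by (simp add: row_value_def)
  have eq_by_bits: "a = b" if "a < 2 ^ (r + 1)" "b < 2 ^ (r + 1)" "\<And>j. j < r + 1 \<Longrightarrow> bit a j \<longleftrightarrow> bit b j"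
    for a b :: nat
  proof (rule bit_eqI)
    fix j
    show "bit a j \<longleftrightarrow> bit b j"
    proof (cases "j < r + 1")
      case False
      have "\<not> bit c j" if "c < 2 ^ (r + 1)" for c :: nat
        using bit_take_bit_iff[of "r + 1" c j] take_bit_nat_eq_self[OF that] False by simp
      thus ?thesis using that(1,2) by blast
    qed (use that(3) in blast)
  qed
  have unit_F: "(\<Sum>k\<in>A (unit_vec (r + 1) i). outer (e k) (f k)) \<in> F" for i
    unfolding face by (rule imageI) simp
  \<comment> \<open>Rows with equal new labels have equal coefficients in every
    \<open>\<mu> j\<close>, hence in all of \<open>F\<close>, in particular in the elements given by
    unit vectors, which read off the bits of the original rows.\<close>
  have \<nu>_inj: "inj_on \<nu> {..<?N}"
  proof (rule inj_onI)
    fix k l assume kl: "k \<in> {..<?N}" "l \<in> {..<?N}" "\<nu> k = \<nu> l"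
    have "\<mu> ` {..<r + 1} \<subseteq> {B. bicoeff (\<zeta> k) (\<eta> k) B = bicoeff (\<zeta> l) (\<eta> l) B}"
    proof (rule image_subsetI)
      fix j assume j: "j \<in> {..<r + 1}"
      have "k \<in> A (U j) \<longleftrightarrow> l \<in> A (U j)" using bit_\<nu>[of k j] bit_\<nu>[of l j] kl(3) j by simp
      thus "\<mu> j \<in> {B. bicoeff (\<zeta> k) (\<eta> k) B = bicoeff (\<zeta> l) (\<eta> l) B}" using kl j by (simp add: U cf)
    qed
    hence "V.span (\<mu> ` {..<r + 1}) \<subseteq> {B. bicoeff (\<zeta> k) (\<eta> k) B = bicoeff (\<zeta> l) (\<eta> l) B}"
      by (rule V.span_minimal[OF _ subspace_bicoeff_eq])
    hence same: "bicoeff (\<zeta> k) (\<eta> k) B = bicoeff (\<zeta> l) (\<eta> l) B" if "B \<in> F" for B using span that by blast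
    have "row_value k = row_value l"
    proof (rule eq_by_bits[OF row_value_less row_value_less])
      fix j assume j: "j < r + 1"
      have "(if k \<in> A (unit_vec (r + 1) (r - j)) then 1 else 0 :: 'q) = (if l \<in> A (unit_vec (r + 1) (r - j)) then 1 else 0)"
        using same[OF unit_F[of "r - j"]] cf[of k] cf[of l] kl by simp
      thus "bit (row_value k) j \<longleftrightarrow> bit (row_value l) j" using bits_row_value[of k j] bits_row_value[of l j] kl j by (simp split: if_splits)
    qed
    thus "k = l" using kl(1,2) bij_betw_imp_inj_on[OF row_value_bij] by (auto dest: inj_onD)
  qed
  have \<nu>_pos: "\<nu> k \<noteq> 0" if k: "k < ?N" for k
  proof
    assume 0: "\<nu> k = 0"
    have "\<mu> ` {..<r + 1} \<subseteq> {B. bicoeff (\<zeta> k) (\<eta> k) B = 0}"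
    proof (rule image_subsetI)
      fix j assume j: "j \<in> {..<r + 1}"
      have "k \<notin> A (U j)" using bit_\<nu>[of k j] 0 j by simp
      thus "\<mu> j \<in> {B. bicoeff (\<zeta> k) (\<eta> k) B = 0}" using k j by (simp add: U cf)
    qed
    hence "V.span (\<mu> ` {..<r + 1}) \<subseteq> {B. bicoeff (\<zeta> k) (\<eta> k) B = 0}"
      by (rule V.span_minimal[OF _ subspace_bicoeff_0])
    hence zero: "bicoeff (\<zeta> k) (\<eta> k) B = 0" if "B \<in> F" for B using span that by blast
    have "row_value k = 0"
    proof (rule eq_by_bits[OF row_value_less])
      fix j assume j: "j < r + 1"
      have "k \<notin> A (unit_vec (r + 1) (r - j))"
        using zero[OF unit_F[of "r - j"]] cf[of k "unit_vec (r + 1) (r - j)"] k by (simp split: if_splits)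
      thus "bit (row_value k) j \<longleftrightarrow> bit (0::nat) j" using bits_row_value[OF k j] by simp
    qed simp
    thus False using k by (simp add: row_value_def)
  qed
  have \<nu>_surj: "\<nu> ` {..<?N} = {1..<2 ^ (r + 1)}"
  proof (rule card_subset_eq)
    show "\<nu> ` {..<?N} \<subseteq> {1..<2 ^ (r + 1)}" using \<nu>_less \<nu>_pos by (auto simp: Suc_le_eq)
    show "card (\<nu> ` {..<?N}) = card {1..<2 ^ (r + 1) :: nat}" using card_image[OF \<nu>_inj] by simp
  qed simp
  define idx where "idx k = inv_into {..<?N} \<nu> (lab k)" for k
  have idx: "idx k < ?N" "\<nu> (idx k) = lab k" if "lab k \<noteq> 0" for k
  proof -
    have "lab k \<in> \<nu> ` {..<?N}" unfolding \<nu>_surj using that lab_less[of k] by simp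
    thus "idx k < ?N" "\<nu> (idx k) = lab k"
      unfolding idx_def using inv_into_into[of "lab k" \<nu> "{..<?N}"] f_inv_into_f[of "lab k" \<nu> "{..<?N}"] by auto
  qed
  let ?P = "{k. lab k \<noteq> 0}"
  have ext: "\<exists>e'. frame e' \<and> (\<forall>k\<in>?P. e' k = g (idx k))" if g: "indep_family {..<?N} g" for g :: "nat \<Rightarrow> 'q ^ 'n"
  proof -
    have gi: "inj_on g {..<?N}" and gd: "vec.independent (g ` {..<?N})"
      using g[unfolded indep_family_def] by blast+
    have mem: "idx k \<in> {..<?N}" if "k \<in> ?P" for k unfolding lessThan_iff by (rule idx(1)) (use that in simp)
    have "inj_on (\<lambda>k. g (idx k)) ?P"
    proof (rule inj_onI)
      fix k l assume kl: "k \<in> ?P" "l \<in> ?P" "g (idx k) = g (idx l)"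
      hence "idx k = idx l" using inj_onD[OF gi kl(3) mem[OF kl(1)] mem[OF kl(2)]] by blast
      moreover have "lab k \<noteq> 0" "lab l \<noteq> 0" using kl by simp_all
      ultimately have "lab k = lab l" using idx(2)[of k] idx(2)[of l] by metis
      thus "k = l" using \<open>lab k \<noteq> 0\<close> by (rule lab_inj)
    qed
    moreover have "vec.independent ((\<lambda>k. g (idx k)) ` ?P)"
      by (rule vec.independent_mono[OF gd]) (use mem in blast)
    ultimately show ?thesis by (rule extend_to_frame) blast
  qed
  obtain e' where e': "frame e'" "\<And>k. k \<in> ?P \<Longrightarrow> e' k = e (idx k)" using ext[OF ef(1)] by blast
  obtain f' where f': "frame f'" "\<And>k. k \<in> ?P \<Longrightarrow> f' k = f (idx k)" using ext[OF ef(2)] by blast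
  show ?thesis
  proof (rule that[of "\<lambda>k. (e' k, f' k)"])
    show "(\<lambda>k. (e' k, f' k)) \<in> frames" using e' f' by (simp add: frames_def)
    fix j assume j: "j < r + 1"
    have bij: "bij_betw idx (ms j) (A (U j))"
      unfolding bij_betw_def
    proof
      show "inj_on idx (ms j)"
      proof (rule inj_onI)
        fix k l assume kl: "k \<in> ms j" "l \<in> ms j" "idx k = idx l"
        hence "lab k = lab l" using idx(2)[OF ms_pos[OF kl(1)]] idx(2)[OF ms_pos[OF kl(2)]] by simp
        thus "k = l" using lab_inj ms_pos kl by blast
      qed
      show "idx ` ms j = A (U j)"
      proof
        show "idx ` ms j \<subseteq> A (U j)"
        proof (rule image_subsetI)
          fix k assume k: "k \<in> ms j"
          hence "bit (\<nu> (idx k)) j" using idx(2)[OF ms_pos[OF k]] by (simp add: ms_def)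
          thus "idx k \<in> A (U j)" by (simp add: bit_\<nu>)
        qed
        show "A (U j) \<subseteq> idx ` ms j"
        proof
          fix k assume k: "k \<in> A (U j)"
          hence kN: "k < ?N" by (simp add: A_def)
          obtain l where l: "lab l = \<nu> k" using lab_ex[OF \<nu>_less] by blast
          have "idx l = k" unfolding idx_def l by (rule inv_into_f_f[OF \<nu>_inj]) (simp only: lessThan_iff kN)
          moreover have "l \<in> ms j" unfolding ms_def mem_Collect_eq l bit_\<nu> using k j by blast
          ultimately show "k \<in> idx ` ms j" by blast
        qed
      qed
    qed
    have "m j (\<lambda>k. (e' k, f' k)) = (\<Sum>k\<in>ms j. outer (e (idx k)) (f (idx k)))"
      unfolding m_def psum_def
    proof (rule sum.cong[OF refl])
      fix k assume "k \<in> ms j"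
      hence "k \<in> ?P" using ms_pos by simp
      thus "outer (fst (e' k, f' k)) (snd (e' k, f' k)) = outer (e (idx k)) (f (idx k))"
        by (simp only: fst_conv snd_conv e'(2) f'(2))
    qed
    also have "\<dots> = \<mu> j" unfolding U[OF j] by (rule sum.reindex_bij_betw[OF bij])
    finally show "m j (\<lambda>k. (e' k, f' k)) = \<mu> j" .
  qed
qed

text \<open>Converse of \<open>frame_of_face_basis\<close>: \<open>h\<close> lists the nonzero
  labels in the order of the rows of the matrix.\<close>

lemma face_of_frame:
  assumes \<Phi>: "\<Phi> \<in> frames"
  shows "LS {..<r + 1} \<Phi> \<in> had_faces r"
proof -
  let ?N = "2 ^ (r + 1) - 1 :: nat"
  have "\<forall>k. \<exists>h. k < ?N \<longrightarrow> lab h = row_value k"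
  proof
    fix k show "\<exists>h. k < ?N \<longrightarrow> lab h = row_value k" using lab_ex[of "row_value k"] by (auto simp: row_value_def)
  qed
  then obtain h where h: "\<And>k. k < ?N \<Longrightarrow> lab (h k) = row_value k" by metis
  have h_inj: "inj_on h {..<?N}"
  proof (rule inj_onI)
    fix k l assume kl: "k \<in> {..<?N}" "l \<in> {..<?N}" "h k = h l"
    hence "row_value k = row_value l" using h[of k] h[of l] by simp
    thus "k = l" using kl bij_betw_imp_inj_on[OF row_value_bij] by (auto dest: inj_onD)
  qed
  have fam: "indep_family {..<?N} (\<lambda>k. g (h k))" if g: "frame g" for g :: "'n \<Rightarrow> 'q ^ 'n"
    unfolding indep_family_def
  proof
    obtain \<zeta> where \<zeta>: "dual \<zeta> g" using g by (auto simp: frame_def)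
    have g_inj: "inj g"
    proof (rule injI, rule ccontr)
      fix k l assume "g k = g l" "k \<noteq> l"
      thus False using dualD[OF \<zeta>, of k k] dualD[OF \<zeta>, of k l] by simp
    qed
    show "inj_on (\<lambda>k. g (h k)) {..<?N}"
      using comp_inj_on[OF h_inj inj_on_subset[OF g_inj]] by (simp add: comp_def)
    have "vec.independent (range g)"
    proof
      assume "vec.dependent (range g)"
      then obtain k where k: "g k \<in> vec.span (range g - {g k})" unfolding vec.dependent_def by blast
      have "range g - {g k} \<subseteq> g ` (- {k})" by auto
      hence "g k \<in> vec.span (g ` (- {k}))" using k vec.span_mono by blast
      thus False using dual_not_in_span[OF \<zeta>, of k "- {k}"] by simp
    qed
    thus "vec.independent ((\<lambda>k. g (h k)) ` {..<?N})" by (rule vec.independent_mono) auto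
  qed
  define e f where "e = (\<lambda>k. fst (\<Phi> (h k)))" and "f = (\<lambda>k. snd (\<Phi> (h k)))"
  have e: "indep_family {..<?N} e" and f: "indep_family {..<?N} f"
    using fam[of "\<lambda>k. fst (\<Phi> k)"] fam[of "\<lambda>k. snd (\<Phi> k)"] \<Phi> by (simp_all add: e_def f_def frames_def)
  have m_eq: "m j \<Phi> = (\<Sum>k<?N. f2_scale (of_bool (bit (row_value k) j)) (outer (e k) (f k)))" for j
  proof -
    have bij: "bij_betw h {k. k < ?N \<and> bit (row_value k) j} (ms j)"
      unfolding bij_betw_def
    proof
      show "inj_on h {k. k < ?N \<and> bit (row_value k) j}" by (rule inj_on_subset[OF h_inj]) auto
      show "h ` {k. k < ?N \<and> bit (row_value k) j} = ms j"
      proof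
        show "h ` {k. k < ?N \<and> bit (row_value k) j} \<subseteq> ms j" using h by (auto simp: ms_def)
        show "ms j \<subseteq> h ` {k. k < ?N \<and> bit (row_value k) j}"
        proof
          fix l assume l: "l \<in> ms j"
          hence "lab l \<noteq> 0" by (rule ms_pos)
          hence "lab l \<in> {1..<2 ^ (r + 1)}" using lab_less[of l] by simp
          then obtain k where k: "k < ?N" "lab l = row_value k"
            using bij_betw_imp_surj_on[OF row_value_bij] by (metis imageE lessThan_iff)
          hence "h k = l" using h[OF k(1)] lab_inj[of "h k" l] \<open>lab l \<noteq> 0\<close> by simp
          thus "l \<in> h ` {k. k < ?N \<and> bit (row_value k) j}" using k l by (auto simp: ms_def)
        qed
      qed
    qed
    have "m j \<Phi> = (\<Sum>k\<in>{k. k < ?N \<and> bit (row_value k) j}. outer (e k) (f k))"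
      unfolding m_def psum_def e_def f_def by (rule sum.reindex_bij_betw[OF bij, symmetric])
    also have "\<dots> = (\<Sum>k<?N. f2_scale (of_bool (bit (row_value k) j)) (outer (e k) (f k)))"
      by (rule sum.mono_neutral_cong_left) (auto simp: f2_scale_def)
    finally show ?thesis .
  qed
  \<comment> \<open>Column \<open>j\<close> holds bit \<open>r - j\<close>, so the matrices
    \<open>m\<close> appear in reverse order as images of the unit vectors.\<close>
  have elem: "(\<Sum>k<?N. f2_scale (vec_index (had_matrix r *\<^sub>v u) k) (outer (e k) (f k)))
      = (\<Sum>j<r + 1. f2_scale (vec_index u j) (m (r - j) \<Phi>))" if u: "u \<in> carrier_vec (r + 1)" for u
  proof -
    have "(\<Sum>k<?N. f2_scale (vec_index (had_matrix r *\<^sub>v u) k) (outer (e k) (f k)))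
        = (\<Sum>k<?N. \<Sum>j<r + 1. f2_scale (vec_index u j) (f2_scale (of_bool (bit (row_value k) (r - j))) (outer (e k) (f k))))"
    proof (rule sum.cong[OF refl])
      fix k assume "k \<in> {..<?N}"
      hence k: "k < ?N" by simp
      show "f2_scale (vec_index (had_matrix r *\<^sub>v u) k) (outer (e k) (f k))
          = (\<Sum>j<r + 1. f2_scale (vec_index u j) (f2_scale (of_bool (bit (row_value k) (r - j))) (outer (e k) (f k))))"
        unfolding had_index[OF u k] V.scale_sum_left V.scale_scale by (simp only: mult.commute)
    qed
    also have "\<dots> = (\<Sum>j<r + 1. \<Sum>k<?N. f2_scale (vec_index u j) (f2_scale (of_bool (bit (row_value k) (r - j))) (outer (e k) (f k))))"
      by (rule sum.swap)
    finally show ?thesis unfolding m_eq V.scale_sum_right .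
  qed
  have "had_face r e f = LS {..<r + 1} \<Phi>"
  proof
    show "had_face r e f \<subseteq> LS {..<r + 1} \<Phi>"
    proof
      fix x assume "x \<in> had_face r e f"
      then obtain u where u: "u \<in> carrier_vec (r + 1)" "x = (\<Sum>j<r + 1. f2_scale (vec_index u j) (m (r - j) \<Phi>))"
        unfolding had_face_def using elem by auto
      show "x \<in> LS {..<r + 1} \<Phi>"
        unfolding u(2) LS_def by (intro V.span_sum V.span_scale V.span_base) auto
    qed
    have sub: "V.subspace (had_face r e f)"
    proof (rule subspace_matrixI)
      show "0 \<in> had_face r e f"
        unfolding had_face_def
      proof (rule CollectI, intro exI conjI)
        show "0\<^sub>v (r + 1) \<in> carrier_vec (r + 1)" by simp
        show "0 = (\<Sum>k<?N. f2_scale (vec_index (had_matrix r *\<^sub>v 0\<^sub>v (r + 1)) k) (outer (e k) (f k)))"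
          unfolding elem[OF zero_carrier_vec] by (intro sum.neutral[symmetric]) (auto simp: f2_scale_def)
      qed
      fix x y assume "x \<in> had_face r e f" "y \<in> had_face r e f"
      then obtain u v where u: "u \<in> carrier_vec (r + 1)" "x = (\<Sum>k<?N. f2_scale (vec_index (had_matrix r *\<^sub>v u) k) (outer (e k) (f k)))"
        and v: "v \<in> carrier_vec (r + 1)" "y = (\<Sum>k<?N. f2_scale (vec_index (had_matrix r *\<^sub>v v) k) (outer (e k) (f k)))"
        unfolding had_face_def by auto
      have uv: "u + v \<in> carrier_vec (r + 1)" using u v by simp
      show "x + y \<in> had_face r e f"
        unfolding had_face_def
      proof (rule CollectI, intro exI conjI)
        show "x + y = (\<Sum>k<?N. f2_scale (vec_index (had_matrix r *\<^sub>v (u + v)) k) (outer (e k) (f k)))"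
          unfolding u(2) v(2) elem[OF u(1)] elem[OF v(1)] elem[OF uv] sum.distrib[symmetric]
        proof (rule sum.cong[OF refl])
          fix j assume "j \<in> {..<r + 1}"
          hence "vec_index (u + v) j = vec_index u j + vec_index v j" using v(1) by simp
          thus "f2_scale (vec_index u j) (m (r - j) \<Phi>) + f2_scale (vec_index v j) (m (r - j) \<Phi>)
              = f2_scale (vec_index (u + v) j) (m (r - j) \<Phi>)"
            by (simp only: V.scale_left_distrib)
        qed
      qed (rule uv)
    qed
    have "m j \<Phi> \<in> had_face r e f" if "j < r + 1" for j
      unfolding had_face_def
    proof (rule CollectI, intro exI conjI)
      show c: "unit_vec (r + 1) (r - j) \<in> carrier_vec (r + 1)" by simp
      have "(\<Sum>i<r + 1. f2_scale (vec_index (unit_vec (r + 1) (r - j)) i) (m (r - i) \<Phi>))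
          = (\<Sum>i<r + 1. if i = r - j then m (r - i) \<Phi> else 0)"
        by (rule sum.cong[OF refl]) (auto simp: f2_scale_def)
      also have "\<dots> = m j \<Phi>" using that by (simp add: sum.delta del: sum.lessThan_Suc)
      finally show "m j \<Phi> = (\<Sum>k<?N. f2_scale (vec_index (had_matrix r *\<^sub>v unit_vec (r + 1) (r - j)) k) (outer (e k) (f k)))"
        unfolding elem[OF c] ..
    qed
    thus "LS {..<r + 1} \<Phi> \<subseteq> had_face r e f"
      unfolding LS_def by (intro V.span_minimal sub) auto
  qed
  moreover have "V.dim (LS {..<r + 1} \<Phi>) = r + 1" using dim_LS[OF \<Phi>] by simp
  moreover have "V.subspace (LS {..<r + 1} \<Phi>)" unfolding LS_def by (rule V.subspace_span)
  ultimately show ?thesis unfolding had_faces_def using e f by blast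
qed

text \<open>A dual frame of \<open>\<Phi>0\<close> detects the class of a vector: \<open>fst (\<Phi> k)\<close> is the image of a dual vector of \<open>\<Phi>\<close> under
  \<open>m j\<close>, or under a sum of two of them (this uses characteristic two).\<close>

lemma class_sums_determined:
  assumes \<Phi>: "\<Phi> \<in> frames" and \<Phi>0: "\<Phi>0 \<in> frames" and eq: "\<And>j. j < d \<Longrightarrow> m j \<Phi> = m j \<Phi>0" and c: "c \<noteq> 0"
  shows "psum {k. take_bit d (lab k) = c} \<Phi> = psum {k. take_bit d (lab k) = c} \<Phi>0"
proof -
  obtain \<zeta> \<eta>0 where d0: "dual \<zeta> (\<lambda>k. fst (\<Phi>0 k))" "dual \<eta>0 (\<lambda>k. snd (\<Phi>0 k))" by (rule framesE[OF \<Phi>0])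
  obtain \<zeta>1 \<eta> where d1: "dual \<zeta>1 (\<lambda>k. fst (\<Phi> k))" "dual \<eta> (\<lambda>k. snd (\<Phi> k))" by (rule framesE[OF \<Phi>])
  have mv: "m j \<Psi> *v v = (\<Sum>k\<in>ms j. dot (snd (\<Psi> k)) v *s fst (\<Psi> k))" for j \<Psi> v
    by (simp add: m_def psum_def sum_matrix_vec outer_mult_vec)
  have m_\<eta>: "m j \<Phi> *v \<eta> k = (if k \<in> ms j then fst (\<Phi> k) else 0)" for j k
  proof -
    have "m j \<Phi> *v \<eta> k = (\<Sum>l\<in>ms j. if l = k then fst (\<Phi> l) else 0)"
      unfolding mv by (rule sum.cong[OF refl]) (simp add: dot_commute[of "snd _"] dualD[OF d1(2)])
    thus ?thesis by (simp add: sum.delta)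
  qed
  have \<zeta>_m: "dot (\<zeta> l) (m j \<Phi>0 *v v) = (if l \<in> ms j then dot (snd (\<Phi>0 l)) v else 0)" for j l v
  proof -
    have "dot (\<zeta> l) (m j \<Phi>0 *v v) = (\<Sum>k\<in>ms j. if k = l then dot (snd (\<Phi>0 k)) v else 0)"
      unfolding mv dot_sum_right by (rule sum.cong[OF refl]) (simp add: dot_simps dualD[OF d0(1)])
    thus ?thesis by (simp add: sum.delta)
  qed
  have tb: "take_bit d (lab k) = take_bit d (lab l)" if "\<And>j. j < d \<Longrightarrow> k \<in> ms j \<longleftrightarrow> l \<in> ms j" for k l
    using that by (auto intro!: bit_eqI simp: bit_take_bit_iff ms_def)
  have ex_bit: "\<exists>j<d. k \<in> ms j" if "take_bit d (lab k) \<noteq> 0" for k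
  proof (rule ccontr)
    assume "\<not> ?thesis"
    hence "take_bit d (lab k) = 0" by (auto intro!: bit_eqI simp: bit_take_bit_iff ms_def)
    thus False using that by simp
  qed
  have vanish: "dot (\<zeta> l) (fst (\<Phi> k)) = 0"
    if k: "take_bit d (lab k) \<noteq> 0" and ne: "take_bit d (lab l) \<noteq> take_bit d (lab k)" for k l
  proof (cases "\<exists>j<d. k \<in> ms j \<and> l \<notin> ms j")
    case True
    then obtain j where j: "j < d" "k \<in> ms j" "l \<notin> ms j" by blast
    have "fst (\<Phi> k) = m j \<Phi>0 *v \<eta> k" using m_\<eta>[of j k] j eq by simp
    thus ?thesis using \<zeta>_m[of l j "\<eta> k"] j by simp
  next
    case False
    obtain j where j: "j < d" "k \<in> ms j" using ex_bit[OF k] by blast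
    hence lj: "l \<in> ms j" using False by blast
    obtain i where i: "i < d" "k \<notin> ms i" "l \<in> ms i" using tb[of l k] ne False by blast
    have "fst (\<Phi> k) = m j \<Phi>0 *v \<eta> k + m i \<Phi>0 *v \<eta> k" using m_\<eta>[of j k] m_\<eta>[of i k] i j eq by simp
    thus ?thesis using \<zeta>_m[of l j "\<eta> k"] \<zeta>_m[of l i "\<eta> k"] lj i by (simp add: dot_simps char2)
  qed
  let ?C = "{k. take_bit d (lab k) = c}"
  have "\<zeta> l v* psum ?C \<Phi> = \<zeta> l v* psum ?C \<Phi>0" for l
  proof -
    have row: "\<zeta> l v* psum K \<Psi> = (\<Sum>k\<in>K. dot (\<zeta> l) (fst (\<Psi> k)) *s snd (\<Psi> k))" for K \<Psi>
      by (simp add: psum_def vec_mult_sum vec_mult_outer)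
    have vanish0: "dot (\<zeta> l) (fst (\<Phi>0 k)) = 0" if "take_bit d (lab l) \<noteq> take_bit d (lab k)" for k
      using that dualD[OF d0(1), of l k] by auto
    show ?thesis
    proof (cases "l \<in> ?C")
      case False
      have "\<zeta> l v* psum ?C \<Phi> = 0"
        unfolding row by (rule sum.neutral) (use vanish[of _ l] False c in auto)
      moreover have "\<zeta> l v* psum ?C \<Phi>0 = 0"
        unfolding row by (rule sum.neutral) (use vanish0 False in auto)
      ultimately show ?thesis by simp
    next
      case True
      \<comment> \<open>A set bit of the class: the whole class lies in \<open>ms j\<close>, and
        \<open>\<zeta> l\<close> does not see the other labels of \<open>ms j\<close>, so it has the
        same product with the class sum as with \<open>m j\<close>.\<close>
      then obtain j where j: "j < d" "l \<in> ms j" using ex_bit[of l] c by auto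
      have C_sub: "?C \<subseteq> ms j"
      proof
        fix k assume "k \<in> ?C"
        hence "bit (take_bit d (lab k)) j = bit (take_bit d (lab l)) j" using True by simp
        thus "k \<in> ms j" using j by (simp add: bit_take_bit_iff ms_def)
      qed
      have nz: "take_bit d (lab k) \<noteq> 0" if "k \<in> ms j" for k
      proof
        assume "take_bit d (lab k) = 0"
        hence "\<not> bit (take_bit d (lab k)) j" by simp
        thus False using that j by (simp add: bit_take_bit_iff ms_def)
      qed
      have "\<zeta> l v* psum ?C \<Phi> = \<zeta> l v* m j \<Phi>"
        unfolding m_def row
        by (rule sum.mono_neutral_left[OF _ C_sub]) (use vanish[of _ l] nz True in auto)
      also have "\<dots> = \<zeta> l v* m j \<Phi>0" using eq[OF j(1)] by simp
      also have "\<dots> = \<zeta> l v* psum ?C \<Phi>0"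
        unfolding m_def row
        by (rule sum.mono_neutral_right[OF _ C_sub]) (use vanish0 True in auto)
      finally show ?thesis .
    qed
  qed
  hence "dot (\<zeta> l) (psum ?C \<Phi> *v v) = dot (\<zeta> l) (psum ?C \<Phi>0 *v v)" for l v
    by (simp flip: dot_vector_matrix_mult)
  hence "psum ?C \<Phi> *v v = psum ?C \<Phi>0 *v v" for v by (rule frame_ext[OF d0(1)])
  thus ?thesis by (simp add: matrix_eq)
qed

end

section \<open>Links and their random walks\<close>

text \<open>Carries \<open>second_eigenvalue_le\<close> over to the enumeration chosen by
  \<open>vertex_list\<close>. \<open>p\<close> is the transition matrix, which is symmetric for the
  regular graphs considered here.\<close>

lemma graph_lambda_le:
  fixes V :: "'a set" and w p :: "'a \<Rightarrow> 'a \<Rightarrow> real"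
  assumes fin: "finite V" and two: "2 \<le> card V"
    and w: "\<And>x y. x \<in> V \<Longrightarrow> y \<in> V \<Longrightarrow> w x y / degree_in V w x = p x y"
    and sym: "\<And>x y. x \<in> V \<Longrightarrow> y \<in> V \<Longrightarrow> p x y = p y x"
    and rows: "\<And>x. x \<in> V \<Longrightarrow> (\<Sum>y\<in>V. p x y) = 1"
    and bound: "\<And>f. (\<Sum>x\<in>V. f x) = 0 \<Longrightarrow>
      \<bar>\<Sum>x\<in>V. \<Sum>y\<in>V. f x * p x y * f y\<bar> \<le> \<epsilon> * (\<Sum>x\<in>V. (f x)\<^sup>2)"
  shows "graph_lambda V w \<le> \<epsilon>"
proof -
  define vs where "vs = vertex_list V"
  have vs: "distinct vs" "set vs = V"
    using someI_ex[of "\<lambda>vs. distinct vs \<and> set vs = V"] finite_distinct_list[OF fin]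
    unfolding vs_def vertex_list_def by blast+
  define N where "N = card V"
  have len: "length vs = N" using distinct_card[OF vs(1)] vs(2) by (simp add: N_def)
  have bij: "bij_betw ((!) vs) {..<N} V" by (rule bij_betw_nth[OF vs(1)]) (simp_all add: len vs)
  have mem: "vs ! i \<in> V" if "i < N" for i using bij that by (auto simp: bij_betw_def)
  have sum: "(\<Sum>i<N. g (vs ! i)) = (\<Sum>x\<in>V. g x)" for g :: "'a \<Rightarrow> real"
    by (rule sum.reindex_bij_betw[OF bij])
  have "walk_matrix V w = Matrix.mat N N (\<lambda>(i, j). complex_of_real (p (vs ! i) (vs ! j)))"
    unfolding walk_matrix_def N_def[symmetric] vs_def[symmetric]
    by (rule Matrix.eq_matI) (simp_all add: Let_def w mem flip: of_real_divide)
  moreover have "rev (sorted_list_of_multiset (image_mset cmod (proots (char_poly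
    (Matrix.mat N N (\<lambda>(i, j). complex_of_real (p (vs ! i) (vs ! j)))))))) ! 1 \<le> \<epsilon>"
  proof (rule second_eigenvalue_le)
    show "2 \<le> N" using two by (simp add: N_def)
    show "p (vs ! i) (vs ! j) = p (vs ! j) (vs ! i)" if "i < N" "j < N" for i j
      by (intro sym mem that)
    show "(\<Sum>j<N. p (vs ! i) (vs ! j)) = 1" if "i < N" for i
      unfolding sum by (intro rows mem that)
    fix f :: "nat \<Rightarrow> real" assume f: "(\<Sum>i<N. f i) = 0"
    define f' where "f' x = f (inv_into {..<N} ((!) vs) x)" for x
    have f': "f i = f' (vs ! i)" if "i < N" for i
      unfolding f'_def using bij_betw_inv_into_left[OF bij] that by simp
    have "(\<Sum>x\<in>V. f' x) = 0" using f by (simp add: f' flip: sum)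
    hence "\<bar>\<Sum>x\<in>V. \<Sum>y\<in>V. f' x * p x y * f' y\<bar> \<le> \<epsilon> * (\<Sum>x\<in>V. (f' x)\<^sup>2)" by (rule bound)
    thus "\<bar>\<Sum>i<N. \<Sum>j<N. f i * p (vs ! i) (vs ! j) * f j\<bar> \<le> \<epsilon> * (\<Sum>i<N. (f i)\<^sup>2)"
      by (simp add: f' flip: sum)
  qed
  ultimately show ?thesis by (simp add: graph_lambda_def)
qed

lemma matrix_add_conj:
  "A ** (X + Y) ** B = A ** X ** B + A ** Y ** (B :: 'q::field ^ 'n::finite ^ 'n)"
  by (simp add: matrix_eq matrix_vector_mult_add_rdistrib matrix_vector_right_distrib
    flip: matrix_vector_mul_assoc)

lemma psum_pair_map_eq: "psum K (pair_map A B \<Phi>) = A ** psum K \<Phi> ** transpose B"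
  by (simp add: matrix_eq psum_pair_map transpose_matrix_vector flip: matrix_vector_mul_assoc)

context had_labels
begin

text \<open>X \<mapsto> A X B^T is additive, so the preimage \<open>?C\<close> of a span is a
  subspace and it is enough to look at generators.\<close>

lemma LS_pair_map_subset:
  assumes "LS K \<Phi> \<subseteq> LS K' \<Phi>'"
  shows "LS K (pair_map A B \<Phi>) \<subseteq> LS K' (pair_map A B \<Phi>')"
proof -
  let ?C = "{X. A ** X ** transpose B \<in> LS K' (pair_map A B \<Phi>')}"
  have "(A ** 0 ** transpose B :: 'q ^ 'n ^ 'n) = 0"
    using matrix_add_conj[of A 0 0 "transpose B"] by simp
  hence sub: "V.subspace ?C"
    by (intro subspace_matrixI) (auto simp: LS_def matrix_add_conj V.span_zero V.span_add)
  have "m j \<Phi>' \<in> ?C" if "j \<in> K'" for j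
  proof -
    have "m j (pair_map A B \<Phi>') \<in> LS K' (pair_map A B \<Phi>')"
      unfolding LS_def by (rule V.span_base) (use that in blast)
    thus ?thesis by (simp add: m_def psum_pair_map_eq)
  qed
  hence "LS K' \<Phi>' \<subseteq> ?C" unfolding LS_def by (intro V.span_minimal sub[unfolded LS_def]) blast
  hence "m j \<Phi> \<in> ?C" if "j \<in> K" for j
    using assms that unfolding LS_def by (auto intro: V.span_base)
  hence "m j (pair_map A B \<Phi>) \<in> LS K' (pair_map A B \<Phi>')" if "j \<in> K" for j
    using that by (simp add: m_def psum_pair_map_eq)
  thus ?thesis unfolding LS_def[of K] by (intro V.span_minimal) (auto simp: LS_def V.subspace_span)
qed

lemma LS_pair_map: "LS K \<Phi> = LS K' \<Phi>' \<Longrightarrow> LS K (pair_map A B \<Phi>) = LS K' (pair_map A B \<Phi>')"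
  by (rule subset_antisym; rule LS_pair_map_subset) simp_all

lemma subspace_eq_of_dim:
  assumes "A \<subseteq> B" "V.subspace A" "V.dim A = V.dim B"
  shows "A = B"
proof -
  obtain S where S: "S \<subseteq> A" "V.independent S" "A \<subseteq> V.span S" "card S = V.dim A"
    by (rule V.basis_exists)
  obtain T where T: "S \<subseteq> T" "T \<subseteq> B" "V.independent T" "B \<subseteq> V.span T"
    using V.maximal_independent_subset_extend[of S B] S(1,2) assms(1) by blast
  have "card T = V.dim B" by (rule V.basis_card_eq_dim[OF T(2,4,3)])
  hence "S = T" using S(4) assms(3) by (intro card_subset_eq T(1)) simp_all
  moreover have "V.span S \<subseteq> A" by (rule V.span_minimal[OF S(1) assms(2)])
  ultimately show ?thesis using T(4) assms(1) by blast
qed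

lemma independent_sequence:
  assumes "\<And>j. j < e \<Longrightarrow> \<mu> j \<notin> V.span (\<mu> ` {..<j})"
  shows "inj_on \<mu> {..<e} \<and> V.independent (\<mu> ` {..<e :: nat})"
  using assms
proof (induction e)
  case (Suc e)
  have IH: "inj_on \<mu> {..<e}" "V.independent (\<mu> ` {..<e})"
    using Suc.IH[OF Suc.prems[OF less_SucI]] by simp_all
  have e: "\<mu> e \<notin> V.span (\<mu> ` {..<e})" using Suc.prems by blast
  hence "\<mu> e \<notin> \<mu> ` {..<e}" by (rule contrapos_nn) (rule V.span_base)
  moreover have "inj_on \<mu> (insert e {..<e})"
    unfolding inj_on_insert using IH(1) \<open>\<mu> e \<notin> \<mu> ` {..<e}\<close> by simp
  ultimately show ?case
    unfolding lessThan_Suc image_insert using V.independent_insertI[OF e IH(2)] by blast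
qed (simp add: V.independent_empty)

abbreviation cx :: "('q ^ 'n ^ 'n) weighted_complex"
  where "cx \<equiv> had_complex r"

lemma elems_cx: "elems cx = {x. V.subspace x \<and> (\<exists>F\<in>had_faces r. x \<subseteq> F)}"
  and rk_cx: "rk cx x = int (V.dim x) - 1"
  and wt_cx: "wt cx x = 1 / card (level cx (rk cx x))"
  by (simp_all add: had_complex_def Let_def level_def)

lemma LS_elems:
  assumes "\<Phi> \<in> frames" "K \<subseteq> {..<r + 1}"
  shows "LS K \<Phi> \<in> elems cx"
proof -
  have "LS K \<Phi> \<subseteq> LS {..<r + 1} \<Phi>" unfolding LS_def by (intro V.span_mono image_mono assms)
  moreover have "V.subspace (LS K \<Phi>)" unfolding LS_def by (rule V.subspace_span)
  ultimately show ?thesis unfolding elems_cx using face_of_frame[OF assms(1)] by blast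
qed

text \<open>Extend the sequence to a basis of a face containing \<open>z\<close> and apply
  \<open>frame_of_face_basis\<close>.\<close>

lemma frame_of_sequence:
  assumes z: "z \<in> elems cx" and \<mu>: "\<And>j. j < e \<Longrightarrow> \<mu> j \<in> z"
    and inj: "inj_on \<mu> {..<e}" and ind: "V.independent (\<mu> ` {..<e})"
  obtains \<Phi> where "\<Phi> \<in> frames" "\<And>j. j < e \<Longrightarrow> m j \<Phi> = \<mu> j"
proof -
  obtain F where F: "F \<in> had_faces r" "z \<subseteq> F" using z by (auto simp: elems_cx)
  have dimF: "V.dim F = r + 1" using F by (simp add: had_faces_def)
  have "\<mu> ` {..<e} \<subseteq> F" using \<mu> F(2) by auto
  then obtain B where B: "\<mu> ` {..<e} \<subseteq> B" "B \<subseteq> F" "V.independent B" "F \<subseteq> V.span B"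
    by (rule V.maximal_independent_subset_extend[OF _ ind])
  have cardB: "card B = r + 1" using V.basis_card_eq_dim[OF B(2,4,3)] dimF by simp
  have card_\<mu>: "card (\<mu> ` {..<e}) = e" using card_image[OF inj] by simp
  have e: "e \<le> r + 1" using card_mono[OF _ B(1)] cardB card_\<mu> by simp
  have "card (B - \<mu> ` {..<e}) = card {e..<r + 1}"
    using card_Diff_subset[OF _ B(1)] cardB card_\<mu> by simp
  then obtain g where g: "bij_betw g {e..<r + 1} (B - \<mu> ` {..<e})"
    using finite_same_card_bij[of "{e..<r + 1}" "B - \<mu> ` {..<e}"] by auto
  define \<nu> where "\<nu> j = (if j < e then \<mu> j else g j)" for j
  have "bij_betw \<nu> ({..<e} \<union> {e..<r + 1}) (\<mu> ` {..<e} \<union> (B - \<mu> ` {..<e}))"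
  proof (rule bij_betw_combine)
    show "bij_betw \<nu> {..<e} (\<mu> ` {..<e})"
      using inj by (subst bij_betw_cong[of _ _ \<mu>]) (simp_all add: \<nu>_def bij_betw_def)
    show "bij_betw \<nu> {e..<r + 1} (B - \<mu> ` {..<e})"
      using g by (subst bij_betw_cong[of _ _ g]) (simp_all add: \<nu>_def)
  qed blast
  moreover have "{..<e} \<union> {e..<r + 1} = {..<r + 1}" "\<mu> ` {..<e} \<union> (B - \<mu> ` {..<e}) = B"
    using e B(1) by auto
  ultimately have \<nu>: "bij_betw \<nu> {..<r + 1} B" by simp
  obtain \<Phi> where \<Phi>: "\<Phi> \<in> frames" "\<And>j. j < r + 1 \<Longrightarrow> m j \<Phi> = \<nu> j"
  proof (rule frame_of_face_basis[OF F(1), of \<nu>])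
    show "inj_on \<nu> {..<r + 1}" using \<nu> by (rule bij_betw_imp_inj_on)
    show "V.independent (\<nu> ` {..<r + 1})" using \<nu> B(3) by (simp add: bij_betw_def)
    show "\<nu> j \<in> F" if "j < r + 1" for j using \<nu> B(2) that by (auto simp: bij_betw_def)
  qed blast
  have "m j \<Phi> = \<mu> j" if "j < e" for j using \<Phi>(2)[of j] that e by (simp add: \<nu>_def)
  with \<Phi>(1) show ?thesis by (rule that)
qed

lemma frame_of_elem:
  assumes "x \<in> elems cx"
  obtains \<Phi> where "\<Phi> \<in> frames" "x = LS {..<V.dim x} \<Phi>"
proof -
  have sub: "V.subspace x" using assms by (simp add: elems_cx)
  obtain B where B: "B \<subseteq> x" "V.independent B" "x \<subseteq> V.span B" "card B = V.dim x"
    by (rule V.basis_exists)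
  obtain g where g: "bij_betw g {..<V.dim x} B"
    using finite_same_card_bij[of "{..<V.dim x}" B] B(4) by auto
  have img: "g ` {..<V.dim x} = B" using g by (simp add: bij_betw_def)
  obtain \<Phi> where \<Phi>: "\<Phi> \<in> frames" "\<And>j. j < V.dim x \<Longrightarrow> m j \<Phi> = g j"
  proof (rule frame_of_sequence[OF assms, of "V.dim x" g])
    show "g j \<in> x" if "j < V.dim x" for j using img B(1) that by blast
    show "inj_on g {..<V.dim x}" using g by (rule bij_betw_imp_inj_on)
    show "V.independent (g ` {..<V.dim x})" using B(2) img by simp
  qed blast
  have "(\<lambda>j. m j \<Phi>) ` {..<V.dim x} = B" using \<Phi>(2) img by auto
  hence "LS {..<V.dim x} \<Phi> = V.span B" by (simp add: LS_def)
  also have "\<dots> = x" using B(3) V.span_minimal[OF B(1) sub] by blast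
  finally show ?thesis using that \<Phi>(1) by blast
qed

end

section \<open>The link of one element, described by pairs of frames\<close>

locale had_link = had_labels lab r ty
  for lab :: "'n::finite \<Rightarrow> nat" and r and ty :: "'q::{field,finite} itself" +
  fixes d :: nat and \<Phi>0 :: "('q, 'n) pairs"
  assumes d: "d + 2 \<le> r + 1" and \<Phi>0: "\<Phi>0 \<in> frames"
begin

sublocale C: config "\<lambda>k. take_bit d (lab k)" "\<lambda>c. psum {k. take_bit d (lab k) = c} \<Phi>0" .

text \<open>Each \<open>m j\<close> with \<open>j < d\<close> is the sum of the class sums whose
  class has bit \<open>j\<close>, and these classes are nonzero; the converse is
  \<open>class_sums_determined\<close>.\<close>

lemma \<Omega>_iff: "\<Phi> \<in> C.\<Omega> \<longleftrightarrow> \<Phi> \<in> frames \<and> (\<forall>j<d. m j \<Phi> = m j \<Phi>0)"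
proof
  assume \<Phi>: "\<Phi> \<in> C.\<Omega>"
  have "m j \<Phi> = m j \<Phi>0" if j: "j < d" for j
  proof -
    let ?t = "\<lambda>k. take_bit d (lab k)"
    have cl: "{k \<in> ms j. ?t k = c} = C.cls c" if "c \<in> ?t ` ms j" for c
    proof -
      have "bit c j" using that j by (auto simp: ms_def bit_take_bit_iff)
      thus ?thesis using j by (auto simp: C.cls_def ms_def bit_take_bit_iff)
    qed
    have nz: "c \<noteq> 0" if c: "c \<in> ?t ` ms j" for c
    proof
      assume "c = 0"
      moreover obtain k where "k \<in> ms j" "c = ?t k" using c by blast
      ultimately have "bit (0::nat) j" using j by (metis bit_take_bit_iff mem_Collect_eq ms_def)
      thus False by simp
    qed
    have m_sum: "m j \<Psi> = (\<Sum>c\<in>?t ` ms j. psum (C.cls c) \<Psi>)" for \<Psi> :: "('q, 'n) pairs"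
    proof -
      have "m j \<Psi> = (\<Sum>c\<in>?t ` ms j. \<Sum>k\<in>{k \<in> ms j. ?t k = c}. outer (fst (\<Psi> k)) (snd (\<Psi> k)))"
        unfolding m_def psum_def by (rule sum.group[symmetric]) simp_all
      also have "\<dots> = (\<Sum>c\<in>?t ` ms j. psum (C.cls c) \<Psi>)"
        by (rule sum.cong[OF refl]) (simp only: cl psum_def)
      finally show ?thesis .
    qed
    show ?thesis unfolding m_sum
    proof (rule sum.cong[OF refl])
      fix c assume "c \<in> ?t ` ms j"
      hence "c \<noteq> 0" by (rule nz)
      thus "psum (C.cls c) \<Phi> = psum (C.cls c) \<Phi>0" using \<Phi> by (simp add: C.\<Omega>_def C.cls_def)
    qed
  qed
  thus "\<Phi> \<in> frames \<and> (\<forall>j<d. m j \<Phi> = m j \<Phi>0)" using \<Phi> by (simp add: C.\<Omega>_def)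
next
  assume *: "\<Phi> \<in> frames \<and> (\<forall>j<d. m j \<Phi> = m j \<Phi>0)"
  hence eq: "m j \<Phi> = m j \<Phi>0" if "j < d" for j using that by blast
  have "psum (C.cls c) \<Phi> = psum {k. take_bit d (lab k) = c} \<Phi>0" if "c \<noteq> 0" for c
    unfolding C.cls_def by (rule class_sums_determined[OF conjunct1[OF *] \<Phi>0 eq that])
  thus "\<Phi> \<in> C.\<Omega>" using * by (simp add: C.\<Omega>_def)
qed

text \<open>\<open>W\<close> and \<open>W'\<close> are the two ends of the edge of the link that an
  element of \<open>\<Omega>\<close> describes.\<close>

definition W :: "('q, 'n) pairs \<Rightarrow> ('q ^ 'n ^ 'n) set"
  where "W \<Phi> = LS (insert d {..<d}) \<Phi>"

definition W' :: "('q, 'n) pairs \<Rightarrow> ('q ^ 'n ^ 'n) set"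
  where "W' \<Phi> = LS (insert (d + 1) {..<d}) \<Phi>"

definition x0 :: "('q ^ 'n ^ 'n) set"
  where "x0 = LS {..<d} \<Phi>0"

definition Vx :: "('q ^ 'n ^ 'n) set set"
  where "Vx = level (link cx x0) 0"

lemma LS_x0: "\<Phi> \<in> C.\<Omega> \<Longrightarrow> LS {..<d} \<Phi> = x0"
  unfolding x0_def LS_def \<Omega>_iff by (intro arg_cong[where f = V.span] image_cong) auto

lemma dim_x0: "V.dim x0 = d"
  unfolding x0_def using dim_LS[OF \<Phi>0, of "{..<d}"] d by simp

text \<open>After the shift of ranks, vertices of the link have dimension \<open>d + 1\<close> and
  its elements of rank 1 have dimension \<open>d + 2\<close>.\<close>

lemma level_link: "level (link cx x0) i = {y \<in> elems cx. x0 \<subseteq> y \<and> int (V.dim y) = int d + 1 + i}"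
  by (auto simp: level_def link_def Let_def rk_cx dim_x0)

lemma Vx_iff: "y \<in> Vx \<longleftrightarrow> y \<in> elems cx \<and> x0 \<subseteq> y \<and> V.dim y = d + 1"
  by (auto simp: Vx_def level_link)

lemma elems_subspace: "y \<in> elems cx \<Longrightarrow> V.subspace y"
  by (simp add: elems_cx)

lemma LS_mono: "K \<subseteq> L \<Longrightarrow> LS K \<Phi> \<subseteq> LS L \<Phi>"
  unfolding LS_def by (intro V.span_mono image_mono)

lemma W_Vx:
  assumes "\<Phi> \<in> C.\<Omega>"
  shows "W \<Phi> \<in> Vx" "W' \<Phi> \<in> Vx" "W \<Phi> \<noteq> W' \<Phi>"
proof -
  have \<Phi>: "\<Phi> \<in> frames" using assms by (simp add: \<Omega>_iff)
  have x0: "x0 \<subseteq> W \<Phi>" "x0 \<subseteq> W' \<Phi>"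
    unfolding W_def W'_def LS_x0[OF assms, symmetric] by (rule LS_mono, blast)+
  have sub: "insert d {..<d} \<subseteq> {..<r + 1}" "insert (d + 1) {..<d} \<subseteq> {..<r + 1}" using d by auto
  have "V.dim (W \<Phi>) = d + 1" "V.dim (W' \<Phi>) = d + 1"
    unfolding W_def W'_def dim_LS[OF \<Phi> sub(1)] dim_LS[OF \<Phi> sub(2)] by simp_all
  thus "W \<Phi> \<in> Vx" "W' \<Phi> \<in> Vx"
    unfolding Vx_iff using x0 LS_elems[OF \<Phi> sub(1)] LS_elems[OF \<Phi> sub(2)] by (simp_all add: W_def W'_def)
  have "m d \<Phi> \<in> W \<Phi>" unfolding W_def LS_def by (rule V.span_base) simp
  moreover have "m d \<Phi> \<notin> W' \<Phi>" unfolding W'_def by (rule m_notin_span[OF \<Phi>]) (use d in auto)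
  ultimately show "W \<Phi> \<noteq> W' \<Phi>" by blast
qed

lemma \<Phi>0_\<Omega>: "\<Phi>0 \<in> C.\<Omega>"
  by (simp add: \<Omega>_iff \<Phi>0)

text \<open>\<open>W \<Phi>\<close> is spanned by \<open>x0\<close> and \<open>m d \<Phi>\<close>,
  both inside \<open>v\<close>, and its dimension is that of \<open>v\<close>; likewise for
  \<open>W' \<Phi>\<close>.\<close>

lemma W_eqI:
  assumes "\<Phi> \<in> C.\<Omega>" "v \<in> Vx"
  shows "m d \<Phi> \<in> v \<Longrightarrow> W \<Phi> = v" "m (d + 1) \<Phi> \<in> v \<Longrightarrow> W' \<Phi> = v"
proof -
  have v: "V.subspace v" "x0 \<subseteq> v" "V.dim v = d + 1"
    using assms(2) elems_subspace by (auto simp: Vx_iff)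
  have m: "m j \<Phi> \<in> v" if "j < d" for j
  proof -
    have "m j \<Phi> \<in> LS {..<d} \<Phi>" unfolding LS_def by (rule V.span_base) (use that in simp)
    thus ?thesis using v(2) LS_x0[OF assms(1)] by blast
  qed
  have dims: "V.dim (W \<Phi>) = V.dim v" "V.dim (W' \<Phi>) = V.dim v" using W_Vx(1,2)[OF assms(1)] v(3) by (simp_all add: Vx_iff)
  have sub: "V.subspace (W \<Phi>)" "V.subspace (W' \<Phi>)" by (simp_all add: W_def W'_def LS_def V.subspace_span)
  show "W \<Phi> = v" if "m d \<Phi> \<in> v"
  proof (rule subspace_eq_of_dim[OF _ sub(1) dims(1)])
    show "W \<Phi> \<subseteq> v" unfolding W_def LS_def by (rule V.span_minimal[OF _ v(1)]) (use m that in auto)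
  qed
  show "W' \<Phi> = v" if "m (d + 1) \<Phi> \<in> v"
  proof (rule subspace_eq_of_dim[OF _ sub(2) dims(2)])
    show "W' \<Phi> \<subseteq> v" unfolding W'_def LS_def by (rule V.span_minimal[OF _ v(1)]) (use m that in auto)
  qed
qed

lemma m_indep0:
  assumes "j < d"
  shows "m j \<Phi>0 \<notin> V.span ((\<lambda>j. m j \<Phi>0) ` {..<j})"
  using m_notin_span[OF \<Phi>0, of j "{..<j}"] assms d by (simp add: LS_def)

text \<open>The basis of \<open>x0\<close> given by \<open>\<Phi>0\<close>, followed by
  \<open>a\<close> and \<open>b\<close>, is an independent sequence in \<open>z\<close>, so
  \<open>frame_of_sequence\<close> applies.\<close>

lemma lift_pair:
  assumes z: "z \<in> elems cx" "x0 \<subseteq> z" and a: "a \<in> z" "a \<notin> x0"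
    and b: "b \<in> z" "b \<notin> V.span (insert a x0)"
  obtains \<Phi> where "\<Phi> \<in> C.\<Omega>" "m d \<Phi> = a" "m (d + 1) \<Phi> = b"
proof -
  define \<mu> where "\<mu> j = (if j < d then m j \<Phi>0 else if j = d then a else b)" for j
  have \<mu>_d: "\<mu> ` {..<j} = (\<lambda>j. m j \<Phi>0) ` {..<j}" if "j \<le> d" for j
    using that by (intro image_cong) (auto simp: \<mu>_def)
  have span_d: "V.span (\<mu> ` {..<d}) = x0" unfolding \<mu>_d[OF order.refl] by (simp add: x0_def LS_def)
  have notin: "\<mu> j \<notin> V.span (\<mu> ` {..<j})" if j: "j < d + 2" for j
  proof -
    consider "j < d" | "j = d" | "j = d + 1" using j by linarith
    thus ?thesis
    proof cases
      case 1
      thus ?thesis using m_indep0[OF 1] \<mu>_d[of j] by (simp add: \<mu>_def)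
    next
      case 2
      thus ?thesis using span_d a(2) by (simp add: \<mu>_def)
    next
      case 3
      have "\<mu> ` {..<d + 1} = insert a (\<mu> ` {..<d})" by (auto simp: \<mu>_def lessThan_Suc)
      moreover have "\<mu> ` {..<d} \<subseteq> x0" unfolding span_d[symmetric] by (rule V.span_superset)
      ultimately have "V.span (\<mu> ` {..<d + 1}) \<subseteq> V.span (insert a x0)" by (intro V.span_mono) auto
      thus ?thesis using b(2) 3 by (auto simp: \<mu>_def)
    qed
  qed
  have ind: "inj_on \<mu> {..<d + 2}" "V.independent (\<mu> ` {..<d + 2})"
    using independent_sequence[of "d + 2" \<mu>] notin by blast+
  have in_z: "\<mu> j \<in> z" if "j < d + 2" for j
  proof (cases "j < d")
    case True
    hence "\<mu> j \<in> x0" unfolding span_d[symmetric] by (intro V.span_base) simp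
    thus ?thesis using z(2) by blast
  qed (use a(1) b(1) in \<open>simp add: \<mu>_def\<close>)
  obtain \<Phi> where \<Phi>: "\<Phi> \<in> frames" "\<And>j. j < d + 2 \<Longrightarrow> m j \<Phi> = \<mu> j"
    by (rule frame_of_sequence[OF z(1) _ ind], erule in_z, rule that)
  show ?thesis
  proof (rule that)
    show "\<Phi> \<in> C.\<Omega>" using \<Phi> by (simp add: \<Omega>_iff \<mu>_def)
    show "m d \<Phi> = a" "m (d + 1) \<Phi> = b" using \<Phi>(2) by (simp_all add: \<mu>_def)
  qed
qed

lemma W_surj:
  assumes "y \<in> Vx"
  obtains \<Phi> where "\<Phi> \<in> C.\<Omega>" "W \<Phi> = y"
proof -
  have y: "y \<in> elems cx" "x0 \<subseteq> y" "V.dim y = d + 1" using assms by (simp_all add: Vx_iff)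
  have "y \<noteq> x0" using y(3) dim_x0 by auto
  then obtain a where a: "a \<in> y" "a \<notin> x0" using y(2) by blast
  define \<mu> where "\<mu> j = (if j < d then m j \<Phi>0 else a)" for j
  have \<mu>_d: "\<mu> ` {..<j} = (\<lambda>j. m j \<Phi>0) ` {..<j}" if "j \<le> d" for j
    using that by (intro image_cong) (auto simp: \<mu>_def)
  have span_d: "V.span (\<mu> ` {..<d}) = x0" unfolding \<mu>_d[OF order.refl] by (simp add: x0_def LS_def)
  have notin: "\<mu> j \<notin> V.span (\<mu> ` {..<j})" if j: "j < d + 1" for j
  proof (cases "j < d")
    case True
    thus ?thesis using m_indep0[OF True] \<mu>_d[of j] by (simp add: \<mu>_def)
  next
    case False
    hence "j = d" using j by simp
    thus ?thesis using span_d a(2) by (simp add: \<mu>_def)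
  qed
  have ind: "inj_on \<mu> {..<d + 1}" "V.independent (\<mu> ` {..<d + 1})"
    using independent_sequence[of "d + 1" \<mu>] notin by blast+
  have in_y: "\<mu> j \<in> y" if "j < d + 1" for j
  proof (cases "j < d")
    case True
    hence "\<mu> j \<in> x0" unfolding span_d[symmetric] by (intro V.span_base) simp
    thus ?thesis using y(2) by blast
  qed (use a(1) in \<open>simp add: \<mu>_def\<close>)
  obtain \<Phi> where \<Phi>: "\<Phi> \<in> frames" "\<And>j. j < d + 1 \<Longrightarrow> m j \<Phi> = \<mu> j"
    by (rule frame_of_sequence[OF y(1) _ ind], erule in_y, rule that)
  have \<Omega>: "\<Phi> \<in> C.\<Omega>" using \<Phi> by (simp add: \<Omega>_iff \<mu>_def)
  have "m d \<Phi> = a" using \<Phi>(2)[of d] by (simp add: \<mu>_def)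
  hence "W \<Phi> = y" using W_eqI(1)[OF \<Omega> assms] a(1) by blast
  thus ?thesis using that \<Omega> by blast
qed

definition adj :: "('q ^ 'n ^ 'n) set \<Rightarrow> ('q ^ 'n ^ 'n) set \<Rightarrow> bool"
  where "adj v v' \<longleftrightarrow> (\<exists>\<Phi>\<in>C.\<Omega>. W \<Phi> = v \<and> W' \<Phi> = v')"

lemma m_notin_insert:
  assumes "\<Phi> \<in> C.\<Omega>"
  shows "m d \<Phi> \<notin> V.span (insert (m (d + 1) \<Phi>) x0)" "m (d + 1) \<Phi> \<notin> V.span (insert (m d \<Phi>) x0)"
proof -
  have \<Phi>: "\<Phi> \<in> frames" using assms by (simp add: \<Omega>_iff)
  have sub: "V.span (insert (m i \<Phi>) x0) \<subseteq> LS (insert i {..<d}) \<Phi>" for i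
  proof -
    have "m i \<Phi> \<in> LS (insert i {..<d}) \<Phi>" unfolding LS_def by (rule V.span_base) simp
    moreover have "x0 \<subseteq> LS (insert i {..<d}) \<Phi>" unfolding LS_x0[OF assms, symmetric] by (rule LS_mono) blast
    ultimately show ?thesis by (intro V.span_minimal) (auto simp: LS_def V.subspace_span)
  qed
  have "m d \<Phi> \<notin> LS (insert (d + 1) {..<d}) \<Phi>" "m (d + 1) \<Phi> \<notin> LS (insert d {..<d}) \<Phi>"
    by (rule m_notin_span[OF \<Phi>]; use d in auto)+
  thus "m d \<Phi> \<notin> V.span (insert (m (d + 1) \<Phi>) x0)" "m (d + 1) \<Phi> \<notin> V.span (insert (m d \<Phi>) x0)"
    using sub by blast+
qed

lemma m_in_LS: "j \<in> K \<Longrightarrow> m j \<Phi> \<in> LS K \<Phi>"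
  unfolding LS_def by (rule V.span_base) blast

lemma Z_level:
  assumes "\<Phi> \<in> C.\<Omega>"
  shows "LS {..<d + 2} \<Phi> \<in> elems cx" "x0 \<subseteq> LS {..<d + 2} \<Phi>" "V.dim (LS {..<d + 2} \<Phi>) = d + 2"
proof -
  have \<Phi>: "\<Phi> \<in> frames" using assms by (simp add: \<Omega>_iff)
  have sub: "{..<d + 2} \<subseteq> {..<r + 1}" using d by auto
  show "LS {..<d + 2} \<Phi> \<in> elems cx" by (rule LS_elems[OF \<Phi> sub])
  show "x0 \<subseteq> LS {..<d + 2} \<Phi>" unfolding LS_x0[OF assms, symmetric] by (rule LS_mono) auto
  show "V.dim (LS {..<d + 2} \<Phi>) = d + 2" using dim_LS[OF \<Phi> sub] by simp
qed

text \<open>\<open>lift_pair\<close> accepts the two new matrices of an edge in the opposite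
  order.\<close>

lemma adj_sym:
  assumes "adj v v'"
  shows "adj v' v"
proof -
  obtain \<Phi> where \<Phi>: "\<Phi> \<in> C.\<Omega>" "W \<Phi> = v" "W' \<Phi> = v'" using assms by (auto simp: adj_def)
  have "m (d + 1) \<Phi> \<notin> x0" using m_notin_insert(2)[OF \<Phi>(1)] V.span_superset by blast
  moreover have "m d \<Phi> \<in> LS {..<d + 2} \<Phi>" "m (d + 1) \<Phi> \<in> LS {..<d + 2} \<Phi>" by (rule m_in_LS; simp)+
  ultimately obtain \<Psi> where \<Psi>: "\<Psi> \<in> C.\<Omega>" "m d \<Psi> = m (d + 1) \<Phi>" "m (d + 1) \<Psi> = m d \<Phi>"
    using lift_pair[OF Z_level(1,2)[OF \<Phi>(1)], of "m (d + 1) \<Phi>" "m d \<Phi>"] m_notin_insert(1)[OF \<Phi>(1)] by blast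
  have V: "v \<in> Vx" "v' \<in> Vx" using W_Vx[OF \<Phi>(1)] \<Phi>(2,3) by simp_all
  have "m d \<Phi> \<in> v" "m (d + 1) \<Phi> \<in> v'" unfolding \<Phi>(2,3)[symmetric] W_def W'_def by (rule m_in_LS; simp)+
  hence "W \<Psi> = v'" "W' \<Psi> = v"
    using W_eqI(1)[OF \<Psi>(1) V(2)] W_eqI(2)[OF \<Psi>(1) V(1)] \<Psi>(2,3) by simp_all
  thus ?thesis using \<Psi>(1) by (auto simp: adj_def)
qed

lemma adj_of_level:
  assumes v: "v \<in> Vx" "v' \<in> Vx" "v \<noteq> v'" and z: "z \<in> elems cx" "v \<subseteq> z" "v' \<subseteq> z"
  shows "adj v v'"
proof -
  have v1: "V.subspace v" "x0 \<subseteq> v" "V.dim v = d + 1" and v2: "V.subspace v'" "x0 \<subseteq> v'" "V.dim v' = d + 1"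
    using v elems_subspace by (auto simp: Vx_iff)
  have "\<not> v \<subseteq> v'" "\<not> v' \<subseteq> v"
    using subspace_eq_of_dim[of v v'] subspace_eq_of_dim[of v' v] v1 v2 v(3) by auto
  then obtain a b where ab: "a \<in> v" "a \<notin> v'" "b \<in> v'" "b \<notin> v" by blast
  have "V.span (insert a x0) \<subseteq> v" by (rule V.span_minimal[OF _ v1(1)]) (use ab v1 in auto)
  hence b: "b \<notin> V.span (insert a x0)" using ab by blast
  have "x0 \<subseteq> z" "a \<in> z" "a \<notin> x0" "b \<in> z" using ab v1 v2 z by blast+
  then obtain \<Phi> where \<Phi>: "\<Phi> \<in> C.\<Omega>" "m d \<Phi> = a" "m (d + 1) \<Phi> = b"
    using lift_pair[OF z(1) _ _ _ _ b] by blast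
  have "W \<Phi> = v" "W' \<Phi> = v'" using W_eqI(1)[OF \<Phi>(1) v(1)] W_eqI(2)[OF \<Phi>(1) v(2)] \<Phi> ab by simp_all
  thus ?thesis using \<Phi>(1) by (auto simp: adj_def)
qed

text \<open>The span of the two distinct ends is the only element of dimension \<open>d + 2\<close>
  above both, so the sum defining the edge weight has a single term.\<close>

lemma common_level:
  assumes "\<Phi> \<in> C.\<Omega>"
  shows "{z \<in> level (link cx x0) 1. W \<Phi> \<subset> z \<and> W' \<Phi> \<subset> z} = {LS {..<d + 2} \<Phi>}"
proof
  have W: "V.dim (W \<Phi>) = d + 1" "V.dim (W' \<Phi>) = d + 1" using W_Vx[OF assms] by (simp_all add: Vx_iff)
  have "W \<Phi> \<subseteq> LS {..<d + 2} \<Phi>" "W' \<Phi> \<subseteq> LS {..<d + 2} \<Phi>" unfolding W_def W'_def by (rule LS_mono; auto)+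
  hence "W \<Phi> \<subset> LS {..<d + 2} \<Phi>" "W' \<Phi> \<subset> LS {..<d + 2} \<Phi>" using W Z_level(3)[OF assms] by auto
  thus "{LS {..<d + 2} \<Phi>} \<subseteq> {z \<in> level (link cx x0) 1. W \<Phi> \<subset> z \<and> W' \<Phi> \<subset> z}"
    using Z_level[OF assms] by (simp add: level_link)
  show "{z \<in> level (link cx x0) 1. W \<Phi> \<subset> z \<and> W' \<Phi> \<subset> z} \<subseteq> {LS {..<d + 2} \<Phi>}"
  proof
    fix z assume "z \<in> {z \<in> level (link cx x0) 1. W \<Phi> \<subset> z \<and> W' \<Phi> \<subset> z}"
    hence z: "z \<in> elems cx" "V.dim z = d + 2" "W \<Phi> \<subseteq> z" "W' \<Phi> \<subseteq> z" by (auto simp: level_link)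
    have "m j \<Phi> \<in> z" if "j < d + 2" for j
    proof (cases "j = d + 1")
      case True
      thus ?thesis using z(4) m_in_LS[of j "insert (d + 1) {..<d}" \<Phi>] by (auto simp: W'_def)
    next
      case False
      hence "j \<in> insert d {..<d}" using that by auto
      thus ?thesis using z(3) m_in_LS[of j "insert d {..<d}" \<Phi>] by (auto simp: W_def)
    qed
    hence "LS {..<d + 2} \<Phi> \<subseteq> z" unfolding LS_def by (intro V.span_minimal elems_subspace z(1)) auto
    hence "LS {..<d + 2} \<Phi> = z"
      by (rule subspace_eq_of_dim) (use z(2) Z_level(3)[OF assms] in \<open>simp_all add: LS_def V.subspace_span\<close>)
    thus "z \<in> {LS {..<d + 2} \<Phi>}" by simp
  qed
qed

text \<open>Weights in one rank are equal and stay so when renormalised, so all edges of the link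
  weigh the same.\<close>

lemma skeleton_weight_adj:
  obtains w0 where "w0 \<noteq> 0" "\<And>v v'. v \<in> Vx \<Longrightarrow> v' \<in> Vx \<Longrightarrow> skeleton_weight (link cx x0) v v' = (if adj v v' then w0 else 0)"
proof -
  define L where "L = {z \<in> elems cx. x0 \<subseteq> z \<and> V.dim z = d + 2}"
  define N where "N = card (level cx (int d + 1))"
  have wt: "wt (link cx x0) z = (1 / N) / (card L * (1 / N))" if z: "z \<in> L" for z
  proof -
    have rk: "rk cx y = int d + 1" if "y \<in> L" for y using that by (simp add: L_def rk_cx)
    have eq: "{y \<in> {y \<in> elems cx. x0 \<subseteq> y}. rk cx y = rk cx z} = L"
      using z by (auto simp: L_def rk_cx)
    have "(\<Sum>y\<in>L. wt cx y) = (\<Sum>y\<in>L. 1 / N)" by (rule sum.cong[OF refl]) (simp add: wt_cx rk N_def)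
    thus ?thesis unfolding link_def Let_def weighted_complex.select_convs eq
      by (simp add: wt_cx rk[OF z] N_def)
  qed
  have Z0: "LS {..<d + 2} \<Phi>0 \<in> L" using Z_level[OF \<Phi>0_\<Omega>] by (simp add: L_def)
  hence "card L \<noteq> 0" by auto
  moreover have "LS {..<d + 2} \<Phi>0 \<in> level cx (int d + 1)" using Z0 by (simp add: L_def level_def rk_cx)
  hence "N \<noteq> 0" unfolding N_def by auto
  ultimately have w0: "(1 / N) / (card L * (1 / N)) \<noteq> 0" by simp
  have "skeleton_weight (link cx x0) v v' = (if adj v v' then (1 / N) / (card L * (1 / N)) else 0)"
    if v: "v \<in> Vx" "v' \<in> Vx" for v v'
  proof (cases "adj v v'")
    case True
    then obtain \<Phi> where \<Phi>: "\<Phi> \<in> C.\<Omega>" "W \<Phi> = v" "W' \<Phi> = v'" by (auto simp: adj_def)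
    have "LS {..<d + 2} \<Phi> \<in> L" using Z_level[OF \<Phi>(1)] by (simp add: L_def)
    moreover have "v \<noteq> v'" using W_Vx(3)[OF \<Phi>(1)] \<Phi>(2,3) by simp
    ultimately show ?thesis
      unfolding skeleton_weight_def \<Phi>(2,3)[symmetric] common_level[OF \<Phi>(1)] using True \<Phi> wt by simp
  next
    case False
    have none: "{z \<in> level (link cx x0) 1. v \<subset> z \<and> v' \<subset> z} = {}" if "v \<noteq> v'"
      using adj_of_level[OF v that] False by (auto simp: level_link)
    have "skeleton_weight (link cx x0) v v' = 0"
    proof (cases "v = v'")
      case ne: False
      show ?thesis unfolding skeleton_weight_def none[OF ne] by simp
    qed (simp add: skeleton_weight_def)
    thus ?thesis using False by simp
  qed
  thus ?thesis using that w0 by blast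
qed

end

section \<open>The random walk on the link as a random element of \<open>\<Omega>\<close>\<close>

context had_link
begin

definition \<kappa> :: real
  where "\<kappa> = card {\<Phi> \<in> C.\<Omega>. W \<Phi> = W \<Phi>0}"

text \<open>Divided by \<open>\<kappa>\<close>, this is the transition matrix of the walk on the
  link.\<close>

definition pair_count :: "('q ^ 'n ^ 'n) set \<Rightarrow> ('q ^ 'n ^ 'n) set \<Rightarrow> real"
  where "pair_count v v' = card {\<Phi> \<in> C.\<Omega>. W \<Phi> = v \<and> W' \<Phi> = v'}"

lemma card_W: "v \<in> Vx \<Longrightarrow> real (card {\<Phi> \<in> C.\<Omega>. W \<Phi> = v}) = \<kappa>"
proof -
  assume "v \<in> Vx"
  then obtain \<Phi> where \<Phi>: "\<Phi> \<in> C.\<Omega>" "W \<Phi> = v" by (rule W_surj)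
  have "card {\<Psi> \<in> C.\<Omega>. W \<Psi> = W \<Phi>} = card {\<Psi> \<in> C.\<Omega>. W \<Psi> = W \<Phi>0}"
    by (rule C.card_fiber[where key = W, OF \<Phi>(1) \<Phi>0_\<Omega>]) (unfold W_def, rule LS_pair_map)
  thus ?thesis using \<Phi>(2) by (simp add: \<kappa>_def)
qed

lemma \<kappa>_pos: "0 < \<kappa>"
proof -
  have "\<Phi>0 \<in> {\<Phi> \<in> C.\<Omega>. W \<Phi> = W \<Phi>0}" using \<Phi>0_\<Omega> by simp
  hence "0 < card {\<Phi> \<in> C.\<Omega>. W \<Phi> = W \<Phi>0}" unfolding card_gt_0_iff using finite by blast
  thus ?thesis by (simp add: \<kappa>_def)
qed

text \<open>By transitivity every adjacent pair of vertices is described by the same number of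
  elements of \<open>\<Omega>\<close>, so \<open>pair_count\<close> is proportional to the edge
  weights.\<close>

lemma pair_count_adj:
  obtains c where "0 < c" "\<And>v v'. pair_count v v' = (if adj v v' then c else 0)"
proof -
  define key where "key \<Phi> = (W \<Phi>, W' \<Phi>)" for \<Phi> :: "('q, 'n) pairs"
  have key: "key (pair_map A B \<Phi>) = key (pair_map A B \<Phi>')" if "key \<Phi> = key \<Phi>'" for A B \<Phi> \<Phi>'
    using that LS_pair_map unfolding key_def W_def W'_def prod.inject by blast
  define c where "c = card {\<Phi> \<in> C.\<Omega>. key \<Phi> = key \<Phi>0}"
  have pair_count: "pair_count v v' = card {\<Phi> \<in> C.\<Omega>. key \<Phi> = (v, v')}" for v v' by (simp add: pair_count_def key_def)
  have "pair_count v v' = c" if "adj v v'" for v v'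
  proof -
    obtain \<Phi> where \<Phi>: "\<Phi> \<in> C.\<Omega>" "key \<Phi> = (v, v')" using \<open>adj v v'\<close> by (auto simp: adj_def key_def)
    have "card {\<Psi> \<in> C.\<Omega>. key \<Psi> = key \<Phi>} = card {\<Psi> \<in> C.\<Omega>. key \<Psi> = key \<Phi>0}"
      by (rule C.card_fiber[where key = key, OF \<Phi>(1) \<Phi>0_\<Omega>]) (rule key)
    thus ?thesis by (simp add: pair_count c_def \<Phi>(2))
  qed
  moreover have "pair_count v v' = 0" if "\<not> adj v v'" for v v'
  proof -
    have "{\<Phi> \<in> C.\<Omega>. key \<Phi> = (v, v')} = {}" using that by (auto simp: adj_def key_def)
    thus ?thesis unfolding pair_count by simp
  qed
  moreover have "0 < c"
  proof -
    have "\<Phi>0 \<in> {\<Phi> \<in> C.\<Omega>. key \<Phi> = key \<Phi>0}" using \<Phi>0_\<Omega> by simp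
    thus ?thesis unfolding c_def by (auto simp: card_gt_0_iff)
  qed
  ultimately show ?thesis using that[of "real c"] by auto
qed

lemma pair_count_commute: "pair_count v v' = pair_count v' v"
proof -
  obtain c where "0 < c" and c: "\<And>v v'. pair_count v v' = (if adj v v' then c else 0)" by (rule pair_count_adj, rule that)
  show ?thesis unfolding c by (rule if_cong, blast intro: adj_sym) (rule refl)+
qed

lemma sum_W_W':
  fixes h :: "('q ^ 'n ^ 'n) set \<Rightarrow> ('q ^ 'n ^ 'n) set \<Rightarrow> real"
  shows "(\<Sum>\<Phi>\<in>C.\<Omega>. h (W \<Phi>) (W' \<Phi>)) = (\<Sum>v\<in>Vx. \<Sum>v'\<in>Vx. pair_count v v' * h v v')"
proof -
  have "(\<Sum>\<Phi>\<in>C.\<Omega>. h (W \<Phi>) (W' \<Phi>))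
      = (\<Sum>y\<in>Vx \<times> Vx. \<Sum>\<Phi>\<in>{\<Phi> \<in> C.\<Omega>. (W \<Phi>, W' \<Phi>) = y}. h (W \<Phi>) (W' \<Phi>))"
    by (rule sum.group[symmetric]) (use W_Vx in auto)
  also have "\<dots> = (\<Sum>y\<in>Vx \<times> Vx. pair_count (fst y) (snd y) * h (fst y) (snd y))"
    by (rule sum.cong[OF refl]) (auto simp: pair_count_def)
  finally show ?thesis by (simp add: sum.cartesian_product case_prod_beta)
qed

lemma sum_pair_count:
  assumes "v \<in> Vx"
  shows "(\<Sum>v'\<in>Vx. pair_count v v') = \<kappa>"
proof -
  have "(\<Sum>v'\<in>Vx. pair_count v v') = real (\<Sum>v'\<in>Vx. card {\<Phi> \<in> {\<Phi> \<in> C.\<Omega>. W \<Phi> = v}. W' \<Phi> = v'})"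
    unfolding pair_count_def of_nat_sum by (rule sum.cong[OF refl]) (simp add: conj_assoc)
  also have "(\<Sum>v'\<in>Vx. card {\<Phi> \<in> {\<Phi> \<in> C.\<Omega>. W \<Phi> = v}. W' \<Phi> = v'})
      = (\<Sum>v'\<in>Vx. \<Sum>\<Phi>\<in>{\<Phi> \<in> {\<Phi> \<in> C.\<Omega>. W \<Phi> = v}. W' \<Phi> = v'}. 1)" by simp
  also have "\<dots> = (\<Sum>\<Phi>\<in>{\<Phi> \<in> C.\<Omega>. W \<Phi> = v}. 1)"
    by (rule sum.group) (use W_Vx in auto)
  finally show ?thesis using card_W[OF assms] by simp
qed

text \<open>Both ends of the random edge are uniform on the vertices; for \<open>W'\<close> this
  follows from the symmetry of \<open>pair_count\<close>.\<close>

lemma sum_W: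
  "(\<Sum>\<Phi>\<in>C.\<Omega>. f (W \<Phi>)) = \<kappa> * (\<Sum>v\<in>Vx. f v)"
  "(\<Sum>\<Phi>\<in>C.\<Omega>. f (W' \<Phi>)) = \<kappa> * (\<Sum>v\<in>Vx. f v :: real)"
proof -
  show "(\<Sum>\<Phi>\<in>C.\<Omega>. f (W \<Phi>)) = \<kappa> * (\<Sum>v\<in>Vx. f v)"
    using sum_W_W'[of "\<lambda>v v'. f v"] by (simp add: sum_pair_count sum_distrib_left flip: sum_distrib_right)
  have "(\<Sum>\<Phi>\<in>C.\<Omega>. f (W' \<Phi>)) = (\<Sum>v'\<in>Vx. \<Sum>v\<in>Vx. pair_count v v' * f v')"
    unfolding sum_W_W'[of "\<lambda>v v'. f v'"] by (rule sum.swap)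
  also have "\<dots> = (\<Sum>v'\<in>Vx. \<kappa> * f v')"
  proof (rule sum.cong[OF refl])
    fix v' assume "v' \<in> Vx"
    thus "(\<Sum>v\<in>Vx. pair_count v v' * f v') = \<kappa> * f v'"
      using sum_pair_count[of v'] by (simp add: pair_count_commute[of _ v'] flip: sum_distrib_right)
  qed
  finally show "(\<Sum>\<Phi>\<in>C.\<Omega>. f (W' \<Phi>)) = \<kappa> * (\<Sum>v\<in>Vx. f v)" by (simp add: sum_distrib_left)
qed

text \<open>A vertex as a function of a single matrix, defined also outside \<open>\<Omega>\<close>,
  since \<open>depends\<close> quantifies over all pairs and not only over those in
  \<open>\<Omega>\<close>.\<close>

definition span_at :: "'q ^ 'n ^ 'n \<Rightarrow> ('q ^ 'n ^ 'n) set"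
  where "span_at A = V.span (insert A ((\<lambda>j. m j \<Phi>0) ` {..<d}))"

lemma W_span_at:
  assumes "\<Phi> \<in> C.\<Omega>"
  shows "W \<Phi> = span_at (m d \<Phi>)" "W' \<Phi> = span_at (m (d + 1) \<Phi>)"
proof -
  have "(\<lambda>j. m j \<Phi>) ` {..<d} = (\<lambda>j. m j \<Phi>0) ` {..<d}"
    using assms by (intro image_cong) (auto simp: \<Omega>_iff)
  thus "W \<Phi> = span_at (m d \<Phi>)" "W' \<Phi> = span_at (m (d + 1) \<Phi>)"
    by (simp_all add: W_def W'_def LS_def span_at_def)
qed

lemma admissible_m: "C.admissible (ms j) (\<lambda>\<Phi>. h (m j \<Phi>))"
  unfolding C.admissible_def C.depends_def C.T_inv_def
proof (intro conjI allI ballI impI)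
  fix \<Phi> \<Phi>' :: "('q, 'n) pairs" assume "\<forall>k\<in>ms j. \<Phi> k = \<Phi>' k"
  hence "m j \<Phi> = m j \<Phi>'" unfolding m_def psum_def by (intro sum.cong) simp_all
  thus "h (m j \<Phi>) = h (m j \<Phi>')" by (rule arg_cong)
next
  fix i k t and \<Phi> :: "('q, 'n) pairs" assume "i \<in> ms j" "k \<in> ms j" "i \<noteq> k"
  hence "m j (T i k t \<Phi>) = m j \<Phi>" unfolding m_def by (intro psum_T) simp_all
  thus "h (m j (T i k t \<Phi>)) = h (m j \<Phi>)" by (rule arg_cong)
qed

text \<open>The \<open>d\<close> low bits prescribe the class, and bits \<open>d\<close> and
  \<open>d + 1\<close> the cell; every value below \<open>2 ^ (d + 2)\<close> is a label because
  \<open>d + 2 \<le> r + 1\<close>. The last cell of class 0 contains label 0.\<close>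

lemma cells_ms: "c \<in> range (\<lambda>k. take_bit d (lab k)) \<Longrightarrow> C.cells (ms d) (ms (d + 1)) c"
proof -
  assume "c \<in> range (\<lambda>k. take_bit d (lab k))"
  hence c: "take_bit d c = c" by auto
  have ex: "\<exists>k. take_bit d (lab k) = c \<and> (k \<in> ms d \<longleftrightarrow> a) \<and> (k \<in> ms (d + 1) \<longleftrightarrow> b)" for a b
  proof -
    define v :: nat where "v = horner_sum of_bool 2 (map (\<lambda>j. if j < d then bit c j else if j = d then a else b) [0..<d + 2])"
    have bit_v: "bit v j \<longleftrightarrow> j < d + 2 \<and> (if j < d then bit c j else if j = d then a else b)" for j
      unfolding v_def bit_horner_sum_bit_iff by (auto simp del: upt_Suc)
    have "v < 2 ^ (d + 2)"
      using horner_sum_of_bool_2_less[of "map (\<lambda>j. if j < d then bit c j else if j = d then a else b) [0..<d + 2]"]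
      by (simp add: v_def del: upt_Suc)
    also have "\<dots> \<le> 2 ^ (r + 1)" using d by (intro power_increasing) auto
    finally obtain k where k: "lab k = v" using lab_ex by blast
    have "take_bit d v = take_bit d c" by (rule bit_eqI) (auto simp: bit_take_bit_iff bit_v)
    thus ?thesis using k c by (intro exI[of _ k]) (simp add: ms_def bit_v)
  qed
  show ?thesis
    unfolding C.cells_def C.cls_def
    using ex[of True True] ex[of True False] ex[of False True] ex[of False False] by blast
qed

text \<open>The quadratic form of the walk is \<open>1 / \<kappa>\<close> times the correlation of
  the values of \<open>f\<close> at the two ends of a random edge, and both norms are
  \<open>sqrt \<kappa>\<close> times that of \<open>f\<close>.\<close>

lemma walk_form_bound:
  assumes f: "(\<Sum>v\<in>Vx. f v) = 0"
  shows "\<bar>\<Sum>v\<in>Vx. \<Sum>v'\<in>Vx. f v * (pair_count v v' / \<kappa>) * f v'\<bar>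
    \<le> 2 * (1 / real CARD('q) + C.\<delta>0) * (\<Sum>v\<in>Vx. (f v)\<^sup>2)"
proof -
  define F G where "F = (\<lambda>\<Phi>. f (span_at (m d \<Phi>)))" and "G = (\<lambda>\<Phi>. f (span_at (m (d + 1) \<Phi>)))"
  have FG: "F \<Phi> = f (W \<Phi>)" "G \<Phi> = f (W' \<Phi>)" if "\<Phi> \<in> C.\<Omega>" for \<Phi>
    using W_span_at[OF that] by (simp_all add: F_def G_def)
  let ?\<epsilon> = "2 * (1 / real CARD('q) + C.\<delta>0)"
  have "\<bar>\<Sum>\<Phi>\<in>C.\<Omega>. F \<Phi> * G \<Phi>\<bar> \<le> ?\<epsilon> * (C.nrm F * C.nrm G)"
  proof (rule C.correlation)
    show "C.admissible (ms d) F" "C.admissible (ms (d + 1)) G" unfolding F_def G_def by (rule admissible_m)+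
    show "(\<Sum>\<Phi>\<in>C.\<Omega>. F \<Phi>) = 0" "(\<Sum>\<Phi>\<in>C.\<Omega>. G \<Phi>) = 0" using sum_W[of f] f by (simp_all add: FG)
  qed (rule cells_ms)
  moreover have "C.nrm F = sqrt (\<kappa> * (\<Sum>v\<in>Vx. (f v)\<^sup>2))" "C.nrm G = sqrt (\<kappa> * (\<Sum>v\<in>Vx. (f v)\<^sup>2))"
    using sum_W[of "\<lambda>v. (f v)\<^sup>2"] by (simp_all add: C.nrm_def FG)
  moreover have "0 \<le> \<kappa> * (\<Sum>v\<in>Vx. (f v)\<^sup>2)" using \<kappa>_pos by (simp add: sum_nonneg)
  ultimately have "\<bar>\<Sum>\<Phi>\<in>C.\<Omega>. F \<Phi> * G \<Phi>\<bar> \<le> ?\<epsilon> * (\<kappa> * (\<Sum>v\<in>Vx. (f v)\<^sup>2))" by simp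
  moreover have "(\<Sum>\<Phi>\<in>C.\<Omega>. F \<Phi> * G \<Phi>) = \<kappa> * (\<Sum>v\<in>Vx. \<Sum>v'\<in>Vx. f v * (pair_count v v' / \<kappa>) * f v')"
  proof -
    have "(\<Sum>\<Phi>\<in>C.\<Omega>. F \<Phi> * G \<Phi>) = (\<Sum>v\<in>Vx. \<Sum>v'\<in>Vx. pair_count v v' * (f v * f v'))"
      using sum_W_W'[of "\<lambda>v v'. f v * f v'"] by (simp add: FG)
    also have "\<dots> = \<kappa> * (\<Sum>v\<in>Vx. \<Sum>v'\<in>Vx. f v * (pair_count v v' / \<kappa>) * f v')"
      unfolding sum_distrib_left using \<kappa>_pos by (intro sum.cong refl) (simp add: field_simps)
    finally show ?thesis .
  qed
  ultimately have "\<kappa> * \<bar>\<Sum>v\<in>Vx. \<Sum>v'\<in>Vx. f v * (pair_count v v' / \<kappa>) * f v'\<bar> \<le> \<kappa> * (?\<epsilon> * (\<Sum>v\<in>Vx. (f v)\<^sup>2))"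
    using \<kappa>_pos by (simp add: abs_mult mult.left_commute)
  thus ?thesis using \<kappa>_pos by (rule mult_left_le_imp_le)
qed

lemma skeleton_lambda_link: "skeleton_lambda (link cx x0) \<le> 2 * (1 / real CARD('q) + C.\<delta>0)"
  unfolding skeleton_lambda_def Vx_def[symmetric]
proof (rule graph_lambda_le[where p = "\<lambda>v v'. pair_count v v' / \<kappa>"])
  show "finite Vx" by simp
  have "card {W \<Phi>0, W' \<Phi>0} \<le> card Vx" using W_Vx[OF \<Phi>0_\<Omega>] by (intro card_mono) auto
  thus "2 \<le> card Vx" using W_Vx(3)[OF \<Phi>0_\<Omega>] by simp
  obtain w0 where w0: "w0 \<noteq> 0"
    "\<And>v v'. v \<in> Vx \<Longrightarrow> v' \<in> Vx \<Longrightarrow> skeleton_weight (link cx x0) v v' = (if adj v v' then w0 else 0)"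
    using skeleton_weight_adj by blast
  obtain c where c: "0 < c" "\<And>v v'. pair_count v v' = (if adj v v' then c else 0)" by (rule pair_count_adj, rule that)
  have sw: "skeleton_weight (link cx x0) v v' = w0 / c * pair_count v v'" if "v \<in> Vx" "v' \<in> Vx" for v v'
    using w0(2)[OF that] c by simp
  show "skeleton_weight (link cx x0) v v' / degree_in Vx (skeleton_weight (link cx x0)) v = pair_count v v' / \<kappa>"
    if v: "v \<in> Vx" "v' \<in> Vx" for v v'
  proof -
    have "degree_in Vx (skeleton_weight (link cx x0)) v = w0 / c * (\<Sum>u\<in>Vx. pair_count v u)"
      unfolding degree_in_def sum_distrib_left by (rule sum.cong[OF refl]) (rule sw[OF v(1)])
    thus ?thesis using w0(1) c(1) by (simp add: sum_pair_count[OF v(1)] sw[OF v])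
  qed
  show "pair_count v v' / \<kappa> = pair_count v' v / \<kappa>" for v v' by (simp only: pair_count_commute)
  show "(\<Sum>v'\<in>Vx. pair_count v v' / \<kappa>) = 1" if "v \<in> Vx" for v
    using sum_pair_count[OF that] \<kappa>_pos by (simp flip: sum_divide_distrib)
qed (rule walk_form_bound)

text \<open>The left side is 4/q + 2/(q - 1); as 2/(q - 1) \<le> 4/q for q \<ge> 2, it is at most
  8/q.\<close>

lemma expansion_bound_le: "2 * (1 / real CARD('q) + C.\<delta>0) \<le> 11 / real CARD('q)"
proof -
  have "2 \<le> real CARD('q)" using two_le_card_field[where 'q = 'q] by simp
  thus ?thesis by (simp add: C.\<delta>0_def field_simps)
qed

end

lemma (in had_labels) skeleton_lambda_le:
  assumes "x \<in> elems cx" "V.dim x + 2 \<le> r + 1"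
  shows "skeleton_lambda (link cx x) \<le> 11 / real CARD('q)"
proof -
  obtain \<Phi> where \<Phi>: "\<Phi> \<in> frames" "x = LS {..<V.dim x} \<Phi>" by (rule frame_of_elem[OF assms(1)])
  interpret had_link lab r ty "V.dim x" \<Phi> by unfold_locales (use assms \<Phi> in auto)
  have "x0 = x" using \<Phi>(2) by (simp add: x0_def)
  thus ?thesis using skeleton_lambda_link expansion_bound_le by simp
qed

text \<open>Invert an injection of the labels into the indices and give label 0 to every index
  outside its image.\<close>

lemma ex_labels:
  assumes "2 ^ (r + 1) \<le> CARD('n::finite)"
  obtains lab :: "'n::finite \<Rightarrow> nat" where "\<And>k. lab k < 2 ^ (r + 1)" "\<And>v. v < 2 ^ (r + 1) \<Longrightarrow> \<exists>k. lab k = v"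
    "\<And>k l. lab k = lab l \<Longrightarrow> lab k \<noteq> 0 \<Longrightarrow> k = l"
proof -
  obtain g :: "nat \<Rightarrow> 'n" where g: "inj_on g {..<2 ^ (r + 1)}"
    using assms card_le_inj[of "{..<2 ^ (r + 1) :: nat}" "UNIV :: 'n set"] by auto
  define lab where "lab k = (if k \<in> g ` {..<2 ^ (r + 1)} then inv_into {..<2 ^ (r + 1)} g k else 0)" for k
  have lab_g: "lab (g v) = v" if "v < 2 ^ (r + 1)" for v
    using inv_into_f_f[OF g, of v] that by (simp add: lab_def)
  have g_lab: "g (lab k) = k" if "lab k \<noteq> 0" for k
  proof -
    have k: "k \<in> g ` {..<2 ^ (r + 1)}" using that unfolding lab_def by metis
    thus ?thesis unfolding lab_def if_P[OF k] by (rule f_inv_into_f)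
  qed
  show ?thesis
  proof (rule that[of lab])
    show "lab k < 2 ^ (r + 1)" for k
    proof (cases "k \<in> g ` {..<2 ^ (r + 1)}")
      case True
      thus ?thesis unfolding lab_def if_P[OF True] using inv_into_into[OF True] by simp
    qed (simp add: lab_def)
    show "\<exists>k. lab k = v" if "v < 2 ^ (r + 1)" for v using lab_g[OF that] by blast
    show "k = l" if eq: "lab k = lab l" and "lab k \<noteq> 0" for k l
    proof -
      have "k = g (lab k)" by (rule g_lab[symmetric]) fact
      also have "\<dots> = g (lab l)" by (simp only: eq)
      also have "\<dots> = l" by (rule g_lab) (use that in metis)
      finally show ?thesis .
    qed
  qed
qed

theorem theorem19:
  fixes r b n q :: nat
    and X :: "('q::{field,finite} ^ 'n::finite ^ 'n) weighted_complex"
  assumes "r \<ge> 1" and "b \<ge> 5" and "n \<ge> 2 ^ (r + 1)" and "q = 2 ^ b"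
    and "CARD('q) = q" and "CARD('n) = n"
    and "X = had_complex r"
  shows "local_expansion X \<le> 11 / real q"
proof -
  let ?X = "had_complex r :: ('q ^ 'n ^ 'n) weighted_complex"
  have n: "2 ^ (r + 1) \<le> CARD('n)" and q: "CARD('q) = 2 ^ b" using assms by simp_all
  obtain lab :: "'n \<Rightarrow> nat" where lab: "\<And>k. lab k < 2 ^ (r + 1)"
    "\<And>v. v < 2 ^ (r + 1) \<Longrightarrow> \<exists>k. lab k = v" "\<And>k l. lab k = lab l \<Longrightarrow> lab k \<noteq> 0 \<Longrightarrow> k = l"
    by (rule ex_labels[OF n], rule that) blast+
  have char2: "x + x = 0" for x :: 'q
    using exponent_two_matrix[OF q, where A = "\<chi> i j. x :: 'q ^ 'n ^ 'n"]
    by (simp only: Finite_Cartesian_Product.vec_eq_iff vector_add_component vec_lambda_beta zero_index simp_thms)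
  interpret had_labels lab r "TYPE('q)"
    by unfold_locales (rule char2, rule lab(1), erule lab(2), erule lab(3))
  have n': "2 ^ (r + 1) - 1 \<le> CARD('n)" using n by simp
  have rank: "complex_rank ?X = int r" by (rule had_complex_grassmannian(2)[OF q n'])
  have "local_expansion_at ?X i \<le> 11 / real CARD('q)" if i: "i \<in> {-1..int r - 2}" for i
    unfolding local_expansion_at_def
  proof (rule Max.boundedI)
    have "level ?X i \<noteq> {}" by (rule had_complex_grassmannian(3)[OF q n']) (use i in auto)
    thus "(\<lambda>x. skeleton_lambda (link ?X x)) ` level ?X i \<noteq> {}" by blast
    fix y assume "y \<in> (\<lambda>x. skeleton_lambda (link ?X x)) ` level ?X i"
    then obtain x where x: "x \<in> elems ?X" "int (V.dim x) - 1 = i" "y = skeleton_lambda (link ?X x)"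
      by (auto simp: level_def rk_cx)
    \<comment> \<open>Rank \<open>i \<le> r - 2\<close> means dimension at most
      \<open>r - 1\<close>, so the link has elements of rank 1.\<close>
    have "V.dim x + 2 \<le> r + 1" using x(2) i by auto
    thus "y \<le> 11 / real CARD('q)" unfolding x(3) by (rule skeleton_lambda_le[OF x(1)])
  qed simp
  hence "local_expansion ?X \<le> 11 / real CARD('q)"
    unfolding local_expansion_def rank using \<open>r \<ge> 1\<close> by (intro Max.boundedI) auto
  thus ?thesis using assms by simp
qed

end
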